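(* Let $\Omega\subseteq\mathbb{C}$ be an open set and let $S,T\subseteq\partial\Omega$ be such that $\overline{S}\cap\overline{T}=\emptyset$. Then $V(S,T,\Omega)\neq\emptyset$, where $V(S,T,\Omega)$ is the set (defined in the context) of functions $f\in H(\Omega)$, smooth on $\Omega\cup S$, some of whose Padé approximants approximate every rational function on the compact subsets of $(\mathbb{C}\setminus\overline{\Omega})\cup T$ in the chordal metric and simultaneously approximate $f$ on the compact subsets of $\Omega\cup S$ in the Euclidean metric.
   Context: Notation: $\mathbb{N}_0=\{0,1,2,\dots\}$; $H(\Omega)$ is the set of holomorphic functions on $\Omega$; closures and boundaries are taken in $\mathbb{C}$. Chordal metric on $\mathbb{C}\cup\{\infty\}$: $\chi(a,b)=\frac{|a-b|}{\sqrt{1+|a|^2}\sqrt{1+|b|^2}}$ for $a,b\in\mathbb{C}$, $\chi(a,\infty)=\frac{1}{\sqrt{1+|a|^2}}$, $\chi(\infty,\infty)=0$. Rational functions are regarded as maps into $\mathbb{C}\cup\{\infty\}$. Suprema over the empty set are $0$. Definition of $V(S,T,\Omega)$, for $S,T\subseteq\partial\Omega$: it is the set of all $f\in H(\Omega)$ such that every derivative $f^{(\ell)}$, $\ell\in\mathbb{N}_0$, extends continuously to $\Omega\cup S$ (the extension is still denoted $f^{(\ell)}$), and such that for every rational function $h$ and every compact set $J_2\subset(\mathbb{C}\setminus\overline{\Omega})\cup T$ there is a sequence $(p_n,q_n)_{n\ge1}$ in $\mathbb{N}_0\times\mathbb{N}_0$ with the following property: for every compact set $J_1\subset\Omega\cup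 S$ there is $n_0$ such that $f\in\mathcal{D}_{p_n,q_n}(\zeta)\cap E_{p_n,q_n,\zeta}(J_1\cup J_2)$ for all $\zeta\in J_1$ and $n\ge n_0$, and, as $n\to+\infty$, $$\sup_{\zeta\in J_1}\sup_{z\in J_1}\big|[f;p_n/q_n]_\zeta(z)-f(z)\big|\to0,\qquad \sup_{\zeta\in J_1}\sup_{z\in J_2}\chi\big([f;p_n/q_n]_\zeta(z),h(z)\big)\to0.$$ Padé approximants: for $\zeta\in\Omega\cup S$ put $a_n=f^{(n)}(\zeta)/n!$ for $n\ge0$ and $a_i=0$ for $i<0$. For $p,q\in\mathbb{N}_0$ the Padé approximant $[f;p/q]_\zeta$ is a rational function $A/B$ with $\deg A\le p$, $\deg B\le q$, $B(\zeta)\ne0$, whose Taylor coefficients at $\zeta$ of orders $0,\dots,p+q$ are $a_0,\dots,a_{p+q}$. One writes $f\in\mathcal{D}_{p,q}(\zeta)$ if $q=0$, or if $q\ge1$ and the $q\times q$ Hankel determinant $\det(a_{p-q+i+j-1})_{1\le i,j\le q}$ is non-zero; in that case $[f;p/q]_\zeta$ exists, is unique, and equals $A(f,\zeta)/B(f,\zeta)$ with the Jacobi formulas: $A(f,\zeta)(z)$ and $B(f,\zeta)(z)$ are the $(q+1)\times(q+1)$ determinants whose $i$-th row after the first ($i=1,\dots,q$) is $(a_{p-q+i},a_{p-q+i+1},\dots,a_{p+i})$ and whose first rows are respectively $\big((z-\zeta)^qS_{p-q}(z),(z-\zeta)^{q-1}S_{p-q+1}(z),\dots,S_p(z)\big)$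 and $\big((z-\zeta)^q,(z-\zeta)^{q-1},\dots,1\big)$, where $S_k(z)=\sum_{\nu=0}^ka_\nu(z-\zeta)^\nu$ for $k\ge0$ and $S_k=0$ for $k<0$. For a set $K\subset\mathbb{C}$, $f\in E_{p,q,\zeta}(K)$ means that the polynomials $A(f,\zeta)$ and $B(f,\zeta)$ given by the Jacobi formulas have no common zero in $K$. *)

theory Defs
  imports
    "HOL-Complex_Analysis.Complex_Analysis"
    "HOL-Computational_Algebra.Computational_Algebra"
    "HOL-Computational_Algebra.Field_as_Ring"
    "Jordan_Normal_Form.Determinant"
begin

datatype sphere = Fin complex | Infty

fun chordal :: "sphere \<Rightarrow> sphere \<Rightarrow> real" where
  "chordal (Fin a) (Fin b) = cmod (a - b) / (sqrt (1 + (cmod a)\<^sup>2) * sqrt (1 + (cmod b)\<^sup>2))"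
| "chordal (Fin a) Infty = 1 / sqrt (1 + (cmod a)\<^sup>2)"
| "chordal Infty (Fin b) = 1 / sqrt (1 + (cmod b)\<^sup>2)"
| "chordal Infty Infty = 0"

text \<open>The Euclidean distance, infinite when the first argument is the point at infinity (a pole).\<close>

fun euclid :: "sphere \<Rightarrow> complex \<Rightarrow> ennreal" where
  "euclid (Fin a) b = ennreal (cmod (a - b))"
| "euclid Infty b = \<infinity>"

text \<open>The library function \<open>quot_of_fract\<close> yields numerator and denominator in lowest terms,
  so the zeros of the denominator are exactly the poles.\<close>

definition rat_eval :: "complex poly fract \<Rightarrow> complex \<Rightarrow> sphere" where
  "rat_eval h z = (let (P, Q) = quot_of_fract h in
     if poly Q z = 0 then Infty else Fin (poly P z / poly Q z))"

definition extends_continuously :: "complex set \<Rightarrow> complex set \<Rightarrow> (complex \<Rightarrow> complex) \<Rightarrow> bool" where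
  "extends_continuously \<Omega> S g \<longleftrightarrow>
     (\<exists>G. continuous_on (\<Omega> \<union> S) G \<and> (\<forall>z\<in>\<Omega>. G z = g z))"

text \<open>The value at \<open>z\<close> of the (extended) \<open>l\<close>-th derivative. A continuous extension to boundary points
  is unique and given by the limit from within \<open>\<Omega>\<close>; values of \<open>f\<close> outside \<open>\<Omega>\<close> play no role.\<close>

definition deriv_ext :: "complex set \<Rightarrow> (complex \<Rightarrow> complex) \<Rightarrow> nat \<Rightarrow> complex \<Rightarrow> complex" where
  "deriv_ext \<Omega> f l z =
     (if z \<in> \<Omega> then (deriv ^^ l) f z else Lim (at z within \<Omega>) ((deriv ^^ l) f))"

definition taylor_coeff :: "complex set \<Rightarrow> (complex \<Rightarrow> complex) \<Rightarrow> complex \<Rightarrow> int \<Rightarrow> complex" where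
  "taylor_coeff \<Omega> f \<zeta> n = (if n < 0 then 0 else deriv_ext \<Omega> f (nat n) \<zeta> / fact (nat n))"

text \<open>All notions below depend on \<open>f\<close> only through its sequence \<open>a\<close> of Taylor coefficients
  at the centre \<open>\<zeta>\<close>.\<close>

definition is_pade :: "(int \<Rightarrow> complex) \<Rightarrow> nat \<Rightarrow> nat \<Rightarrow> complex \<Rightarrow> complex poly fract \<Rightarrow> bool" where
  "is_pade a p q \<zeta> R \<longleftrightarrow>
     (\<exists>A B. R = Fract A B \<and> degree A \<le> p \<and> degree B \<le> q \<and> poly B \<zeta> \<noteq> 0 \<and>
       (\<forall>n\<le>p + q. (deriv ^^ n) (\<lambda>z. poly A z / poly B z) \<zeta> / fact n = a (int n)))"

definition pade :: "(int \<Rightarrow> complex) \<Rightarrow> nat \<Rightarrow> nat \<Rightarrow> complex \<Rightarrow> complex poly fract" where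
  "pade a p q \<zeta> = (THE R. is_pade a p q \<zeta> R)"

text \<open>Matrix indices start at 0 here, hence the shift by one compared with
  \<open>det (a\<^bsub>p-q+i+j-1\<^esub>)\<close> for \<open>1 \<le> i, j \<le> q\<close>.\<close>

definition in_D :: "(int \<Rightarrow> complex) \<Rightarrow> nat \<Rightarrow> nat \<Rightarrow> bool" where
  "in_D a p q \<longleftrightarrow> q = 0 \<or>
     Determinant.det (Matrix.mat q q (\<lambda>(i, j). a (int p - int q + int i + int j + 1))) \<noteq> 0"

definition partial_sum :: "(int \<Rightarrow> complex) \<Rightarrow> complex \<Rightarrow> int \<Rightarrow> complex poly" where
  "partial_sum a \<zeta> k =
     (if k < 0 then 0 else \<Sum>\<nu>\<le>nat k. Polynomial.smult (a (int \<nu>)) ([:- \<zeta>, 1:] ^ \<nu>))"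

definition jacobi_num :: "(int \<Rightarrow> complex) \<Rightarrow> nat \<Rightarrow> nat \<Rightarrow> complex \<Rightarrow> complex poly" where
  "jacobi_num a p q \<zeta> = Determinant.det (Matrix.mat (q + 1) (q + 1) (\<lambda>(i, j).
     if i = 0 then [:- \<zeta>, 1:] ^ (q - j) * partial_sum a \<zeta> (int p - int q + int j)
     else [:a (int p - int q + int i + int j):]))"

definition jacobi_den :: "(int \<Rightarrow> complex) \<Rightarrow> nat \<Rightarrow> nat \<Rightarrow> complex \<Rightarrow> complex poly" where
  "jacobi_den a p q \<zeta> = Determinant.det (Matrix.mat (q + 1) (q + 1) (\<lambda>(i, j).
     if i = 0 then [:- \<zeta>, 1:] ^ (q - j)
     else [:a (int p - int q + int i + int j):]))"

definition in_E :: "(int \<Rightarrow> complex) \<Rightarrow> nat \<Rightarrow> nat \<Rightarrow> complex \<Rightarrow> complex set \<Rightarrow> bool" where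
  "in_E a p q \<zeta> K \<longleftrightarrow>
     \<not> (\<exists>z\<in>K. poly (jacobi_num a p q \<zeta>) z = 0 \<and> poly (jacobi_den a p q \<zeta>) z = 0)"

text \<open>Suprema are taken in \<open>ennreal\<close>, where the supremum of the empty set is 0. Functions on
  \<open>\<Omega>\<close> are represented by total functions, whose values outside \<open>\<Omega>\<close> are irrelevant.\<close>

definition V :: "complex set \<Rightarrow> complex set \<Rightarrow> complex set \<Rightarrow> (complex \<Rightarrow> complex) set" where
  "V S T \<Omega> = {f. f holomorphic_on \<Omega> \<and>
     (\<forall>l. extends_continuously \<Omega> S ((deriv ^^ l) f)) \<and>
     (\<forall>h J2. compact J2 \<and> J2 \<subseteq> (UNIV - closure \<Omega>) \<union> T \<longrightarrow>
       (\<exists>p q :: nat \<Rightarrow> nat. \<forall>J1. compact J1 \<and> J1 \<subseteq> \<Omega> \<union> S \<longrightarrow>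
         (\<exists>n0. \<forall>n\<ge>n0. \<forall>\<zeta>\<in>J1.
            in_D (taylor_coeff \<Omega> f \<zeta>) (p n) (q n) \<and>
            in_E (taylor_coeff \<Omega> f \<zeta>) (p n) (q n) \<zeta> (J1 \<union> J2)) \<and>
         ((\<lambda>n. SUP \<zeta>\<in>J1. SUP z\<in>J1.
             euclid (rat_eval (pade (taylor_coeff \<Omega> f \<zeta>) (p n) (q n) \<zeta>) z) (deriv_ext \<Omega> f 0 z))
           \<longlonglongrightarrow> 0) \<and>
         ((\<lambda>n. SUP \<zeta>\<in>J1. SUP z\<in>J2.
             ennreal (chordal (rat_eval (pade (taylor_coeff \<Omega> f \<zeta>) (p n) (q n) \<zeta>) z) (rat_eval h z)))
           \<longlonglongrightarrow> 0)))}"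

end

theory Submission imports Defs begin

text \<open>
  The function is a limit of rational functions \<open>f\<^sub>n = A\<^sub>n / B\<^sub>n\<close>, where \<open>f\<^sub>n\<close> is close to
  \<open>f\<^sub>n\<^sub>-\<^sub>1\<close>, with many derivatives, on a compact set \<open>K\<^sub>n\<^sub>-\<^sub>1\<close> and chordally close to a prescribed
  rational function \<open>h\<^sub>n\<close> on a compact set \<open>L\<^sub>n\<close>. For \<open>p = deg A\<^sub>n\<close> and \<open>q = deg B\<^sub>n\<close> the Pade approximant
  of \<open>f\<^sub>n\<close> at every centre is \<open>f\<^sub>n\<close> itself and its Hankel determinant does not vanish; since the
  Jacobi formulas are continuous in the Taylor coefficients, this persists approximately for
  every function whose Taylor coefficients are close to those of \<open>f\<^sub>n\<close>, in particular for the limit.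

  The frontier is covered by two closed sets \<open>M\<close>, \<open>M'\<close> disjoint from \<open>S\<close>, \<open>T\<close> respectively, and
  \<open>K\<^sub>n\<close>, \<open>L\<^sub>n\<close> consist of the points of the closure and of the complement of \<open>\<Omega>\<close> that keep away from
  \<open>M\<close>, \<open>M'\<close>. Poles outside \<open>K\<^sub>n\<close> can then be moved along segments that avoid \<open>K\<^sub>n\<close>, towards \<open>M\<close> or towards
  infinity, until they lie outside \<open>K\<^sub>n\<^sub>+\<^sub>1\<close>.

  If \<open>\<bar>Y/X\<bar>\<close> is tiny on \<open>K\<close> and huge on \<open>L\<close>, then \<open>(A\<^sub>1 X + A\<^sub>2 Y) / (B\<^sub>1 X + B\<^sub>2 Y)\<close> is close to \<open>A\<^sub>1 / B\<^sub>1\<close> on \<open>K\<close>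
  and chordally close to \<open>A\<^sub>2 / B\<^sub>2\<close> on \<open>L\<close>, wherever the poles are. Such \<open>X\<close>, \<open>Y\<close> replace Runge's theorem;
  they come from the discrete Laplacian of \<open>log \<bar>z\<bar>\<close>: the product of \<open>1 - 1 / (u - \<lambda>)\<^sup>4\<close> over the
  Gaussian integers \<open>\<lambda>\<close> of a fine grid near \<open>L\<close> is close to \<open>1\<close> far from \<open>L\<close>, while over a square box around \<open>u\<close>
  it telescopes to something of modulus at least \<open>9/4\<close>.
\<close>

section \<open>The chordal metric in homogeneous coordinates\<close>

text \<open>The point with homogeneous coordinates [a : b]. The pair (0, 0) is also sent to
  \<open>Infty\<close>, so metric estimates have to exclude it.\<close>

definition sphere_ratio :: "complex \<Rightarrow> complex \<Rightarrow> sphere" where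
  "sphere_ratio a b = (if b = 0 then Infty else Fin (a / b))"

lemma chordal_sphere_ratio:
  assumes "a \<noteq> 0 \<or> b \<noteq> 0" "c \<noteq> 0 \<or> d \<noteq> 0"
  shows "chordal (sphere_ratio a b) (sphere_ratio c d) =
    cmod (a * d - b * c) / (sqrt ((cmod a)\<^sup>2 + (cmod b)\<^sup>2) * sqrt ((cmod c)\<^sup>2 + (cmod d)\<^sup>2))"
proof -
  have s: "sqrt (1 + (cmod x / cmod y)\<^sup>2) = sqrt ((cmod x)\<^sup>2 + (cmod y)\<^sup>2) / cmod y" if "y \<noteq> 0" for x y
  proof -
    have "1 + (cmod x / cmod y)\<^sup>2 = ((cmod x)\<^sup>2 + (cmod y)\<^sup>2) / (cmod y)\<^sup>2"
      using that by (simp add: power_divide add_divide_distrib)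
    then show ?thesis by (simp add: real_sqrt_divide)
  qed
  consider "b = 0" "d = 0" | "b = 0" "d \<noteq> 0" | "b \<noteq> 0" "d = 0" | "b \<noteq> 0" "d \<noteq> 0" by blast
  then show ?thesis
  proof cases
    case 4
    have "a / b - c / d = (a * d - b * c) / (b * d)" using 4 by (simp add: field_simps)
    then show ?thesis using 4 by (simp add: sphere_ratio_def s norm_divide norm_mult)
  qed (use assms in \<open>auto simp: sphere_ratio_def s norm_mult norm_divide\<close>)
qed

text \<open>Since a d - b c = b (a - c) - a (b - d), the norm of the pair (a, b) cancels. Only the
  fixed pair (c, d) then needs a lower bound, and poles need no special treatment.\<close>

lemma chordal_sphere_ratio_le:
  assumes "a \<noteq> 0 \<or> b \<noteq> 0" "c \<noteq> 0 \<or> d \<noteq> 0"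
  shows "chordal (sphere_ratio a b) (sphere_ratio c d) \<le> (cmod (a - c) + cmod (b - d)) / sqrt ((cmod c)\<^sup>2 + (cmod d)\<^sup>2)"
proof -
  let ?r = "sqrt ((cmod a)\<^sup>2 + (cmod b)\<^sup>2)" and ?s = "sqrt ((cmod c)\<^sup>2 + (cmod d)\<^sup>2)"
  have r: "?r > 0" and s: "?s > 0"
    using assms by (auto simp: add_pos_nonneg add_nonneg_pos sum_power2_gt_zero_iff)
  have "a * d - b * c = b * (a - c) - a * (b - d)" by (simp add: algebra_simps)
  then have "cmod (a * d - b * c) \<le> cmod b * cmod (a - c) + cmod a * cmod (b - d)"
    by (metis norm_mult norm_triangle_ineq4)
  also have "\<dots> \<le> ?r * cmod (a - c) + ?r * cmod (b - d)"
    by (intro add_mono mult_right_mono real_le_rsqrt) auto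
  finally have "cmod (a * d - b * c) / (?r * ?s) \<le> (?r * cmod (a - c) + ?r * cmod (b - d)) / (?r * ?s)"
    using r s by (intro divide_right_mono) auto
  also have "\<dots> = (?r * (cmod (a - c) + cmod (b - d))) / (?r * ?s)" by (simp add: distrib_left)
  also have "\<dots> = (cmod (a - c) + cmod (b - d)) / ?s"
    using r by (intro mult_divide_mult_cancel_left) auto
  finally show ?thesis using chordal_sphere_ratio[OF assms] by simp
qed

text \<open>Stereographic projection onto the sphere |w|^2 + t^2 = t of diameter 1, with infinity at
  the origin. It embeds the chordal metric isometrically, which yields the triangle
  inequality.\<close>

fun stereo :: "sphere \<Rightarrow> complex \<times> real" where
  "stereo (Fin z) = ((1 / (1 + (cmod z)\<^sup>2)) *\<^sub>R z, 1 / (1 + (cmod z)\<^sup>2))"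
| "stereo Infty = (0, 0)"

lemma chordal_eq_dist_stereo: "chordal x y = dist (stereo x) (stereo y)"
proof -
  have pos: "1 + (cmod z)\<^sup>2 > 0" for z by (simp add: add_pos_nonneg)
  have nz: "1 + (cmod z)\<^sup>2 \<noteq> 0" for z using pos[of z] by simp
  have inf: "dist (stereo (Fin z)) (stereo Infty) = 1 / sqrt (1 + (cmod z)\<^sup>2)" for z
  proof -
    have "dist (stereo (Fin z)) (stereo Infty) = sqrt ((cmod z / (1 + (cmod z)\<^sup>2))\<^sup>2 + (1 / (1 + (cmod z)\<^sup>2))\<^sup>2)"
      using pos[of z] by (simp add: dist_prod_def)
    also have "(cmod z / (1 + (cmod z)\<^sup>2))\<^sup>2 + (1 / (1 + (cmod z)\<^sup>2))\<^sup>2 = ((cmod z)\<^sup>2 + 1) / (1 + (cmod z)\<^sup>2)\<^sup>2"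
      by (simp add: power_divide add_divide_distrib)
    also have "\<dots> = 1 / (1 + (cmod z)\<^sup>2)"
      using nz[of z] unfolding add.commute[of _ 1] power2_eq_square[of "1 + _"] by simp
    finally show ?thesis by (simp add: real_sqrt_divide)
  qed
  have fin: "dist (stereo (Fin z)) (stereo (Fin w)) = chordal (Fin z) (Fin w)" for z w
  proof -
    define p q where "p = 1 + (cmod z)\<^sup>2" and "q = 1 + (cmod w)\<^sup>2"
    have p: "p > 0" and q: "q > 0" using pos by (simp_all add: p_def q_def)
    have pz: "(Re z)\<^sup>2 + (Im z)\<^sup>2 = p - 1" and qw: "(Re w)\<^sup>2 + (Im w)\<^sup>2 = q - 1"
      by (simp_all add: p_def q_def cmod_power2)
    have e: "(cmod ((1 / p) *\<^sub>R z - (1 / q) *\<^sub>R w))\<^sup>2 + (1 / p - 1 / q)\<^sup>2 = (cmod (z - w))\<^sup>2 / (p * q)"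
    proof -
      have "(cmod ((1 / p) *\<^sub>R z - (1 / q) *\<^sub>R w))\<^sup>2 + (1 / p - 1 / q)\<^sup>2
        = (Re z / p - Re w / q)\<^sup>2 + (Im z / p - Im w / q)\<^sup>2 + (1 / p - 1 / q)\<^sup>2"
        by (simp add: cmod_power2)
      also have "\<dots> = ((Re z)\<^sup>2 + (Im z)\<^sup>2 + 1) / p\<^sup>2 + ((Re w)\<^sup>2 + (Im w)\<^sup>2 + 1) / q\<^sup>2
          - 2 * (Re z * Re w + Im z * Im w + 1) / (p * q)"
        by (simp add: power2_diff power_divide add_divide_distrib diff_divide_distrib distrib_left)
      also have "\<dots> = 1 / p + 1 / q - 2 * (Re z * Re w + Im z * Im w + 1) / (p * q)"
        unfolding pz qw power2_eq_square[of p] power2_eq_square[of q] using p q by simp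
      also have "\<dots> = (p + q - 2 - 2 * (Re z * Re w + Im z * Im w)) / (p * q)"
        using p q by (simp add: field_simps)
      also have "p + q - 2 - 2 * (Re z * Re w + Im z * Im w) = (cmod (z - w))\<^sup>2"
        using pz qw unfolding cmod_power2 by (simp add: power2_diff)
      finally show ?thesis .
    qed
    have "dist (stereo (Fin z)) (stereo (Fin w)) = sqrt ((cmod ((1 / p) *\<^sub>R z - (1 / q) *\<^sub>R w))\<^sup>2 + (1 / p - 1 / q)\<^sup>2)"
      by (simp add: dist_prod_def dist_norm p_def q_def)
    also have "\<dots> = cmod (z - w) / (sqrt p * sqrt q)"
      unfolding e by (simp add: real_sqrt_divide real_sqrt_mult)
    finally show ?thesis by (simp add: p_def q_def)
  qed
  show ?thesis
    by (cases x; cases y) (use fin inf in \<open>auto simp: dist_commute simp del: stereo.simps\<close>)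
qed

lemma chordal_triangle: "chordal x z \<le> chordal x y + chordal y z"
  unfolding chordal_eq_dist_stereo by (rule dist_triangle)

text \<open>\<open>rat_eval\<close> reduces to lowest terms A / B, which have no common zero. From A
  Q = P B the pairs (A, B) and (P, Q) are proportional at \<open>z\<close> as soon as the second one
  does not vanish there.\<close>

lemma rat_eval_Fract:
  assumes "poly P z \<noteq> 0 \<or> poly Q z \<noteq> 0" "Q \<noteq> 0"
  shows "rat_eval (Fract P Q) z = sphere_ratio (poly P z) (poly Q z)"
proof -
  obtain A B where AB: "quot_of_fract (Fract P Q) = (A, B)" by (cases "quot_of_fract (Fract P Q)")
  have B: "B \<noteq> 0" using snd_quot_of_fract_nonzero[of "Fract P Q"] AB by simp
  have "Fract A B = Fract P Q" using Fract_quot_of_fract[of "Fract P Q"] AB by simp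
  then have e: "A * Q = P * B" using B assms(2) by (simp add: eq_fract)
  have "coprime A B" using coprime_quot_of_fract[of "Fract P Q"] AB by simp
  then have cop: "poly A z \<noteq> 0 \<or> poly B z \<noteq> 0"
    using coprime_poly_0 by blast
  have ez: "poly A z * poly Q z = poly P z * poly B z" using e by (metis poly_mult)
  have iff: "poly B z = 0 \<longleftrightarrow> poly Q z = 0" using ez cop assms(1) by auto
  show ?thesis
    using ez iff by (auto simp: rat_eval_def AB sphere_ratio_def field_simps)
qed

lemma rat_eval_coprime_pair:
  obtains P Q where "coprime P Q" "Q \<noteq> 0" "h = Fract P Q"
    "\<And>z. poly P z \<noteq> 0 \<or> poly Q z \<noteq> 0" "\<And>z. rat_eval h z = sphere_ratio (poly P z) (poly Q z)"
proof -
  obtain A B where AB: "quot_of_fract h = (A, B)" by (cases "quot_of_fract h")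
  have B: "B \<noteq> 0" using snd_quot_of_fract_nonzero[of h] AB by simp
  have h: "h = Fract A B" using Fract_quot_of_fract[of h] AB by simp
  have cop: "coprime A B" using coprime_quot_of_fract[of h] AB by simp
  have nz: "poly A z \<noteq> 0 \<or> poly B z \<noteq> 0" for z using coprime_poly_0[OF cop] by blast
  show thesis
    by (rule that[OF cop B h nz]) (simp add: rat_eval_def AB sphere_ratio_def)
qed

lemma compact_pair_norm_ge:
  fixes a b :: "'a::topological_space \<Rightarrow> complex"
  assumes "compact L" "continuous_on L a" "continuous_on L b" "\<And>z. z \<in> L \<Longrightarrow> a z \<noteq> 0 \<or> b z \<noteq> 0"
  obtains \<delta> where "\<delta> > 0" "\<And>z. z \<in> L \<Longrightarrow> \<delta> \<le> sqrt ((cmod (a z))\<^sup>2 + (cmod (b z))\<^sup>2)"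
proof (cases "L = {}")
  case False
  have "continuous_on L (\<lambda>z. sqrt ((cmod (a z))\<^sup>2 + (cmod (b z))\<^sup>2))"
    using assms by (intro continuous_intros)
  then obtain z0 where z0: "z0 \<in> L" "\<forall>z\<in>L. sqrt ((cmod (a z0))\<^sup>2 + (cmod (b z0))\<^sup>2) \<le> sqrt ((cmod (a z))\<^sup>2 + (cmod (b z))\<^sup>2)"
    using continuous_attains_inf[OF assms(1) False] by blast
  moreover have "sqrt ((cmod (a z0))\<^sup>2 + (cmod (b z0))\<^sup>2) > 0"
    using assms(4)[OF z0(1)] by (auto simp: sum_power2_gt_zero_iff)
  ultimately show thesis using that by blast
qed (use that[of 1] in auto)

section \<open>Lattice products\<close>

text \<open>The factors (w - x - 1) / (w - x) and (w - x + 1) / (w - x) telescope separately along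
  the row, which leaves only its two ends.\<close>

lemma prod_row_telescope:
  fixes w :: complex
  assumes "\<And>x. x \<in> {- int R..int R} \<Longrightarrow> w \<noteq> of_int x"
  shows "(\<Prod>x\<in>{- int R..int R}. ((w - of_int x)\<^sup>2 - 1) / (w - of_int x)\<^sup>2)
    = (w\<^sup>2 - (of_nat R + 1)\<^sup>2) / (w\<^sup>2 - (of_nat R)\<^sup>2)"
  using assms
proof (induction R)
  case (Suc R)
  define a b :: complex where "a = of_nat R" and "b = a + 1"
  have wa: "w \<noteq> a" "w \<noteq> - a" "w \<noteq> b" "w \<noteq> - b"
    using Suc.prems[of "int R"] Suc.prems[of "- int R"] Suc.prems[of "int R + 1"] Suc.prems[of "- int R - 1"]
    by (auto simp: a_def b_def)
  have nz: "w - a \<noteq> 0" "w + a \<noteq> 0" "w - b \<noteq> 0" "w + b \<noteq> 0"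
    using wa by (auto simp: add_eq_0_iff2)
  have set: "{- int (Suc R)..int (Suc R)} = insert (- int R - 1) (insert (int R + 1) {- int R..int R})"
    by auto
  have fac: "w\<^sup>2 - c\<^sup>2 = (w - c) * (w + c)" for c by (simp add: algebra_simps power2_eq_square)
  have fac1: "(w - b)\<^sup>2 - 1 = (w - b - 1) * (w - a)" "(w + b)\<^sup>2 - 1 = (w + b + 1) * (w + a)"
    by (simp_all add: b_def algebra_simps power2_eq_square)
  \<comment> \<open>Here p1, ..., p6 stand for w - b - 1, w - a, w + b + 1, w + a, w - b, w +
    b.\<close>
  have cancel: "p3 * p4 / p6\<^sup>2 * (p1 * p2 / p5\<^sup>2 * (p5 * p6 / (p2 * p4))) = p1 * p3 / (p5 * p6)"
    if "p2 \<noteq> 0" "p4 \<noteq> 0" "p5 \<noteq> 0" "p6 \<noteq> 0" for p1 p2 p3 p4 p5 p6 :: complex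
    using that by (simp add: power2_eq_square mult_ac)
  have "(\<Prod>x\<in>{- int (Suc R)..int (Suc R)}. ((w - of_int x)\<^sup>2 - 1) / (w - of_int x)\<^sup>2)
      = ((w + b)\<^sup>2 - 1) / (w + b)\<^sup>2 * (((w - b)\<^sup>2 - 1) / (w - b)\<^sup>2 * ((w\<^sup>2 - b\<^sup>2) / (w\<^sup>2 - a\<^sup>2)))"
    unfolding set using Suc by (simp add: a_def b_def algebra_simps)
  also have "\<dots> = (w - b - 1) * (w + b + 1) / ((w - b) * (w + b))"
    unfolding fac fac1 using nz by (intro cancel)
  also have "\<dots> = (w\<^sup>2 - (b + 1)\<^sup>2) / (w\<^sup>2 - b\<^sup>2)"
    by (simp add: fac algebra_simps)
  finally show ?case by (simp add: a_def b_def add_ac)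
qed simp

lemma norm_ratio_ge:
  fixes u v :: complex
  assumes "(1 + t) * (cmod v)\<^sup>2 \<le> (cmod u)\<^sup>2" "v \<noteq> 0" "t \<ge> 0"
  shows "sqrt (1 + t) \<le> cmod (u / v)"
proof -
  have "1 + t \<le> (cmod u)\<^sup>2 / (cmod v)\<^sup>2" using assms by (simp add: pos_le_divide_eq)
  then show ?thesis by (intro real_le_lsqrt) (auto simp: norm_divide power_divide)
qed

text \<open>The quotient splits into the end factors at \<open>R\<close> and \<open>- R\<close>. For
  Re w in [0, 1] each numerator exceeds its denominator by at least 2 R - 1 in squared modulus,
  while the squared denominator is at most 2 (R + 1)^2; so each factor is at least the square root
  of the bound.\<close>

lemma norm_row_ge:
  fixes w :: complex
  assumes R: "R \<ge> 1" and w: "0 \<le> Re w" "Re w \<le> 1" "\<bar>Im w\<bar> \<le> real R + 1"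
    and nz: "w \<noteq> of_nat R" "w \<noteq> - of_nat R"
  shows "1 + (2 * real R - 1) / (2 * (real R + 1)\<^sup>2)
    \<le> cmod ((w\<^sup>2 - (of_nat R + 1)\<^sup>2) / (w\<^sup>2 - (of_nat R)\<^sup>2))"
proof -
  define a where "a = real R"
  define t where "t = (2 * a - 1) / (2 * (a + 1)\<^sup>2)"
  have a: "a \<ge> 1" using R by (simp add: a_def)
  have t: "t \<ge> 0" using a by (simp add: t_def)
  have im: "(Im w)\<^sup>2 \<le> (a + 1)\<^sup>2"
    using power_mono[OF w(3), of 2] by (simp add: a_def)
  have bound: "(1 + t) * (cmod v)\<^sup>2 \<le> (cmod u)\<^sup>2"
    if "(cmod v)\<^sup>2 \<le> 2 * (a + 1)\<^sup>2" "(cmod v)\<^sup>2 + (2 * a - 1) \<le> (cmod u)\<^sup>2" for u v :: complex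
  proof -
    have "t * (cmod v)\<^sup>2 \<le> t * (2 * (a + 1)\<^sup>2)" using that(1) t by (rule mult_left_mono)
    also have "\<dots> = 2 * a - 1" using a by (simp add: t_def)
    finally show ?thesis using that(2) by (simp add: algebra_simps)
  qed
  have sq: "(a - Re w)\<^sup>2 \<le> (a + 1)\<^sup>2" "(a + Re w)\<^sup>2 \<le> (a + 1)\<^sup>2"
    using a w by (auto intro!: power_mono)
  have 1: "sqrt (1 + t) \<le> cmod ((w - (of_real a + 1)) / (w - of_real a))"
    and 2: "sqrt (1 + t) \<le> cmod ((w + (of_real a + 1)) / (w + of_real a))"
  proof -
    have c: "(cmod (w + of_real c))\<^sup>2 = (c + Re w)\<^sup>2 + (Im w)\<^sup>2"
        "(cmod (w - of_real c))\<^sup>2 = (c - Re w)\<^sup>2 + (Im w)\<^sup>2" for c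
      by (simp_all add: cmod_power2 power2_commute add.commute)
    have e: "of_real a + 1 = complex_of_real (a + 1)" by simp
    have "(1 + t) * (cmod (w - of_real a))\<^sup>2 \<le> (cmod (w - of_real (a + 1)))\<^sup>2"
      using sq(1) im w by (intro bound; unfold c) (auto simp: power2_eq_square algebra_simps)
    moreover have "(1 + t) * (cmod (w + of_real a))\<^sup>2 \<le> (cmod (w + of_real (a + 1)))\<^sup>2"
      using sq(2) im w by (intro bound; unfold c) (auto simp: power2_eq_square algebra_simps)
    ultimately show "sqrt (1 + t) \<le> cmod ((w - (of_real a + 1)) / (w - of_real a))"
      "sqrt (1 + t) \<le> cmod ((w + (of_real a + 1)) / (w + of_real a))"
      unfolding e using nz t by (auto intro!: norm_ratio_ge simp: a_def add_eq_0_iff2)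
  qed
  have "1 + t = sqrt (1 + t) * sqrt (1 + t)" using t by simp
  also have "\<dots> \<le> cmod ((w - (of_real a + 1)) / (w - of_real a)) * cmod ((w + (of_real a + 1)) / (w + of_real a))"
    using 1 2 t by (intro mult_mono) auto
  also have "\<dots> = cmod ((w\<^sup>2 - (of_nat R + 1)\<^sup>2) / (w\<^sup>2 - (of_nat R)\<^sup>2))"
    unfolding norm_mult[symmetric] a_def
    by (simp add: power2_eq_square algebra_simps)
  finally show ?thesis by (simp add: t_def a_def)
qed

text \<open>A single row gains a factor 1 + t with t of order 1 / R. By Bernoulli the 2 R + 1 rows
  together gain a constant that does not depend on \<open>R\<close>.\<close>

lemma norm_rows_ge:
  fixes w :: "int \<Rightarrow> complex"
  assumes R: "R \<ge> 2"
    and w: "\<And>y. y \<in> {- int R..int R} \<Longrightarrow> 0 \<le> Re (w y) \<and> Re (w y) \<le> 1 \<and> \<bar>Im (w y)\<bar> \<le> real R + 1"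
    and nz: "\<And>x y. x \<in> {- int R..int R} \<Longrightarrow> y \<in> {- int R..int R} \<Longrightarrow> w y \<noteq> of_int x"
  shows "3/2 \<le> cmod (\<Prod>y\<in>{- int R..int R}. \<Prod>x\<in>{- int R..int R}.
     ((w y - of_int x)\<^sup>2 - 1) / (w y - of_int x)\<^sup>2)"
proof -
  define t where "t = (2 * real R - 1) / (2 * (real R + 1)\<^sup>2)"
  have r: "real R \<ge> 2" using R by simp
  have t: "t \<ge> 0" using r by (simp add: t_def)
  \<comment> \<open>This amounts to 3 R^2 - 2 R - 2 \<ge> 0, which is false for R = 1 and true from
    R = 2 on.\<close>
  have "1 / 2 \<le> real (2 * R + 1) * t"
  proof -
    have "2 * real R \<le> real R * real R" using r by (intro mult_right_mono) auto
    moreover have "(2 * real R + 1) * (2 * real R - 1) - (real R + 1)\<^sup>2 = 3 * (real R * real R) - 2 * real R - 2"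
      by (simp add: power2_eq_square algebra_simps)
    ultimately have "(real R + 1)\<^sup>2 \<le> (2 * real R + 1) * (2 * real R - 1)"
      using r by linarith
    then show ?thesis using r by (simp add: t_def field_simps)
  qed
  then have "3 / 2 \<le> 1 + real (2 * R + 1) * t" by simp
  also have "\<dots> \<le> (1 + t) ^ (2 * R + 1)"
    using Bernoulli_inequality[of t "2 * R + 1"] t by simp
  also have "\<dots> = (\<Prod>y\<in>{- int R..int R}. 1 + t)" by (simp add: nat_add_distrib nat_mult_distrib)
  also have "\<dots> \<le> (\<Prod>y\<in>{- int R..int R}. cmod (((w y)\<^sup>2 - (of_nat R + 1)\<^sup>2) / ((w y)\<^sup>2 - (of_nat R)\<^sup>2)))"
  proof (intro prod_mono conjI)
    fix y assume y: "y \<in> {- int R..int R}"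
    show "1 + t \<le> cmod (((w y)\<^sup>2 - (of_nat R + 1)\<^sup>2) / ((w y)\<^sup>2 - (of_nat R)\<^sup>2))"
      unfolding t_def using R w[OF y] nz[OF _ y, of "int R"] nz[OF _ y, of "- int R"]
      by (intro norm_row_ge) auto
  qed (use t in auto)
  also have "\<dots> = cmod (\<Prod>y\<in>{- int R..int R}. ((w y)\<^sup>2 - (of_nat R + 1)\<^sup>2) / ((w y)\<^sup>2 - (of_nat R)\<^sup>2))"
    by (simp add: prod_norm)
  also have "(\<Prod>y\<in>{- int R..int R}. ((w y)\<^sup>2 - (of_nat R + 1)\<^sup>2) / ((w y)\<^sup>2 - (of_nat R)\<^sup>2))
     = (\<Prod>y\<in>{- int R..int R}. \<Prod>x\<in>{- int R..int R}. ((w y - of_int x)\<^sup>2 - 1) / (w y - of_int x)\<^sup>2)"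
    using nz by (intro prod.cong prod_row_telescope[symmetric]) auto
  finally show ?thesis .
qed

definition lattice_point :: "int \<times> int \<Rightarrow> complex" where
  "lattice_point = (\<lambda>(x, y). Complex (of_int x) (of_int y))"

text \<open>1 - 1 / d^4 = (1 - 1 / d^2) (1 + 1 / d^2) is a horizontal second difference times a
  vertical one, the latter being the former at - \<i> d. Rows handle the first and columns the
  second, each contributing 3/2.\<close>

lemma norm_box_ge:
  fixes v :: complex
  assumes R: "R \<ge> 2" and v: "0 \<le> Re v" "Re v \<le> 1" "0 \<le> Im v" "Im v \<le> 1"
    and nz: "\<And>l. l \<in> {- int R..int R} \<times> {- int R..int R} \<Longrightarrow> v \<noteq> lattice_point l"
  shows "9/4 \<le> cmod (\<Prod>l\<in>{- int R..int R} \<times> {- int R..int R}. 1 - 1 / (v - lattice_point l) ^ 4)"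
proof -
  let ?I = "{- int R..int R}"
  let ?g = "\<lambda>w. (w\<^sup>2 - 1) / w\<^sup>2 :: complex"
  have 1: "1 - 1 / (v - lattice_point (x, y)) ^ 4 = ?g (v - \<i> * of_int y - of_int x) * ?g (- \<i> * (v - of_int x) - of_int y)"
    if "x \<in> ?I" "y \<in> ?I" for x y
  proof -
    define d where "d = v - \<i> * of_int y - of_int x"
    have l: "v - lattice_point (x, y) = d"
      by (simp add: d_def lattice_point_def complex_eq_iff)
    have d: "d \<noteq> 0" using nz[of "(x, y)"] that l by auto
    have e: "- \<i> * (v - of_int x) - of_int y = - \<i> * d" by (simp add: d_def algebra_simps)
    have "1 - 1 / d ^ 4 = ?g d * ?g (- \<i> * d)"
      using d by (simp add: power_mult_distrib field_simps)
    then show ?thesis unfolding l e by (simp add: d_def)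
  qed
  have nz': "v - \<i> * of_int y \<noteq> of_int x" "- \<i> * (v - of_int x) \<noteq> of_int y"
    if "x \<in> ?I" "y \<in> ?I" for x y
    using nz[of "(x, y)"] that by (auto simp: lattice_point_def complex_eq_iff)
  have A: "3/2 \<le> cmod (\<Prod>y\<in>?I. \<Prod>x\<in>?I. ?g (v - \<i> * of_int y - of_int x))"
    by (rule norm_rows_ge[OF R]) (use v nz' in auto)
  have B: "3/2 \<le> cmod (\<Prod>x\<in>?I. \<Prod>y\<in>?I. ?g (- \<i> * (v - of_int x) - of_int y))"
    by (rule norm_rows_ge[OF R]) (use v nz' in auto)
  have "(\<Prod>l\<in>?I \<times> ?I. 1 - 1 / (v - lattice_point l) ^ 4)
     = (\<Prod>l\<in>?I \<times> ?I. (\<lambda>(x,y). ?g (v - \<i> * of_int y - of_int x)) l * (\<lambda>(x,y). ?g (- \<i> * (v - of_int x) - of_int y)) l)"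
    using 1 by (intro prod.cong) auto
  also have "\<dots> = (\<Prod>x\<in>?I. \<Prod>y\<in>?I. ?g (v - \<i> * of_int y - of_int x))
      * (\<Prod>x\<in>?I. \<Prod>y\<in>?I. ?g (- \<i> * (v - of_int x) - of_int y))"
    unfolding prod.distrib by (simp only: prod.cartesian_product case_prod_conv)
  also have "(\<Prod>x\<in>?I. \<Prod>y\<in>?I. ?g (v - \<i> * of_int y - of_int x)) = (\<Prod>y\<in>?I. \<Prod>x\<in>?I. ?g (v - \<i> * of_int y - of_int x))"
    by (rule prod.swap)
  finally show ?thesis
    using mult_mono[OF A B] by (simp only: norm_mult) simp
qed

lemma norm_prod_one_plus_minus_one_le:
  fixes f :: "'a \<Rightarrow> complex"
  shows "cmod ((\<Prod>x\<in>A. 1 + f x) - 1) \<le> exp (\<Sum>x\<in>A. cmod (f x)) - 1"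
proof (induction A rule: infinite_finite_induct)
  case (insert x A)
  let ?P = "\<Prod>x\<in>A. 1 + f x" and ?s = "\<Sum>x\<in>A. cmod (f x)"
  have P: "cmod ?P \<le> exp ?s"
    using insert.IH norm_triangle_ineq[of "?P - 1" 1] by simp
  have "(\<Prod>x\<in>insert x A. 1 + f x) - 1 = (?P - 1) + f x * ?P"
    using insert.hyps by (simp add: algebra_simps)
  then have "cmod ((\<Prod>x\<in>insert x A. 1 + f x) - 1) \<le> cmod (?P - 1) + cmod (f x) * cmod ?P"
    by (metis norm_mult norm_triangle_ineq)
  also have "\<dots> \<le> (exp ?s - 1) + cmod (f x) * exp ?s"
    using insert.IH P by (intro add_mono mult_left_mono) auto
  also have "\<dots> = exp ?s * (1 + cmod (f x)) - 1" by (simp add: algebra_simps)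
  also have "\<dots> \<le> exp ?s * exp (cmod (f x)) - 1"
    using exp_ge_add_one_self[of "cmod (f x)"] by (intro diff_right_mono mult_left_mono) auto
  finally show ?case using insert.hyps by (simp add: exp_add mult.commute add.commute)
qed simp_all

text \<open>About r^2 factors, each within r^(-4) of 1: the decay beats the two-dimensional count,
  so the product tends to 1 as \<open>r\<close> grows.\<close>

lemma norm_far_prod_le:
  fixes u :: complex
  assumes "finite \<Lambda>" "r > 0" "\<And>l. l \<in> \<Lambda> \<Longrightarrow> r \<le> cmod (u - lattice_point l)" "real (card \<Lambda>) \<le> C * r\<^sup>2"
  shows "cmod ((\<Prod>l\<in>\<Lambda>. 1 - 1 / (u - lattice_point l) ^ 4) - 1) \<le> exp (C / r\<^sup>2) - 1"
proof -
  let ?f = "\<lambda>l. - (1 / (u - lattice_point l) ^ 4)"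
  have "cmod ((\<Prod>l\<in>\<Lambda>. 1 + ?f l) - 1) \<le> exp (\<Sum>l\<in>\<Lambda>. cmod (?f l)) - 1"
    by (rule norm_prod_one_plus_minus_one_le)
  also have "(\<Sum>l\<in>\<Lambda>. cmod (?f l)) \<le> real (card \<Lambda>) * (1 / r ^ 4)"
  proof (rule sum_bounded_above)
    fix l assume "l \<in> \<Lambda>"
    then have "r ^ 4 \<le> cmod (u - lattice_point l) ^ 4" using assms by (intro power_mono) auto
    then show "cmod (?f l) \<le> 1 / r ^ 4"
      using assms(2) by (simp add: norm_divide norm_power frac_le)
  qed
  also have "\<dots> \<le> C * r\<^sup>2 * (1 / r ^ 4)" using assms by (intro mult_right_mono) auto
  also have "\<dots> = C / r\<^sup>2" using assms(2) by (simp add: power4_eq_xxxx power2_eq_square)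
  finally show ?thesis by simp
qed

section \<open>Separating disjoint compact sets by a rational function\<close>

lemma ball_minus_finite_nonempty:
  fixes z :: complex
  assumes "r > 0" "finite F"
  obtains w where "w \<in> ball z r" "w \<notin> F"
  using assms uncountable_ball[OF assms(1), of z] by (metis countable_finite countable_subset subsetI)

text \<open>\<open>X\<close> has finitely many zeros, so points where the inequality is known
  accumulate at \<open>z\<close>, and continuity carries it over.\<close>

lemma norm_poly_le_of_nearby:
  fixes P Q X :: "complex poly"
  assumes "X \<noteq> 0" "r > 0" "\<And>w. w \<in> ball z r \<Longrightarrow> poly X w \<noteq> 0 \<Longrightarrow> cmod (poly Q w) \<le> cmod (poly P w)"
  shows "cmod (poly Q z) \<le> cmod (poly P z)"
proof (rule ccontr)
  assume "\<not> ?thesis"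
  moreover have "isCont (\<lambda>w. cmod (poly Q w) - cmod (poly P w)) z" by (intro continuous_intros)
  then have "((\<lambda>w. cmod (poly Q w) - cmod (poly P w)) \<longlongrightarrow> cmod (poly Q z) - cmod (poly P z)) (nhds z)"
    unfolding isCont_def using tendsto_at_iff_tendsto_nhds[of "\<lambda>w. cmod (poly Q w) - cmod (poly P w)" z] by blast
  ultimately have "\<forall>\<^sub>F w in nhds z. cmod (poly Q w) - cmod (poly P w) > 0"
    by (intro order_tendstoD(1)) auto
  then obtain e where e: "e > 0" "\<And>w. dist w z < e \<Longrightarrow> cmod (poly Q w) > cmod (poly P w)"
    by (auto simp: eventually_nhds_metric)
  obtain w where "w \<in> ball z (min e r)" "w \<notin> {x. poly X x = 0}"
    using ball_minus_finite_nonempty[of "min e r" "{x. poly X x = 0}" z] e(1) assms poly_roots_finite by auto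
  then show False using e(2)[of w] assms(3)[of w] by (force simp: dist_commute)
qed

text \<open>A quotient built from a fine grid near \<open>L\<close> has modulus at most 11/10 on
  \<open>K\<close> and, off its poles, at least 2 near \<open>L\<close>. The factor 3/2 lies
  strictly between and separates the two.\<close>

lemma separating_polys:
  fixes K L :: "complex set"
  assumes K: "compact K" and L: "compact L" and dis: "K \<inter> L = {}"
  obtains X Y where "X \<noteq> 0" "\<And>z. z \<in> K \<Longrightarrow> cmod (poly Y z) < cmod (poly X z)"
    "\<And>z. z \<in> L \<Longrightarrow> cmod (poly X z) < cmod (poly Y z)"
proof -
  obtain d0 where d0: "d0 > 0" "\<And>x y. x \<in> K \<Longrightarrow> y \<in> L \<Longrightarrow> d0 \<le> dist x y"
    using separate_compact_closed[OF K compact_imp_closed[OF L] dis] by blast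
  \<comment> \<open>\<open>K\<close> keeps distance 4 d from \<open>L\<close>, and grid points are
    taken within 2 d of \<open>L\<close>, so they stay 2 d away from \<open>K\<close>.\<close>
  define d where "d = d0 / 4"
  have d: "d > 0" using d0 by (simp add: d_def)
  obtain M where M: "M > 0" "\<And>z. z \<in> L \<Longrightarrow> cmod z \<le> M"
    using compact_imp_bounded[OF L] bounded_pos by metis
  \<comment> \<open>In units of the mesh the grid lies within radius 2 q R, so \<open>C\<close> R^2
    will bound the number of grid points, with \<open>C\<close> independent of the mesh.\<close>
  define q where "q = (M + 2 * d) / d"
  define C where "C = (4 * q + 3)\<^sup>2"
  have "q > 0" unfolding q_def using M d by (intro divide_pos_pos) auto
  then have "4 * q + 3 > 0" by linarith
  then have C: "C > 0" unfolding C_def by (rule zero_less_power)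
  have ln: "ln (11/10 :: real) > 0" by simp
  \<comment> \<open>\<open>C\<close> is already fixed, so a large \<open>R\<close> brings the far
    factor exp (C / R^2) down to 11/10. Adding 2 meets the condition of the box estimate.\<close>
  obtain R0 :: nat where R0: "C / ln (11/10) < real R0" using reals_Archimedean2 by blast
  define R where "R = R0 + 2"
  have R: "R \<ge> 2" "real R \<ge> 2" "real R > 0" by (auto simp: R_def)
  have CR: "exp (C / (real R)\<^sup>2) \<le> 11 / 10"
  proof -
    have "C / (real R)\<^sup>2 \<le> C / real R"
      using C R by (intro divide_left_mono) (auto simp: power2_eq_square)
    also have "\<dots> \<le> ln (11/10)"
      using R0 ln R by (simp add: R_def field_simps) (use ln in linarith)
    finally have "exp (C / (real R)\<^sup>2) \<le> exp (ln (11/10))" by (simp only: exp_le_cancel_iff)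
    then show ?thesis by simp
  qed
  \<comment> \<open>With this mesh a box of \<open>R\<close> steps has half-width d / 2 and fits
    into the 2 d neighbourhood of \<open>L\<close>.\<close>
  define \<delta> where "\<delta> = d / (2 * real R)"
  have \<delta>: "\<delta> > 0" "real R * \<delta> = d / 2" "2 * \<delta> \<le> d / 2"
    using d R by (auto simp: \<delta>_def field_simps)
  define \<Lambda> where "\<Lambda> = {l. \<exists>w\<in>L. cmod (\<delta> * lattice_point l - w) \<le> 2 * d}"
  define B where "B = \<lceil>(M + 2 * d) / \<delta>\<rceil>"
  have "(M + 2 * d) / \<delta> > 0" using M(1) d \<delta>(1) by (intro divide_pos_pos) auto
  then have B0: "B \<ge> 0" unfolding B_def by linarith
  have sub: "\<Lambda> \<subseteq> {-B..B} \<times> {-B..B}"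
  proof
    fix l assume "l \<in> \<Lambda>"
    then obtain w where w: "w \<in> L" "cmod (\<delta> * lattice_point l - w) \<le> 2 * d" by (auto simp: \<Lambda>_def)
    obtain x y where l: "l = (x, y)" by (cases l)
    have "cmod (\<delta> * lattice_point l) \<le> cmod (\<delta> * lattice_point l - w) + cmod w"
      using norm_triangle_ineq[of "\<delta> * lattice_point l - w" w] by simp
    then have n: "\<delta> * cmod (lattice_point l) \<le> M + 2 * d"
      using w M(2)[of w] \<delta> by (simp add: norm_mult)
    have n': "cmod (lattice_point l) \<le> (M + 2 * d) / \<delta>"
      using n \<delta>(1) by (simp add: pos_le_divide_eq mult.commute)
    have "\<bar>of_int x\<bar> \<le> cmod (lattice_point l)" "\<bar>of_int y\<bar> \<le> cmod (lattice_point l)"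
      using abs_Re_le_cmod[of "lattice_point l"] abs_Im_le_cmod[of "lattice_point l"]
      by (simp_all add: l lattice_point_def)
    then have "\<bar>of_int x\<bar> \<le> (of_int B :: real)" "\<bar>of_int y\<bar> \<le> (of_int B :: real)"
      using n' le_of_int_ceiling[of "(M + 2 * d) / \<delta>"] unfolding B_def by linarith+
    then have "\<bar>x\<bar> \<le> B" "\<bar>y\<bar> \<le> B" by (metis of_int_abs of_int_le_iff)+
    then show "l \<in> {-B..B} \<times> {-B..B}" by (auto simp: l)
  qed
  have fin: "finite \<Lambda>" using sub by (rule finite_subset) auto
  have card: "real (card \<Lambda>) \<le> C * (real R)\<^sup>2"
  proof -
    have "card \<Lambda> \<le> card ({-B..B} \<times> {-B..B})" using sub by (intro card_mono) auto
    also have "\<dots> = (nat (2 * B + 1))\<^sup>2" by (simp add: card_cartesian_product power2_eq_square algebra_simps)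
    finally have "real (card \<Lambda>) \<le> (real (nat (2 * B + 1)))\<^sup>2" by (metis of_nat_le_iff of_nat_power)
    also have "\<dots> = (2 * of_int B + 1)\<^sup>2" using B0 by simp
    also have "\<dots> \<le> (real R * (4 * q + 3))\<^sup>2"
    proof (rule power_mono)
      have gen: "N / (d / (2 * r)) = r * (2 * (N / d))" for N r :: real by simp
      have "of_int B \<le> (M + 2 * d) / \<delta> + 1" unfolding B_def by linarith
      also have "(M + 2 * d) / \<delta> = real R * (2 * q)"
        unfolding \<delta>_def q_def by (rule gen)
      finally have "2 * of_int B + 1 \<le> real R * (4 * q) + 3" by simp
      also have "\<dots> \<le> real R * (4 * q + 3)" using R by (simp add: distrib_left)
      finally show "2 * of_int B + 1 \<le> real R * (4 * q + 3)" .
    qed (use B0 in simp)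
    finally show ?thesis by (simp add: C_def power_mult_distrib mult.commute)
  qed
  let ?s = "\<lambda>l. [:- (\<delta> * lattice_point l), 1:] :: complex poly"
  \<comment> \<open>Each factor of Y0 / X0 is 1 - \<delta>^4 / (z - \<delta> \<lambda>)^4, the
    lattice factor at z / \<delta>.\<close>
  define X0 where "X0 = (\<Prod>l\<in>\<Lambda>. ?s l ^ 4)"
  define Y0 where "Y0 = (\<Prod>l\<in>\<Lambda>. ?s l ^ 4 - [:of_real \<delta> ^ 4:])"
  have X0: "X0 \<noteq> 0" by (simp add: X0_def prod_zero_iff fin)
  have Xz: "poly X0 z \<noteq> 0 \<longleftrightarrow> (\<forall>l\<in>\<Lambda>. z / \<delta> \<noteq> lattice_point l)" for z :: complex
    using fin \<delta>(1) by (auto simp: X0_def poly_prod field_simps)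
  have ratio: "poly Y0 z / poly X0 z = (\<Prod>l\<in>\<Lambda>. 1 - 1 / (z / \<delta> - lattice_point l) ^ 4)"
    if "poly X0 z \<noteq> 0" for z
  proof -
    have "poly Y0 z / poly X0 z = (\<Prod>l\<in>\<Lambda>. poly (?s l ^ 4 - [:of_real \<delta> ^ 4:]) z / poly (?s l ^ 4) z)"
      by (simp add: X0_def Y0_def poly_prod prod_dividef)
    also have "\<dots> = (\<Prod>l\<in>\<Lambda>. 1 - 1 / (z / \<delta> - lattice_point l) ^ 4)"
    proof (rule prod.cong)
      fix l assume l: "l \<in> \<Lambda>"
      have e: "z - \<delta> * lattice_point l = \<delta> * (z / \<delta> - lattice_point l)"
        using \<delta>(1) by (simp add: field_simps)
      have "poly (?s l ^ 4 - [:of_real \<delta> ^ 4:]) z / poly (?s l ^ 4) z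
          = ((z - \<delta> * lattice_point l) ^ 4 - of_real \<delta> ^ 4) / (z - \<delta> * lattice_point l) ^ 4"
        by simp
      also have "\<dots> = 1 - 1 / (z / \<delta> - lattice_point l) ^ 4"
        unfolding e power_mult_distrib using that l \<delta>(1) unfolding Xz by (simp add: diff_divide_distrib)
      finally show "poly (?s l ^ 4 - [:of_real \<delta> ^ 4:]) z / poly (?s l ^ 4) z = 1 - 1 / (z / \<delta> - lattice_point l) ^ 4" .
    qed simp
    finally show ?thesis .
  qed
  have scale: "cmod (z - \<delta> * lattice_point l) = \<delta> * cmod (z / \<delta> - lattice_point l)" for z :: complex and l
  proof -
    have "z - \<delta> * lattice_point l = \<delta> * (z / \<delta> - lattice_point l)"
      using \<delta>(1) by (simp add: field_simps)
    then show ?thesis using \<delta>(1) by (simp only: norm_mult) simp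
  qed
  have onK: "poly X0 z \<noteq> 0 \<and> cmod (poly Y0 z / poly X0 z) \<le> 11/10" if z: "z \<in> K" for z
  proof -
    have far: "real R \<le> cmod (z / \<delta> - lattice_point l)" if l: "l \<in> \<Lambda>" for l
    proof -
      obtain w where w: "w \<in> L" "cmod (\<delta> * lattice_point l - w) \<le> 2 * d" using l by (auto simp: \<Lambda>_def)
      have "4 * d \<le> cmod (z - w)" using d0(2)[OF z w(1)] by (simp add: d_def dist_norm)
      also have "\<dots> \<le> cmod (z - \<delta> * lattice_point l) + cmod (\<delta> * lattice_point l - w)"
        using norm_triangle_ineq[of "z - \<delta> * lattice_point l" "\<delta> * lattice_point l - w"] by simp
      finally have "\<delta> * real R \<le> \<delta> * cmod (z / \<delta> - lattice_point l)"
        using w(2) d \<delta>(2) scale[where z = z and l = l] by (simp add: mult.commute)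
      then show ?thesis using \<delta>(1) by simp
    qed
    have nz: "poly X0 z \<noteq> 0" unfolding Xz using far R by force
    have "cmod (poly Y0 z / poly X0 z - 1) \<le> exp (C / (real R)\<^sup>2) - 1"
      unfolding ratio[OF nz] by (rule norm_far_prod_le) (use fin R far card in auto)
    then show ?thesis using nz CR norm_triangle_ineq[of "poly Y0 z / poly X0 z - 1" 1] by simp
  qed
  \<comment> \<open>The bound is needed on a whole neighbourhood of \<open>L\<close>, because it
    fails to make sense at the zeros of \<open>X0\<close> and is later extended to them by
    continuity.\<close>
  have nearL: "2 \<le> cmod (poly Y0 z / poly X0 z)"
    if w: "w \<in> L" and zw: "z \<in> ball w (d / 2)" and nz: "poly X0 z \<noteq> 0" for z w
  proof -
    define u where "u = z / \<delta>"
    \<comment> \<open>Subtracting the integer corner moves \<open>u\<close> into the unit square,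
      where the box estimate applies.\<close>
    define x0 y0 where "x0 = \<lfloor>Re u\<rfloor>" and "y0 = \<lfloor>Im u\<rfloor>"
    define v where "v = u - lattice_point (x0, y0)"
    have v: "0 \<le> Re v" "Re v \<le> 1" "0 \<le> Im v" "Im v \<le> 1"
      unfolding v_def x0_def y0_def lattice_point_def by (simp_all; linarith)+
    define Q where "Q = (\<lambda>(x, y). (x + x0, y + y0)) ` ({- int R..int R} \<times> {- int R..int R})"
    have lp: "u - lattice_point (x + x0, y + y0) = v - lattice_point (x, y)" for x y
      by (simp add: v_def lattice_point_def complex_eq_iff)
    \<comment> \<open>A box point is at most d + 2 \<delta> \<le> 3 d / 2 from \<open>z\<close>, and
      \<open>z\<close> is within d / 2 of \<open>w\<close>.\<close>
    have QL: "Q \<subseteq> \<Lambda>"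
    proof
      fix l assume "l \<in> Q"
      then obtain x y where xy: "x \<in> {- int R..int R}" "y \<in> {- int R..int R}" "l = (x + x0, y + y0)"
        by (auto simp: Q_def)
      have "cmod (u - lattice_point l) \<le> \<bar>Re (v - lattice_point (x, y))\<bar> + \<bar>Im (v - lattice_point (x, y))\<bar>"
        unfolding xy(3) lp by (rule cmod_le)
      also have "\<dots> \<le> (real R + 1) + (real R + 1)"
      proof (rule add_mono)
        have "\<bar>of_int x\<bar> \<le> real R" "\<bar>of_int y\<bar> \<le> real R" using xy by auto
        then show "\<bar>Re (v - lattice_point (x, y))\<bar> \<le> real R + 1" "\<bar>Im (v - lattice_point (x, y))\<bar> \<le> real R + 1"
          using v by (simp_all add: lattice_point_def)
      qed
      finally have "\<delta> * cmod (u - lattice_point l) \<le> \<delta> * (2 * real R + 2)" using \<delta>(1) by simp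
      also have "\<dots> = d + 2 * \<delta>" using \<delta>(2) by (simp add: algebra_simps)
      finally have "cmod (z - \<delta> * lattice_point l) \<le> d + d / 2"
        unfolding scale u_def using \<delta>(3) by simp
      moreover have "cmod (\<delta> * lattice_point l - w) \<le> cmod (z - \<delta> * lattice_point l) + cmod (w - z)"
        using norm_triangle_ineq[of "\<delta> * lattice_point l - z" "z - w"] by (simp add: norm_minus_commute)
      ultimately have "cmod (\<delta> * lattice_point l - w) \<le> 2 * d"
        using zw by (simp add: dist_norm)
      then show "l \<in> \<Lambda>" using w by (auto simp: \<Lambda>_def)
    qed
    have nzl: "u \<noteq> lattice_point l" if "l \<in> \<Lambda>" for l using nz that unfolding Xz u_def by auto
    have inj: "inj_on (\<lambda>(x, y). (x + x0, y + y0)) ({- int R..int R} \<times> {- int R..int R})"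
      by (auto simp: inj_on_def)
    have "(\<Prod>l\<in>Q. 1 - 1 / (u - lattice_point l) ^ 4) = (\<Prod>l\<in>{- int R..int R} \<times> {- int R..int R}. 1 - 1 / (v - lattice_point l) ^ 4)"
      unfolding Q_def prod.reindex[OF inj] by (intro prod.cong) (auto simp: lp)
    moreover have "9/4 \<le> cmod (\<Prod>l\<in>{- int R..int R} \<times> {- int R..int R}. 1 - 1 / (v - lattice_point l) ^ 4)"
    proof (rule norm_box_ge[OF R(1) v])
      fix l assume l: "l \<in> {- int R..int R} \<times> {- int R..int R}"
      obtain x y where xy: "l = (x, y)" by (cases l)
      have "(x + x0, y + y0) \<in> Q" using l by (auto simp: Q_def xy)
      then have "u - lattice_point (x + x0, y + y0) \<noteq> 0" using nzl QL by auto
      then show "v \<noteq> lattice_point l" unfolding lp xy by simp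
    qed
    ultimately have A: "9/4 \<le> cmod (\<Prod>l\<in>Q. 1 - 1 / (u - lattice_point l) ^ 4)" by simp
    \<comment> \<open>Outside the box some coordinate differs from that of \<open>u\<close> by at
      least \<open>R\<close>, so the remaining factors multiply to within 1/10 of 1. Together with
      the box this gives 9/4 * 9/10 > 2.\<close>
    have "cmod ((\<Prod>l\<in>\<Lambda> - Q. 1 - 1 / (u - lattice_point l) ^ 4) - 1) \<le> exp (C / (real R)\<^sup>2) - 1"
    proof (rule norm_far_prod_le)
      show "real (card (\<Lambda> - Q)) \<le> C * (real R)\<^sup>2"
        using card card_mono[OF fin, of "\<Lambda> - Q"] by force
      fix l assume l: "l \<in> \<Lambda> - Q"
      obtain x y where xy: "l = (x + x0, y + y0)" by (metis surj_pair diff_add_cancel)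
      have "\<not> (\<bar>x\<bar> \<le> int R \<and> \<bar>y\<bar> \<le> int R)"
        using l unfolding Q_def xy by (auto simp: image_iff)
      then consider "of_int x \<ge> real R + 1" | "of_int x \<le> - (real R + 1)" | "of_int y \<ge> real R + 1" | "of_int y \<le> - (real R + 1)"
        by linarith
      then have "real R \<le> \<bar>Re (v - lattice_point (x, y))\<bar> \<or> real R \<le> \<bar>Im (v - lattice_point (x, y))\<bar>"
        using v by cases (auto simp: lattice_point_def)
      then show "real R \<le> cmod (u - lattice_point l)"
        unfolding xy lp using abs_Re_le_cmod abs_Im_le_cmod order_trans by blast
    qed (use fin R in auto)
    then have "9/10 \<le> cmod (\<Prod>l\<in>\<Lambda> - Q. 1 - 1 / (u - lattice_point l) ^ 4)"
      using CR norm_triangle_ineq2[of 1 "1 - (\<Prod>l\<in>\<Lambda> - Q. 1 - 1 / (u - lattice_point l) ^ 4)"]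
      by (simp add: norm_minus_commute)
    with A have "9/4 * (9/10) \<le> cmod (\<Prod>l\<in>Q. 1 - 1 / (u - lattice_point l) ^ 4) * cmod (\<Prod>l\<in>\<Lambda> - Q. 1 - 1 / (u - lattice_point l) ^ 4)"
      by (intro mult_mono) auto
    also have "\<dots> = cmod (\<Prod>l\<in>\<Lambda>. 1 - 1 / (u - lattice_point l) ^ 4)"
      unfolding prod.subset_diff[OF QL fin] norm_mult by simp
    finally show ?thesis unfolding ratio[OF nz] u_def by simp
  qed
  \<comment> \<open>\<open>X0\<close> and \<open>Y0\<close> both vanish at grid points inside \<open>L\<close>; the reduced quotient does not.\<close>
  obtain P Q where PQ: "coprime P Q" "Q \<noteq> 0" "Fract Y0 X0 = Fract P Q" "\<And>z. poly P z \<noteq> 0 \<or> poly Q z \<noteq> 0"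
    using rat_eval_coprime_pair by metis
  have "Y0 * Q = P * X0" using PQ(2,3) X0 by (simp add: eq_fract)
  then have e: "poly Y0 z * poly Q z = poly P z * poly X0 z" for z by (metis poly_mult)
  have Qnz: "poly Q z \<noteq> 0" and Pe: "poly Y0 z / poly X0 z = poly P z / poly Q z" if "poly X0 z \<noteq> 0" for z
  proof -
    show "poly Q z \<noteq> 0" using e[of z] PQ(4)[of z] that by auto
    then show "poly Y0 z / poly X0 z = poly P z / poly Q z" using e[of z] that by (simp add: field_simps)
  qed
  show thesis
  proof (rule that[of "Polynomial.smult (3/2) Q" P])
    fix z assume z: "z \<in> K"
    have nz: "poly Q z \<noteq> 0" "cmod (poly P z / poly Q z) \<le> 11/10"
      using onK[OF z] Qnz[of z] Pe[of z] by auto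
    then have "cmod (poly P z) \<le> 11/10 * cmod (poly Q z)" "cmod (poly Q z) > 0"
      by (simp_all add: norm_divide pos_divide_le_eq)
    then have "cmod (poly P z) < 3/2 * cmod (poly Q z)" by linarith
    then show "cmod (poly P z) < cmod (poly (Polynomial.smult (3/2) Q) z)" by (simp add: norm_mult)
  next
    fix z assume z: "z \<in> L"
    have "cmod (poly (Polynomial.smult 2 Q) z) \<le> cmod (poly P z)"
    proof (rule norm_poly_le_of_nearby[OF X0, of "d / 2"])
      fix w assume w: "w \<in> ball z (d / 2)" "poly X0 w \<noteq> 0"
      then show "cmod (poly (Polynomial.smult 2 Q) w) \<le> cmod (poly P w)"
        using nearL[OF z w, unfolded Pe[OF w(2)]] Qnz[OF w(2)] by (simp add: norm_divide norm_mult pos_le_divide_eq)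
    qed (use d in simp)
    then have le: "2 * cmod (poly Q z) \<le> cmod (poly P z)" by (simp add: norm_mult)
    \<comment> \<open>If \<open>P\<close> vanished at \<open>z\<close> then so would
      \<open>Q\<close>, which lowest terms exclude. Hence the inequality is strict even where
      \<open>Q\<close> vanishes.\<close>
    moreover have "cmod (poly P z) > 0" using le PQ(4)[of z] by auto
    ultimately have "3/2 * cmod (poly Q z) < cmod (poly P z)" by linarith
    then show "cmod (poly (Polynomial.smult (3/2) Q) z) < cmod (poly P z)" by (simp add: norm_mult)
  qed (use PQ in simp)
qed

section \<open>Simultaneous rational approximation\<close>

lemma compact_norm_ratio_less_one:
  fixes a b :: "complex \<Rightarrow> complex"
  assumes "compact K" "continuous_on K a" "continuous_on K b" "\<And>z. z \<in> K \<Longrightarrow> cmod (a z) < cmod (b z)"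
  obtains c where "0 < c" "c < 1" "\<And>z. z \<in> K \<Longrightarrow> cmod (a z) \<le> c * cmod (b z)"
proof (cases "K = {}")
  case False
  have nz: "b z \<noteq> 0" if "z \<in> K" for z using assms(4)[OF that] by auto
  have "continuous_on K (\<lambda>z. cmod (a z) / cmod (b z))"
    using nz by (intro continuous_intros assms) auto
  then obtain z0 where z0: "z0 \<in> K" "\<forall>z\<in>K. cmod (a z) / cmod (b z) \<le> cmod (a z0) / cmod (b z0)"
    using continuous_attains_sup[OF assms(1) False] by blast
  let ?c = "cmod (a z0) / cmod (b z0)"
  have c: "?c < 1" using assms(4)[OF z0(1)] nz[OF z0(1)] by simp
  show thesis
  proof (rule that[of "max ?c (1/2)"])
    fix z assume z: "z \<in> K"
    have "cmod (a z) / cmod (b z) \<le> ?c" using z0(2) z by blast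
    then have "cmod (a z) \<le> ?c * cmod (b z)"
      using nz[OF z] by (subst (asm) pos_divide_le_eq) auto
    also have "\<dots> \<le> max ?c (1/2) * cmod (b z)" by (intro mult_right_mono) auto
    finally show "cmod (a z) \<le> max ?c (1/2) * cmod (b z)" .
  qed (use c in auto)
qed (use that[of "1/2"] in auto)

text \<open>By compactness both ratios are at most some c < 1; n-th powers of \<open>X\<close> and
  \<open>Y\<close> improve this to c^n.\<close>

lemma separating_polys_strong:
  fixes K L :: "complex set"
  assumes K: "compact K" and L: "compact L" and dis: "K \<inter> L = {}" and "\<epsilon> > 0"
  obtains X Y where "\<And>z. z \<in> K \<Longrightarrow> poly X z \<noteq> 0 \<and> cmod (poly Y z) \<le> \<epsilon> * cmod (poly X z)"
    "\<And>z. z \<in> L \<Longrightarrow> poly Y z \<noteq> 0 \<and> cmod (poly X z) \<le> \<epsilon> * cmod (poly Y z)"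
proof -
  obtain X Y where XY: "\<And>z. z \<in> K \<Longrightarrow> cmod (poly Y z) < cmod (poly X z)"
    "\<And>z. z \<in> L \<Longrightarrow> cmod (poly X z) < cmod (poly Y z)"
    using separating_polys[OF K L dis] by metis
  obtain c1 where c1: "0 < c1" "c1 < 1" "\<And>z. z \<in> K \<Longrightarrow> cmod (poly Y z) \<le> c1 * cmod (poly X z)"
    by (rule compact_norm_ratio_less_one[OF K, of "poly Y" "poly X"]) (use XY in \<open>auto intro!: continuous_intros\<close>)
  obtain c2 where c2: "0 < c2" "c2 < 1" "\<And>z. z \<in> L \<Longrightarrow> cmod (poly X z) \<le> c2 * cmod (poly Y z)"
    by (rule compact_norm_ratio_less_one[OF L, of "poly X" "poly Y"]) (use XY in \<open>auto intro!: continuous_intros\<close>)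
  define c where "c = max c1 c2"
  have c: "0 < c" "c < 1" using c1 c2 by (auto simp: c_def)
  obtain n where n: "c ^ n < \<epsilon>" using real_arch_pow_inv[OF \<open>\<epsilon> > 0\<close> c(2)] by blast
  have le: "cmod (p ^ n) \<le> \<epsilon> * cmod (q ^ n)" if "cmod p \<le> c' * cmod q" "c' \<le> c" for p q :: complex and c'
  proof -
    have "cmod p \<le> c * cmod q" using that mult_right_mono[OF that(2), of "cmod q"] by simp
    then have "cmod p ^ n \<le> (c * cmod q) ^ n" by (intro power_mono) auto
    also have "\<dots> = c ^ n * cmod q ^ n" by (simp add: power_mult_distrib)
    also have "\<dots> \<le> \<epsilon> * cmod q ^ n" using n by (intro mult_right_mono) auto
    finally show ?thesis by (simp add: norm_power)
  qed
  show thesis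
  proof (rule that[of "X ^ n" "Y ^ n"])
    fix z assume "z \<in> K"
    then show "poly (X ^ n) z \<noteq> 0 \<and> cmod (poly (Y ^ n) z) \<le> \<epsilon> * cmod (poly (X ^ n) z)"
      using XY(1)[of z] le[OF c1(3)[of z]] by (auto simp: c_def)
  next
    fix z assume "z \<in> L"
    then show "poly (Y ^ n) z \<noteq> 0 \<and> cmod (poly (X ^ n) z) \<le> \<epsilon> * cmod (poly (Y ^ n) z)"
      using XY(2)[of z] le[OF c2(3)[of z]] by (auto simp: c_def)
  qed
qed

lemma sphere_ratio_scale: "c \<noteq> 0 \<Longrightarrow> sphere_ratio (c * a) (c * b) = sphere_ratio a b"
  by (simp add: sphere_ratio_def)

lemma compact_poly_bounded:
  assumes "compact K"
  obtains M where "M > 0" "\<And>z. z \<in> K \<Longrightarrow> cmod (poly p z) \<le> M"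
proof -
  have "compact (poly p ` K)" by (intro compact_continuous_image continuous_intros assms)
  then obtain M where "M > 0" "\<forall>x\<in>poly p ` K. cmod x \<le> M"
    using compact_imp_bounded bounded_pos by metis
  then show thesis using that by blast
qed

text \<open>Take N = A1 X + A2 Y and D = B1 X + B2 Y. Dividing by \<open>X\<close> on
  \<open>K\<close> shows a small perturbation of A1 / B1; dividing by \<open>Y\<close> on
  \<open>L\<close> shows a small perturbation of the pair (A2, B2), which is harmless chordally even
  at zeros of \<open>B2\<close>.\<close>

lemma simultaneous_rational_approx_aux:
  fixes K L :: "complex set"
  assumes K: "compact K" and L: "compact L" and dis: "K \<inter> L = {}"
    and B1: "\<And>z. z \<in> K \<Longrightarrow> poly B1 z \<noteq> 0"
    and AB2: "\<And>z. z \<in> L \<Longrightarrow> poly A2 z \<noteq> 0 \<or> poly B2 z \<noteq> 0" and e: "\<epsilon> > 0"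
  obtains N D where
    "\<And>z. z \<in> K \<Longrightarrow> poly D z \<noteq> 0 \<and> cmod (poly N z / poly D z - poly A1 z / poly B1 z) \<le> \<epsilon>"
    "\<And>z. z \<in> L \<Longrightarrow> (poly N z \<noteq> 0 \<or> poly D z \<noteq> 0) \<and>
       chordal (sphere_ratio (poly N z) (poly D z)) (sphere_ratio (poly A2 z) (poly B2 z)) \<le> \<epsilon>"
proof -
  have KL: "compact (K \<union> L)" using K L by (rule compact_Un)
  obtain M1 M2 M3 M4 where M: "M1 > 0" "M2 > 0" "M3 > 0" "M4 > 0"
    "\<And>z. z \<in> K \<union> L \<Longrightarrow> cmod (poly A1 z) \<le> M1" "\<And>z. z \<in> K \<union> L \<Longrightarrow> cmod (poly B1 z) \<le> M2"
    "\<And>z. z \<in> K \<union> L \<Longrightarrow> cmod (poly A2 z) \<le> M3" "\<And>z. z \<in> K \<union> L \<Longrightarrow> cmod (poly B2 z) \<le> M4"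
    using compact_poly_bounded[OF KL] by metis
  define M where "M = M1 + M2 + M3 + M4"
  have M0: "M > 0" using M by (simp add: M_def)
  have MM: "cmod (poly A1 z) \<le> M" "cmod (poly B1 z) \<le> M" "cmod (poly A2 z) \<le> M" "cmod (poly B2 z) \<le> M"
    if "z \<in> K \<union> L" for z
    using M(1-4) M(5-8)[OF that] by (auto simp: M_def)
  obtain m where m: "m > 0" "\<And>z. z \<in> K \<Longrightarrow> m \<le> sqrt ((cmod (poly B1 z))\<^sup>2 + (cmod (poly B1 z))\<^sup>2)"
    by (rule compact_pair_norm_ge[OF K, of "poly B1" "poly B1"]) (use B1 in \<open>auto intro!: continuous_intros\<close>)
  \<comment> \<open>The bound \<open>m\<close> comes from the pair (B1, B1), whose norm is at most
    twice |B1|.\<close>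
  have mB: "m / 2 \<le> cmod (poly B1 z)" if "z \<in> K" for z
  proof -
    have "m \<le> sqrt ((cmod (poly B1 z))\<^sup>2) + sqrt ((cmod (poly B1 z))\<^sup>2)"
      by (rule order_trans[OF m(2)[OF that] sqrt_add_le_add_sqrt]) auto
    then show ?thesis by simp
  qed
  obtain d where d: "d > 0" "\<And>z. z \<in> L \<Longrightarrow> d \<le> sqrt ((cmod (poly A2 z))\<^sup>2 + (cmod (poly B2 z))\<^sup>2)"
    by (rule compact_pair_norm_ge[OF L, of "poly A2" "poly B2"]) (use AB2 in \<open>auto intro!: continuous_intros\<close>)
  \<comment> \<open>In order, the four bounds keep the denominator on \<open>K\<close> at least m /
    4, make the error on \<open>K\<close> at most \<open>\<epsilon>\<close>, make the chordal error
    on \<open>L\<close> at most \<open>\<epsilon>\<close>, and prevent the perturbed pair on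
    \<open>L\<close> from vanishing.\<close>
  define \<eta> where "\<eta> = Min {m / (4 * M), \<epsilon> * m\<^sup>2 / (16 * M\<^sup>2), \<epsilon> * d / (2 * M), d / (4 * M)}"
  have eta: "\<eta> > 0" using m d M0 e by (simp add: \<eta>_def)
  have eta4: "\<eta> \<le> m / (4 * M)" "\<eta> \<le> \<epsilon> * m\<^sup>2 / (16 * M\<^sup>2)" "\<eta> \<le> \<epsilon> * d / (2 * M)" "\<eta> \<le> d / (4 * M)"
    by (simp_all add: \<eta>_def)
  have eta': "M * \<eta> \<le> m / 4" "2 * M * M * \<eta> \<le> \<epsilon> * (m / 2 * (m / 4))" "2 * M * \<eta> \<le> \<epsilon> * d" "2 * M * \<eta> < d"
  proof -
    show "M * \<eta> \<le> m / 4" using eta4(1) M0 by (simp add: field_simps)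
    have "2 * M * M * \<eta> \<le> 2 * M * M * (\<epsilon> * m\<^sup>2 / (16 * M\<^sup>2))" using eta4(2) M0 by (intro mult_left_mono) auto
    also have "\<dots> = \<epsilon> * (m / 2 * (m / 4))" using M0 by (simp add: power2_eq_square)
    finally show "2 * M * M * \<eta> \<le> \<epsilon> * (m / 2 * (m / 4))" .
    show "2 * M * \<eta> \<le> \<epsilon> * d" using eta4(3) M0 by (simp add: field_simps)
    have "2 * M * \<eta> \<le> d / 2" using eta4(4) M0 by (simp add: field_simps)
    then show "2 * M * \<eta> < d" using d by linarith
  qed
  obtain X Y where XY: "\<And>z. z \<in> K \<Longrightarrow> poly X z \<noteq> 0 \<and> cmod (poly Y z) \<le> \<eta> * cmod (poly X z)"
    "\<And>z. z \<in> L \<Longrightarrow> poly Y z \<noteq> 0 \<and> cmod (poly X z) \<le> \<eta> * cmod (poly Y z)"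
    using separating_polys_strong[OF K L dis eta] by metis
  show thesis
  proof (rule that[of "B1 * X + B2 * Y" "A1 * X + A2 * Y"])
    fix z assume z: "z \<in> K"
    define F where "F = poly Y z / poly X z"
    have X: "poly X z \<noteq> 0" and F: "cmod F \<le> \<eta>"
      using XY(1)[OF z] by (auto simp: F_def norm_divide pos_divide_le_eq)
    have FX: "poly X z * F = poly Y z" using X by (simp add: F_def)
    let ?a = "poly A1 z" and ?b = "poly B1 z" and ?c = "poly A2 z" and ?d = "poly B2 z"
    have bnz: "?b \<noteq> 0" using B1 z by auto
    have D: "poly (B1 * X + B2 * Y) z = poly X z * (?b + ?d * F)" and N: "poly (A1 * X + A2 * Y) z = poly X z * (?a + ?c * F)"
      unfolding poly_add poly_mult FX[symmetric] by (simp_all add: algebra_simps)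
    have "cmod (?d * F) \<le> M * \<eta>" using MM(4)[of z] z F M0 by (simp add: norm_mult mult_mono)
    then have dF: "m / 4 \<le> cmod (?b + ?d * F)"
      using eta'(1) mB[OF z] norm_diff_ineq[of ?b "?d * F"] by linarith
    then have nz: "?b + ?d * F \<noteq> 0" using m by auto
    have eq: "(?a + ?c * F) / (?b + ?d * F) - ?a / ?b = F * (?c * ?b - ?a * ?d) / (?b * (?b + ?d * F))"
      using nz bnz by (simp add: divide_simps) (simp add: algebra_simps)
    have "cmod (?c * ?b - ?a * ?d) \<le> M * M + M * M"
      using MM[of z] z M0 by (intro order_trans[OF norm_triangle_ineq4] add_mono) (auto simp: norm_mult intro!: mult_mono)
    then have num: "cmod (F * (?c * ?b - ?a * ?d)) \<le> \<eta> * (M * M + M * M)"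
      using F eta M0 by (simp add: norm_mult mult_mono)
    have den: "m / 2 * (m / 4) \<le> cmod (?b * (?b + ?d * F))"
      unfolding norm_mult using mB[OF z] dF m by (intro mult_mono) auto
    have "cmod ((?a + ?c * F) / (?b + ?d * F) - ?a / ?b) \<le> \<eta> * (M * M + M * M) / (m / 2 * (m / 4))"
      unfolding eq norm_divide using num den m eta M0 by (intro frac_le) auto
    also have "\<dots> \<le> \<epsilon>" using eta'(2) m by (subst pos_divide_le_eq) (auto simp: algebra_simps)
    finally show "poly (B1 * X + B2 * Y) z \<noteq> 0 \<and>
        cmod (poly (A1 * X + A2 * Y) z / poly (B1 * X + B2 * Y) z - ?a / ?b) \<le> \<epsilon>"
      unfolding D N using nz X by simp
  next
    fix z assume z: "z \<in> L"
    define G where "G = poly X z / poly Y z"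
    have Y: "poly Y z \<noteq> 0" and G: "cmod G \<le> \<eta>"
      using XY(2)[OF z] by (auto simp: G_def norm_divide pos_divide_le_eq)
    have GY: "poly Y z * G = poly X z" using Y by (simp add: G_def)
    let ?a = "poly A1 z" and ?b = "poly B1 z" and ?c = "poly A2 z" and ?d = "poly B2 z"
    have D: "poly (B1 * X + B2 * Y) z = poly Y z * (?d + ?b * G)" and N: "poly (A1 * X + A2 * Y) z = poly Y z * (?c + ?a * G)"
      unfolding poly_add poly_mult GY[symmetric] by (simp_all add: algebra_simps)
    have ab: "cmod (?a * G) \<le> M * \<eta>" "cmod (?b * G) \<le> M * \<eta>"
      using MM[of z] z G M0 by (auto simp: norm_mult intro!: mult_mono)
    have nz: "?c + ?a * G \<noteq> 0 \<or> ?d + ?b * G \<noteq> 0"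
    proof (rule ccontr)
      assume "\<not> ?thesis"
      then have "?c = - (?a * G)" "?d = - (?b * G)" by (simp_all add: eq_neg_iff_add_eq_0)
      then have "cmod ?c = cmod (?a * G)" "cmod ?d = cmod (?b * G)" by (metis norm_minus_cancel)+
      then have "cmod ?c + cmod ?d < d" using ab eta'(4) by linarith
      moreover have "sqrt ((cmod ?c)\<^sup>2 + (cmod ?d)\<^sup>2) \<le> cmod ?c + cmod ?d"
        by (rule sqrt_sum_squares_le_sum) auto
      ultimately show False using d(2)[OF z] by linarith
    qed
    have "chordal (sphere_ratio (?c + ?a * G) (?d + ?b * G)) (sphere_ratio ?c ?d)
       \<le> (cmod (?c + ?a * G - ?c) + cmod (?d + ?b * G - ?d)) / sqrt ((cmod ?c)\<^sup>2 + (cmod ?d)\<^sup>2)"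
      by (rule chordal_sphere_ratio_le[OF nz AB2[OF z]])
    also have "\<dots> \<le> (2 * M * \<eta>) / d"
      using ab d(1) d(2)[OF z] M0 eta by (intro frac_le) auto
    also have "\<dots> \<le> \<epsilon>" using eta'(3) d by (simp add: pos_divide_le_eq)
    finally show "(poly (A1 * X + A2 * Y) z \<noteq> 0 \<or> poly (B1 * X + B2 * Y) z \<noteq> 0) \<and>
       chordal (sphere_ratio (poly (A1 * X + A2 * Y) z) (poly (B1 * X + B2 * Y) z)) (sphere_ratio ?c ?d) \<le> \<epsilon>"
      unfolding D N using nz Y by (simp add: sphere_ratio_scale)
  qed
qed

text \<open>Reduction to lowest terms preserves the value in the sphere wherever \<open>N\<close>
  and \<open>D\<close> have no common zero, hence on \<open>K\<close> and \<open>L\<close>.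
  Coprimality later makes the Hankel determinant non-zero.\<close>

lemma simultaneous_rational_approx:
  fixes K L :: "complex set"
  assumes K: "compact K" and L: "compact L" and dis: "K \<inter> L = {}"
    and B1: "B1 \<noteq> 0" "\<And>z. z \<in> K \<Longrightarrow> poly B1 z \<noteq> 0" and e: "\<epsilon> > 0"
  obtains A B where "coprime A B" "B \<noteq> 0"
    "\<And>z. z \<in> K \<Longrightarrow> poly B z \<noteq> 0 \<and> cmod (poly A z / poly B z - poly A1 z / poly B1 z) \<le> \<epsilon>"
    "\<And>z. z \<in> L \<Longrightarrow> chordal (sphere_ratio (poly A z) (poly B z)) (rat_eval h z) \<le> \<epsilon>"
proof -
  \<comment> \<open>The extra point \<open>z0\<close> forces a nonzero denominator even if \<open>K\<close> is empty.\<close>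
  have "infinite (- L)"
    using L not_bounded_UNIV compact_imp_bounded
    by (metis Compl_eq_Diff_UNIV Diff_infinite_finite bounded_Un bounded_subset finite_imp_bounded sup_compl_top top.extremum)
  then have "infinite (- L - {z. poly B1 z = 0})" using poly_roots_finite[OF B1(1)] by simp
  then obtain z0 where z0: "z0 \<notin> L" "poly B1 z0 \<noteq> 0"
    by (metis (mono_tags, lifting) ComplD DiffE finite.emptyI mem_Collect_eq subsetI subset_empty)
  obtain P Q where PQ: "\<And>z. poly P z \<noteq> 0 \<or> poly Q z \<noteq> 0" "\<And>z. rat_eval h z = sphere_ratio (poly P z) (poly Q z)"
    using rat_eval_coprime_pair[of h] by metis
  obtain N D where ND:
    "\<And>z. z \<in> insert z0 K \<Longrightarrow> poly D z \<noteq> 0 \<and> cmod (poly N z / poly D z - poly A1 z / poly B1 z) \<le> \<epsilon>"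
    "\<And>z. z \<in> L \<Longrightarrow> (poly N z \<noteq> 0 \<or> poly D z \<noteq> 0) \<and>
       chordal (sphere_ratio (poly N z) (poly D z)) (sphere_ratio (poly P z) (poly Q z)) \<le> \<epsilon>"
    by (rule simultaneous_rational_approx_aux[of "insert z0 K" L B1 P Q \<epsilon> A1]) (use K L dis B1 z0 PQ(1) e in auto)
  have D0: "D \<noteq> 0" using ND(1)[of z0] by auto
  obtain A B where AB: "coprime A B" "B \<noteq> 0" "Fract N D = Fract A B" "\<And>z. poly A z \<noteq> 0 \<or> poly B z \<noteq> 0"
    "\<And>z. rat_eval (Fract N D) z = sphere_ratio (poly A z) (poly B z)"
    using rat_eval_coprime_pair by metis
  have pe: "sphere_ratio (poly A z) (poly B z) = sphere_ratio (poly N z) (poly D z)" if "poly N z \<noteq> 0 \<or> poly D z \<noteq> 0" for z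
    using rat_eval_Fract[OF that D0] AB(5) by simp
  show thesis
  proof (rule that[OF AB(1,2)])
    fix z assume z: "z \<in> K"
    have "sphere_ratio (poly A z) (poly B z) = sphere_ratio (poly N z) (poly D z)" using ND(1)[of z] z pe by blast
    then have "poly B z \<noteq> 0" "poly A z / poly B z = poly N z / poly D z"
      using ND(1)[of z] z by (auto simp: sphere_ratio_def split: if_splits)
    then show "poly B z \<noteq> 0 \<and> cmod (poly A z / poly B z - poly A1 z / poly B1 z) \<le> \<epsilon>"
      using ND(1)[of z] z by simp
  next
    fix z assume "z \<in> L"
    then show "chordal (sphere_ratio (poly A z) (poly B z)) (rat_eval h z) \<le> \<epsilon>"
      using ND(2)[of z] PQ(2) pe by simp
  qed
qed

section \<open>Moving poles\<close>

text \<open>\<open>U\<close> is meant to be a neighbourhood of the current compact set, on which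
  closeness controls derivatives; \<open>K\<close> is the next, larger compact set, which the new
  poles must avoid.\<close>

definition rat_approximable :: "complex set \<Rightarrow> complex set \<Rightarrow> (complex \<Rightarrow> complex) \<Rightarrow> bool" where
  "rat_approximable U K g \<longleftrightarrow> (\<forall>\<epsilon>>0. \<exists>A B. B \<noteq> 0 \<and> (\<forall>z\<in>K. poly B z \<noteq> 0) \<and>
     (\<forall>z\<in>U. poly B z \<noteq> 0 \<and> cmod (g z - poly A z / poly B z) \<le> \<epsilon>))"

lemma rat_approximable_rational:
  assumes "B \<noteq> 0" "\<And>z. z \<in> K \<union> U \<Longrightarrow> poly B z \<noteq> 0"
  shows "rat_approximable U K (\<lambda>z. poly A z / poly B z)"
  unfolding rat_approximable_def using assms by (intro allI impI exI[of _ A] exI[of _ B]) auto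

lemma rat_approximable_limit:
  assumes "\<And>\<epsilon>. \<epsilon> > 0 \<Longrightarrow> \<exists>h. rat_approximable U K h \<and> (\<forall>z\<in>U. cmod (g z - h z) \<le> \<epsilon>)"
  shows "rat_approximable U K g"
  unfolding rat_approximable_def
proof (intro allI impI)
  fix \<epsilon> :: real assume e: "\<epsilon> > 0"
  obtain h where h: "rat_approximable U K h" "\<And>z. z \<in> U \<Longrightarrow> cmod (g z - h z) \<le> \<epsilon> / 2"
    using assms[of "\<epsilon> / 2"] e by auto
  obtain A B where AB: "B \<noteq> 0" "\<forall>z\<in>K. poly B z \<noteq> 0"
    "\<forall>z\<in>U. poly B z \<noteq> 0 \<and> cmod (h z - poly A z / poly B z) \<le> \<epsilon> / 2"
    using h(1) e unfolding rat_approximable_def by (meson half_gt_zero)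
  have "cmod (g z - poly A z / poly B z) \<le> \<epsilon>" if "z \<in> U" for z
    using norm_triangle_ineq[of "g z - h z" "h z - poly A z / poly B z"] h(2)[OF that] AB(3) that by auto
  with AB show "\<exists>A B. B \<noteq> 0 \<and> (\<forall>z\<in>K. poly B z \<noteq> 0) \<and>
     (\<forall>z\<in>U. poly B z \<noteq> 0 \<and> cmod (g z - poly A z / poly B z) \<le> \<epsilon>)" by blast
qed

lemma rat_approximable_add:
  assumes "rat_approximable U K f" "rat_approximable U K g"
  shows "rat_approximable U K (\<lambda>z. f z + g z)"
  unfolding rat_approximable_def
proof (intro allI impI)
  fix \<epsilon> :: real assume e: "\<epsilon> > 0"
  obtain A B where AB: "B \<noteq> 0" "\<forall>z\<in>K. poly B z \<noteq> 0"
    "\<forall>z\<in>U. poly B z \<noteq> 0 \<and> cmod (f z - poly A z / poly B z) \<le> \<epsilon> / 2"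
    using assms(1) e unfolding rat_approximable_def by (meson half_gt_zero)
  obtain C D where CD: "D \<noteq> 0" "\<forall>z\<in>K. poly D z \<noteq> 0"
    "\<forall>z\<in>U. poly D z \<noteq> 0 \<and> cmod (g z - poly C z / poly D z) \<le> \<epsilon> / 2"
    using assms(2) e unfolding rat_approximable_def by (meson half_gt_zero)
  have "cmod (f z + g z - poly (A * D + C * B) z / poly (B * D) z) \<le> \<epsilon>" if "z \<in> U" for z
  proof -
    have "poly (A * D + C * B) z / poly (B * D) z = poly A z / poly B z + poly C z / poly D z"
      using AB CD that by (simp add: add_frac_eq)
    then have "f z + g z - poly (A * D + C * B) z / poly (B * D) z
      = (f z - poly A z / poly B z) + (g z - poly C z / poly D z)" by simp
    then show ?thesis
      using norm_triangle_ineq[of "f z - poly A z / poly B z" "g z - poly C z / poly D z"]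
        conjunct2[OF bspec[OF AB(3) that]] conjunct2[OF bspec[OF CD(3) that]] by (simp only: mult_2)
  qed
  with AB CD show "\<exists>A B. B \<noteq> 0 \<and> (\<forall>z\<in>K. poly B z \<noteq> 0) \<and>
     (\<forall>z\<in>U. poly B z \<noteq> 0 \<and> cmod (f z + g z - poly A z / poly B z) \<le> \<epsilon>)"
    by (intro exI[of _ "A * D + C * B"] exI[of _ "B * D"]) auto
qed

lemma rat_approximable_mult:
  assumes "rat_approximable U K f" "rat_approximable U K g"
    and fb: "\<And>z. z \<in> U \<Longrightarrow> cmod (f z) \<le> M" and gb: "\<And>z. z \<in> U \<Longrightarrow> cmod (g z) \<le> M"
  shows "rat_approximable U K (\<lambda>z. f z * g z)"
  unfolding rat_approximable_def
proof (intro allI impI)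
  fix \<epsilon> :: real assume e: "\<epsilon> > 0"
  define N where "N = max M 1"
  have N: "N \<ge> 1" "M \<le> N" by (auto simp: N_def)
  \<comment> \<open>With \<delta> \<le> 1 the approximant of \<open>f\<close> is bounded by N + 1,
    and the error of the product is at most \<delta> N + (N + 1) \<delta>.\<close>
  define \<delta> where "\<delta> = min 1 (\<epsilon> / (2 * N + 1))"
  have d: "\<delta> > 0" "\<delta> \<le> 1" using e N by (auto simp: \<delta>_def)
  have "\<delta> * (2 * N + 1) \<le> \<epsilon> / (2 * N + 1) * (2 * N + 1)"
    using N by (intro mult_right_mono) (auto simp: \<delta>_def)
  then have dN: "\<delta> * (2 * N + 1) \<le> \<epsilon>" using N by simp
  obtain A B where AB: "B \<noteq> 0" "\<forall>z\<in>K. poly B z \<noteq> 0"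
    "\<forall>z\<in>U. poly B z \<noteq> 0 \<and> cmod (f z - poly A z / poly B z) \<le> \<delta>"
    using assms(1) d(1) unfolding rat_approximable_def by meson
  obtain C D where CD: "D \<noteq> 0" "\<forall>z\<in>K. poly D z \<noteq> 0"
    "\<forall>z\<in>U. poly D z \<noteq> 0 \<and> cmod (g z - poly C z / poly D z) \<le> \<delta>"
    using assms(2) d(1) unfolding rat_approximable_def by meson
  have "cmod (f z * g z - poly (A * C) z / poly (B * D) z) \<le> \<epsilon>" if z: "z \<in> U" for z
  proof -
    define p q where "p = poly A z / poly B z" and "q = poly C z / poly D z"
    have pq: "cmod (f z - p) \<le> \<delta>" "cmod (g z - q) \<le> \<delta>" using AB(3) CD(3) z by (auto simp: p_def q_def)
    have fg: "cmod (f z) \<le> N" "cmod (g z) \<le> N" using fb[OF z] gb[OF z] N by auto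
    have p: "cmod p \<le> N + 1"
      using norm_triangle_ineq4[of "f z" "f z - p"] pq(1) fg(1) d(2) by simp
    have "f z * g z - p * q = (f z - p) * g z + p * (g z - q)" by (simp add: algebra_simps)
    then have "cmod (f z * g z - p * q) \<le> cmod (f z - p) * cmod (g z) + cmod p * cmod (g z - q)"
      by (metis norm_mult norm_triangle_ineq)
    also have "\<dots> \<le> \<delta> * N + (N + 1) * \<delta>"
      using pq fg p d N by (intro add_mono mult_mono) auto
    also have "\<dots> \<le> \<epsilon>" using dN by (simp add: algebra_simps)
    finally show ?thesis by (simp add: p_def q_def)
  qed
  with AB CD show "\<exists>A B. B \<noteq> 0 \<and> (\<forall>z\<in>K. poly B z \<noteq> 0) \<and>
     (\<forall>z\<in>U. poly B z \<noteq> 0 \<and> cmod (f z * g z - poly A z / poly B z) \<le> \<epsilon>)"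
    by (intro exI[of _ "A * C"] exI[of _ "B * D"]) auto
qed

lemma rat_approximable_const: "rat_approximable U K (\<lambda>z. c)"
  using rat_approximable_rational[of 1 K U "[:c:]"] by simp

lemma rat_approximable_power:
  assumes "rat_approximable U K f" "\<And>z. z \<in> U \<Longrightarrow> cmod (f z) \<le> M"
  shows "rat_approximable U K (\<lambda>z. f z ^ n)"
proof (induction n)
  case (Suc n)
  define N where "N = max 1 M"
  have b: "cmod (f z) ^ n \<le> N ^ n" "cmod (f z) \<le> N" if "z \<in> U" for z
    using assms(2)[OF that] by (auto simp: N_def intro!: power_mono)
  have N: "N \<ge> 1" "N ^ n \<ge> 0" by (auto simp: N_def)
  have "cmod (f z) \<le> N + N ^ n" "cmod (f z ^ n) \<le> N + N ^ n" if "z \<in> U" for z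
    using b[OF that] N unfolding norm_power by linarith+
  then show ?case unfolding power_Suc
    by (rule rat_approximable_mult[OF assms(1) Suc])
qed (use rat_approximable_const in simp)

lemma rat_approximable_sum:
  assumes "\<And>k. k \<in> I \<Longrightarrow> rat_approximable U K (f k)"
  shows "rat_approximable U K (\<lambda>z. \<Sum>k\<in>I. f k z)"
  using assms
  by (induction I rule: infinite_finite_induct) (auto intro: rat_approximable_const rat_approximable_add)

text \<open>Expand 1 / (z - a) as the geometric series of (a - b)^k / (z - b)^(k + 1). Its ratio has
  modulus at most 1/2 on \<open>U\<close>, and its partial sums only have the pole
  \<open>b\<close>.\<close>

lemma rat_approximable_move_pole:
  assumes r: "r > 0" and a: "\<And>z. z \<in> U \<Longrightarrow> r \<le> cmod (z - a)" and b: "\<And>z. z \<in> U \<Longrightarrow> r \<le> cmod (z - b)"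
    and ab: "cmod (a - b) \<le> r / 2" and app: "rat_approximable U K (\<lambda>z. 1 / (z - b))"
  shows "rat_approximable U K (\<lambda>z. 1 / (z - a))"
proof (rule rat_approximable_limit)
  fix \<epsilon> :: real assume e: "\<epsilon> > 0"
  obtain n where n: "(1 / 2) ^ n < \<epsilon> * r"
    using real_arch_pow_inv[of "\<epsilon> * r" "1 / 2"] e r by auto
  define h where "h = (\<lambda>z. \<Sum>k<n. (a - b) ^ k * (1 / (z - b)) ^ Suc k)"
  have bd: "cmod (1 / (z - b)) \<le> 1 / r" if "z \<in> U" for z
    using b[OF that] r by (simp add: norm_divide frac_le)
  have "rat_approximable U K h"
    unfolding h_def
  proof (rule rat_approximable_sum)
    fix k
    show "rat_approximable U K (\<lambda>z. (a - b) ^ k * (1 / (z - b)) ^ Suc k)"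
    proof (rule rat_approximable_mult[OF rat_approximable_const rat_approximable_power[OF app bd]])
      fix z assume "z \<in> U"
      then have "cmod (1 / (z - b)) ^ Suc k \<le> (1 / r) ^ Suc k" by (intro power_mono bd) auto
      then have "cmod ((1 / (z - b)) ^ Suc k) \<le> (1 / r) ^ Suc k" by (simp only: norm_power)
      then show "cmod ((1 / (z - b)) ^ Suc k) \<le> cmod ((a - b) ^ k) + (1 / r) ^ Suc k"
        using norm_ge_zero[of "(a - b) ^ k"] by linarith
      show "cmod ((a - b) ^ k) \<le> cmod ((a - b) ^ k) + (1 / r) ^ Suc k" using r by simp
    qed
  qed
  moreover have "cmod (1 / (z - a) - h z) \<le> \<epsilon>" if z: "z \<in> U" for z
  proof -
    define x where "x = (a - b) / (z - b)"
    have nz: "z - a \<noteq> 0" "z - b \<noteq> 0" using a[OF z] b[OF z] r by auto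
    have x: "cmod x \<le> 1 / 2"
    proof -
      have "cmod x \<le> (r / 2) / r" unfolding x_def norm_divide using ab b[OF z] r by (intro frac_le) auto
      then show ?thesis using r by simp
    qed
    then have x1: "x \<noteq> 1" by auto
    have zz: "(z - b) * (1 - x) = z - a" using nz by (simp add: x_def field_simps)
    have "h z = (\<Sum>k<n. x ^ k) / (z - b)"
      unfolding h_def sum_divide_distrib by (intro sum.cong) (auto simp: x_def power_divide)
    also have "\<dots> = (1 - x ^ n) / (z - a)"
      using x1 by (subst sum_gp_strict) (simp add: zz[symmetric])
    finally have "1 / (z - a) - h z = x ^ n / (z - a)" by (simp add: diff_divide_distrib)
    then have "cmod (1 / (z - a) - h z) = cmod x ^ n / cmod (z - a)" by (simp add: norm_divide norm_power)
    also have "\<dots> \<le> (1 / 2) ^ n / r" using x a[OF z] r by (intro frac_le power_mono) auto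
    also have "\<dots> \<le> \<epsilon>" using n r by (simp add: pos_divide_le_eq)
    finally show ?thesis .
  qed
  ultimately show "\<exists>h. rat_approximable U K h \<and> (\<forall>z\<in>U. cmod (1 / (z - a) - h z) \<le> \<epsilon>)" by blast
qed

text \<open>Cut the segment into steps of length at most r / 2. The pole \<open>b\<close> is
  admissible outright, and approximability propagates back from \<open>b\<close> to \<open>a\<close>
  one step at a time.\<close>

lemma rat_approximable_inverse_segment:
  assumes r: "r > 0" and seg: "\<And>z w. z \<in> U \<Longrightarrow> w \<in> closed_segment a b \<Longrightarrow> r \<le> cmod (z - w)" and b: "b \<notin> K"
  shows "rat_approximable U K (\<lambda>z. 1 / (z - a))"
proof -
  obtain n :: nat where n: "cmod (b - a) / (r / 2) < real n" using reals_Archimedean2 by blast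
  then have n': "cmod (b - a) \<le> real n * (r / 2)" "n > 0"
    using r by (auto simp: pos_divide_less_eq intro: gr0I)
  define c where "c = (\<lambda>k::nat. a + (real k / real n) *\<^sub>R (b - a))"
  have c: "c k \<in> closed_segment a b" if "k \<le> n" for k
  proof -
    have "c k = (1 - real k / real n) *\<^sub>R a + (real k / real n) *\<^sub>R b"
      by (simp add: c_def algebra_simps)
    then show ?thesis unfolding in_segment using that n'(2) by (intro exI[of _ "real k / real n"]) auto
  qed
  have "rat_approximable U K (\<lambda>z. 1 / (z - c k))" if "k \<le> n" for k
    using that
  proof (induction rule: inc_induct)
    case base
    have "c n = b" using n'(2) by (simp add: c_def)
    moreover have "z \<noteq> b" if "z \<in> U" for z using seg[OF that, of b] r by auto
    ultimately show ?case using b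
      using rat_approximable_rational[of "[:- b, 1:]" K U 1] by (auto simp: add.commute)
  next
    case (step k)
    have "c k - c (Suc k) = - ((1 / real n) *\<^sub>R (b - a))"
      by (simp add: c_def add_divide_distrib algebra_simps)
    then have "cmod (c k - c (Suc k)) = cmod (b - a) / real n" by simp
    also have "\<dots> \<le> r / 2" using n' by (simp add: pos_divide_le_eq mult.commute)
    finally show ?case
      using step c[of k] c[of "Suc k"]
      by (intro rat_approximable_move_pole[OF r, where a = "c k" and b = "c (Suc k)"] seg) auto
  qed
  from this[of 0] show ?thesis by (simp add: c_def)
qed

text \<open>Induction on the degree of \<open>B\<close> splits off one factor 1 / (z - a) per root.
  Boundedness on \<open>U\<close> is carried along because the product rule requires it.\<close>

lemma rat_approximable_rational_general:
  assumes U: "bounded U" and r: "r > 0" and "B \<noteq> 0"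
    and "\<And>a. poly B a = 0 \<Longrightarrow> \<exists>b. b \<notin> K \<and> (\<forall>z\<in>U. \<forall>w\<in>closed_segment a b. r \<le> cmod (z - w))"
  shows "rat_approximable U K (\<lambda>z. poly A z / poly B z) \<and> (\<exists>M. \<forall>z\<in>U. cmod (poly A z / poly B z) \<le> M)"
  using assms(3,4)
proof (induction "degree B" arbitrary: B)
  case 0
  obtain c where B: "B = [:c:]" using 0 by (metis degree_eq_zeroE)
  then have c: "c \<noteq> 0" using 0 by auto
  obtain M where "\<And>z. z \<in> closure U \<Longrightarrow> cmod (poly A z) \<le> M"
    using compact_poly_bounded[of "closure U"] U compact_closure by metis
  then have "\<forall>z\<in>U. cmod (poly A z / poly B z) \<le> M / cmod c"
    using closure_subset by (auto simp: B norm_divide intro!: divide_right_mono)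
  then show ?case using c rat_approximable_rational[of B K U A] B by auto
next
  case (Suc n)
  obtain a where a: "poly B a = 0"
    using fundamental_theorem_of_algebra[of B] Suc.hyps(2) by (metis constant_degree nat.distinct(1))
  then obtain C where C: "B = [:- a, 1:] * C" by (auto simp: poly_eq_0_iff_dvd)
  have C0: "C \<noteq> 0" using C Suc.prems(1) by auto
  have "degree B = degree C + 1" unfolding C using C0 by (subst degree_mult_eq) auto
  then have deg: "n = degree C" using Suc.hyps(2) by simp
  have IH: "rat_approximable U K (\<lambda>z. poly A z / poly C z)" "\<exists>M. \<forall>z\<in>U. cmod (poly A z / poly C z) \<le> M"
    using Suc.hyps(1)[OF deg C0] Suc.prems(2) unfolding C by auto
  then obtain M where M: "\<And>z. z \<in> U \<Longrightarrow> cmod (poly A z / poly C z) \<le> M" by blast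
  obtain b where b: "b \<notin> K" "\<And>z w. z \<in> U \<Longrightarrow> w \<in> closed_segment a b \<Longrightarrow> r \<le> cmod (z - w)"
    using Suc.prems(2)[OF a] by blast
  have inv: "cmod (1 / (z - a)) \<le> 1 / r" if "z \<in> U" for z
    using b(2)[OF that, of a] r by (simp add: norm_divide frac_le)
  have eq: "poly A z / poly B z = poly A z / poly C z * (1 / (z - a))" for z
    unfolding C poly_mult by (simp add: mult.commute)
  have "rat_approximable U K (\<lambda>z. poly A z / poly C z * (1 / (z - a)))"
  proof (rule rat_approximable_mult[OF IH(1) rat_approximable_inverse_segment[OF r b(2) b(1)]])
    fix z assume z: "z \<in> U"
    have "0 \<le> M" using M[OF z] norm_ge_zero order_trans by blast
    then show "cmod (poly A z / poly C z) \<le> M + 1 / r" "cmod (1 / (z - a)) \<le> M + 1 / r"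
      using M[OF z] inv[OF z] r by (auto intro: add_increasing add_increasing2)
  qed
  moreover have "cmod (poly A z / poly B z) \<le> M * (1 / r)" if "z \<in> U" for z
    unfolding eq norm_mult using M[OF that] inv[OF that] order_trans[OF norm_ge_zero M[OF that]]
    by (intro mult_mono) auto
  ultimately show ?case unfolding eq by blast
qed

text \<open>Only finitely many segments occur, one per root of \<open>B\<close>, so they keep a
  common distance 2 r from \<open>K\<close>. The r-neighbourhood \<open>U\<close> of
  \<open>K\<close> then keeps distance \<open>r\<close> from all of them.\<close>

lemma push_poles:
  assumes K: "compact K" and B: "B \<noteq> 0" "\<And>z. z \<in> K \<Longrightarrow> poly B z \<noteq> 0"
    and push: "\<And>a. a \<notin> K \<Longrightarrow> \<exists>b. b \<notin> K' \<and> closed_segment a b \<inter> K = {}"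
  obtains U where "open U" "K \<subseteq> U" "rat_approximable U K' (\<lambda>z. poly A z / poly B z)" "\<And>z. z \<in> U \<Longrightarrow> poly B z \<noteq> 0"
proof -
  have "\<forall>a\<in>{a. poly B a = 0}. \<exists>b. b \<notin> K' \<and> closed_segment a b \<inter> K = {}" using push B(2) by blast
  from bchoice[OF this] obtain b where
    b: "\<And>a. poly B a = 0 \<Longrightarrow> b a \<notin> K' \<and> closed_segment a (b a) \<inter> K = {}"
    by blast
  have "\<forall>a\<in>{a. poly B a = 0}. \<exists>d. d > 0 \<and> (\<forall>z\<in>K. \<forall>w\<in>closed_segment a (b a). d \<le> dist z w)"
  proof
    fix a assume "a \<in> {a. poly B a = 0}"
    then show "\<exists>d. d > 0 \<and> (\<forall>z\<in>K. \<forall>w\<in>closed_segment a (b a). d \<le> dist z w)"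
      using separate_compact_closed[OF K, of "closed_segment a (b a)"] b[of a] by (auto simp: inf_commute)
  qed
  from bchoice[OF this] obtain d where d: "\<And>a. poly B a = 0 \<Longrightarrow> d a > 0"
    "\<And>a z w. poly B a = 0 \<Longrightarrow> z \<in> K \<Longrightarrow> w \<in> closed_segment a (b a) \<Longrightarrow> d a \<le> dist z w" by blast
  have fin: "finite {a. poly B a = 0}" using B(1) by (rule poly_roots_finite)
  \<comment> \<open>The inserted 1 covers a denominator without roots.\<close>
  define r where "r = Min (insert 1 (d ` {a. poly B a = 0})) / 2"
  have r: "r > 0" unfolding r_def using fin d(1) by auto
  have r2: "2 * r \<le> d a" if "poly B a = 0" for a
    unfolding r_def using fin that by auto
  define U where "U = (\<Union>z\<in>K. ball z r)"
  have sep: "r \<le> cmod (z - w)" if z: "z \<in> U" and a: "poly B a = 0" and w: "w \<in> closed_segment a (b a)" for z w a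
  proof -
    obtain y where y: "y \<in> K" "dist y z < r" using z by (auto simp: U_def)
    have "2 * r \<le> dist y w" using r2[OF a] d(2)[OF a y(1) w] by linarith
    then show ?thesis using dist_triangle[of y w z] y(2) by (simp add: dist_norm)
  qed
  have bU: "bounded U"
  proof -
    obtain M where M: "\<And>z. z \<in> K \<Longrightarrow> cmod z \<le> M" using compact_imp_bounded[OF K] by (auto simp: bounded_iff)
    have "cmod z \<le> M + r" if z: "z \<in> U" for z
    proof -
      obtain y where y: "y \<in> K" "dist y z < r" using z by (auto simp: U_def)
      then show ?thesis using M[OF y(1)] norm_triangle_ineq4[of y "y - z"] by (simp add: dist_norm)
    qed
    then show ?thesis by (auto simp: bounded_iff)
  qed
  show thesis
  proof (rule that[of U])
    show "open U" unfolding U_def by auto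
    show "K \<subseteq> U" using r by (auto simp: U_def)
    show "rat_approximable U K' (\<lambda>z. poly A z / poly B z)"
      using rat_approximable_rational_general[OF bU r B(1), of K' A] b sep by meson
    \<comment> \<open>A root in \<open>U\<close> would be the starting point of its own segment, at
      distance 0 from itself.\<close>
    show "poly B z \<noteq> 0" if "z \<in> U" for z
      using sep[OF that, of z z] r by auto
  qed
qed

section \<open>Taylor coefficients of rational functions and the inductive approximation
  step\<close>

definition rat_taylor :: "complex poly \<Rightarrow> complex poly \<Rightarrow> complex \<Rightarrow> nat \<Rightarrow> complex" where
  "rat_taylor A B \<zeta> k = (deriv ^^ k) (\<lambda>z. poly A z / poly B z) \<zeta> / fact k"

text \<open>Cauchy's inequality on discs of one radius r \<le> 1 around the points of
  \<open>K\<close>. The constant 1 / r^l depends on neither the function nor the centre and serves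
  all orders up to \<open>l\<close>.\<close>

lemma taylor_bound_on_compact:
  assumes K: "compact K" and U: "open U" "K \<subseteq> U"
  obtains c where "c > 0"
    "\<And>\<phi> \<eta> \<zeta> k. \<lbrakk>\<phi> holomorphic_on U; \<And>z. z \<in> U \<Longrightarrow> cmod (\<phi> z) \<le> \<eta>; \<zeta> \<in> K; k \<le> l\<rbrakk> \<Longrightarrow>
       cmod ((deriv ^^ k) \<phi> \<zeta> / fact k) \<le> c * \<eta>"
proof -
  obtain e where e: "e > 0" "(\<Union>x\<in>K. cball x e) \<subseteq> U"
    using compact_subset_open_imp_cball_epsilon_subset[OF K U] by blast
  define r where "r = min e 1"
  have r: "0 < r" "r \<le> 1" "r \<le> e" using e by (auto simp: r_def)
  show thesis
  proof (rule that[of "1 / r ^ l"])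
    fix \<phi> :: "complex \<Rightarrow> complex" and \<eta> \<zeta> k
    assume phi: "\<phi> holomorphic_on U" "\<And>z. z \<in> U \<Longrightarrow> cmod (\<phi> z) \<le> \<eta>" "\<zeta> \<in> K" "k \<le> l"
    have sub: "cball \<zeta> r \<subseteq> U" using e(2) phi(3) r(3) by (force simp: subset_iff)
    have hol: "\<phi> holomorphic_on cball \<zeta> r" using phi(1) sub by (rule holomorphic_on_subset)
    have eta: "0 \<le> \<eta>" using phi(2)[of \<zeta>] phi(3) U by (meson norm_ge_zero order_trans subsetD)
    have "cmod ((deriv ^^ k) \<phi> \<zeta>) \<le> fact k * \<eta> / r ^ k"
    proof (rule Cauchy_inequality)
      show "\<phi> holomorphic_on ball \<zeta> r" using hol ball_subset_cball holomorphic_on_subset by blast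
      show "continuous_on (cball \<zeta> r) \<phi>" using hol by (rule holomorphic_on_imp_continuous_on)
      show "cmod (\<phi> x) \<le> \<eta>" if "cmod (\<zeta> - x) = r" for x
        using sub that by (intro phi(2)) (auto simp: dist_norm)
    qed (use r in auto)
    then have "cmod ((deriv ^^ k) \<phi> \<zeta> / fact k) \<le> \<eta> / r ^ k"
      by (simp add: norm_divide pos_divide_le_eq mult.commute)
    also have "\<dots> \<le> \<eta> / r ^ l"
      using eta r phi(4) by (intro divide_left_mono power_decreasing) auto
    finally show "cmod ((deriv ^^ k) \<phi> \<zeta> / fact k) \<le> 1 / r ^ l * \<eta>" by simp
  qed (use r in simp)
qed

lemma rat_taylor_close:
  assumes K: "compact K" and U: "open U" "K \<subseteq> U"
  obtains c where "c > 0"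
    "\<And>A B A' B' \<eta> \<zeta> k. \<lbrakk>\<And>z. z \<in> U \<Longrightarrow> poly B z \<noteq> 0 \<and> poly B' z \<noteq> 0 \<and> cmod (poly A z / poly B z - poly A' z / poly B' z) \<le> \<eta>;
       \<zeta> \<in> K; k \<le> l\<rbrakk> \<Longrightarrow> cmod (rat_taylor A B \<zeta> k - rat_taylor A' B' \<zeta> k) \<le> c * \<eta>"
proof -
  obtain c where c: "c > 0"
    "\<And>\<phi> \<eta> \<zeta> k. \<lbrakk>\<phi> holomorphic_on U; \<And>z. z \<in> U \<Longrightarrow> cmod (\<phi> z) \<le> \<eta>; \<zeta> \<in> K; k \<le> l\<rbrakk> \<Longrightarrow>
       cmod ((deriv ^^ k) \<phi> \<zeta> / fact k) \<le> c * \<eta>"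
    using taylor_bound_on_compact[OF K U] by metis
  show thesis
  proof (rule that[OF c(1)])
    fix A B A' B' \<eta> \<zeta> k
    assume close: "\<And>z. z \<in> U \<Longrightarrow> poly B z \<noteq> 0 \<and> poly B' z \<noteq> 0 \<and> cmod (poly A z / poly B z - poly A' z / poly B' z) \<le> \<eta>"
      and z: "\<zeta> \<in> K" "k \<le> l"
    have hol: "(\<lambda>z. poly A z / poly B z) holomorphic_on U" "(\<lambda>z. poly A' z / poly B' z) holomorphic_on U"
      using close by (auto intro!: holomorphic_intros)
    have "(deriv ^^ k) (\<lambda>z. poly A z / poly B z - poly A' z / poly B' z) \<zeta>
       = (deriv ^^ k) (\<lambda>z. poly A z / poly B z) \<zeta> - (deriv ^^ k) (\<lambda>z. poly A' z / poly B' z) \<zeta>"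
      using hol U z by (intro higher_deriv_diff[OF _ _ U(1)]) auto
    moreover have "cmod ((deriv ^^ k) (\<lambda>z. poly A z / poly B z - poly A' z / poly B' z) \<zeta> / fact k) \<le> c * \<eta>"
      using close z by (intro c(2) holomorphic_intros hol) auto
    ultimately show "cmod (rat_taylor A B \<zeta> k - rat_taylor A' B' \<zeta> k) \<le> c * \<eta>"
      by (simp add: rat_taylor_def diff_divide_distrib)
  qed
qed

text \<open>Two approximations in succession: first the poles of A1 / B1 are pushed out of
  \<open>K'\<close>, then the result is joined with \<open>h\<close> on \<open>L\<close>. Each is
  uniform on an open neighbourhood of \<open>K\<close>, so Cauchy's inequality gives closeness of
  all coefficients up to order \<open>l\<close>.\<close>

lemma rational_step:
  assumes K: "compact K" and K': "compact K'" and sub: "K \<subseteq> K'" and L: "compact L" and dis: "K' \<inter> L = {}"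
    and push: "\<And>a. a \<notin> K \<Longrightarrow> \<exists>b. b \<notin> K' \<and> closed_segment a b \<inter> K = {}"
    and B1: "B1 \<noteq> 0" "\<And>z. z \<in> K \<Longrightarrow> poly B1 z \<noteq> 0" and e: "\<epsilon> > 0"
  obtains A B where "coprime A B" "B \<noteq> 0" "\<And>z. z \<in> K' \<Longrightarrow> poly B z \<noteq> 0"
    "\<And>\<zeta> k. \<zeta> \<in> K \<Longrightarrow> k \<le> l \<Longrightarrow> cmod (rat_taylor A B \<zeta> k - rat_taylor A1 B1 \<zeta> k) \<le> \<epsilon>"
    "\<And>z. z \<in> L \<Longrightarrow> chordal (sphere_ratio (poly A z) (poly B z)) (rat_eval h z) \<le> \<epsilon>"
proof -
  obtain U where U: "open U" "K \<subseteq> U" "rat_approximable U K' (\<lambda>z. poly A1 z / poly B1 z)" "\<And>z. z \<in> U \<Longrightarrow> poly B1 z \<noteq> 0"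
    using push_poles[OF K B1 push, of A1] by metis
  obtain c where c: "c > 0"
    "\<And>A B A' B' \<eta> \<zeta> k. \<lbrakk>\<And>z. z \<in> U \<Longrightarrow> poly B z \<noteq> 0 \<and> poly B' z \<noteq> 0 \<and> cmod (poly A z / poly B z - poly A' z / poly B' z) \<le> \<eta>;
       \<zeta> \<in> K; k \<le> l\<rbrakk> \<Longrightarrow> cmod (rat_taylor A B \<zeta> k - rat_taylor A' B' \<zeta> k) \<le> c * \<eta>"
    using rat_taylor_close[OF K U(1,2)] by metis
  have "\<epsilon> / (2 * c) > 0" using e c(1) by simp
  then obtain A2 B2 where AB2: "B2 \<noteq> 0" "\<forall>z\<in>K'. poly B2 z \<noteq> 0"
     "\<forall>z\<in>U. poly B2 z \<noteq> 0 \<and> cmod (poly A1 z / poly B1 z - poly A2 z / poly B2 z) \<le> \<epsilon> / (2 * c)"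
    using U(3) unfolding rat_approximable_def by meson
  have t1: "cmod (rat_taylor A1 B1 \<zeta> k - rat_taylor A2 B2 \<zeta> k) \<le> \<epsilon> / 2" if "\<zeta> \<in> K" "k \<le> l" for \<zeta> k
    using c(2)[of B1 B2 A1 A2 "\<epsilon> / (2 * c)" \<zeta> k] U(4) AB2(3) that c(1) by auto
  \<comment> \<open>A compact neighbourhood of \<open>K'\<close> that avoids \<open>L\<close> and
    the poles of A2 / B2 is needed: approximating on it, rather than on \<open>K'\<close> alone,
    controls derivatives on \<open>K\<close>.\<close>
  let ?O = "- L \<inter> - {z. poly B2 z = 0}"
  have "open ?O"
    using L AB2(1) by (intro open_Int open_Compl compact_imp_closed finite_imp_closed poly_roots_finite)
  moreover have "K' \<subseteq> ?O" using dis AB2(2) by auto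
  ultimately obtain C where C: "\<And>n::nat. compact (C n)" "\<And>n. C n \<subseteq> ?O" "\<And>n. C n \<subseteq> interior (C (Suc n))"
     "\<exists>N. \<forall>n\<ge>N. K' \<subseteq> C n"
    using open_Union_compact_subsets[of ?O] K' by metis
  then obtain n where n: "K' \<subseteq> C n" by auto
  define U' where "U' = interior (C (Suc n))"
  have oU': "open U'" by (simp add: U'_def)
  have U': "K' \<subseteq> U'" "K \<subseteq> U'" "U' \<subseteq> C (Suc n)"
    using n C(3)[of n] sub interior_subset[of "C (Suc n)"] unfolding U'_def by blast+
  obtain c' where c': "c' > 0"
    "\<And>A B A' B' \<eta> \<zeta> k. \<lbrakk>\<And>z. z \<in> U' \<Longrightarrow> poly B z \<noteq> 0 \<and> poly B' z \<noteq> 0 \<and> cmod (poly A z / poly B z - poly A' z / poly B' z) \<le> \<eta>;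
       \<zeta> \<in> K; k \<le> l\<rbrakk> \<Longrightarrow> cmod (rat_taylor A B \<zeta> k - rat_taylor A' B' \<zeta> k) \<le> c' * \<eta>"
    using rat_taylor_close[OF K oU' U'(2)] by metis
  define \<epsilon>' where "\<epsilon>' = min \<epsilon> (\<epsilon> / (2 * c'))"
  have e': "\<epsilon>' > 0" "\<epsilon>' \<le> \<epsilon>" "c' * \<epsilon>' \<le> \<epsilon> / 2"
  proof -
    have "c' * \<epsilon>' \<le> c' * (\<epsilon> / (2 * c'))" using c'(1) by (intro mult_left_mono) (auto simp: \<epsilon>'_def)
    then show "c' * \<epsilon>' \<le> \<epsilon> / 2" using c'(1) by simp
  qed (use e c'(1) in \<open>auto simp: \<epsilon>'_def\<close>)
  obtain A B where AB: "coprime A B" "B \<noteq> 0"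
    "\<And>z. z \<in> C (Suc n) \<Longrightarrow> poly B z \<noteq> 0 \<and> cmod (poly A z / poly B z - poly A2 z / poly B2 z) \<le> \<epsilon>'"
    "\<And>z. z \<in> L \<Longrightarrow> chordal (sphere_ratio (poly A z) (poly B z)) (rat_eval h z) \<le> \<epsilon>'"
    by (rule simultaneous_rational_approx[OF C(1)[of "Suc n"] L _ AB2(1) _ e'(1), of A2 h])
       (use C(2)[of "Suc n"] in auto)
  show thesis
  proof (rule that[OF AB(1,2)])
    show "poly B z \<noteq> 0" if "z \<in> K'" for z using AB(3)[of z] U'(1,3) that by auto
    show "chordal (sphere_ratio (poly A z) (poly B z)) (rat_eval h z) \<le> \<epsilon>" if "z \<in> L" for z
      using AB(4)[OF that] e'(2) by linarith
    fix \<zeta> k assume z: "\<zeta> \<in> K" "k \<le> l"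
    have "cmod (rat_taylor A B \<zeta> k - rat_taylor A2 B2 \<zeta> k) \<le> c' * \<epsilon>'"
      using AB(3) U'(3) C(2)[of "Suc n"] z by (intro c'(2)) auto
    then show "cmod (rat_taylor A B \<zeta> k - rat_taylor A1 B1 \<zeta> k) \<le> \<epsilon>"
      using t1[OF z] e'(3) norm_triangle_ineq[of "rat_taylor A B \<zeta> k - rat_taylor A2 B2 \<zeta> k" "rat_taylor A2 B2 \<zeta> k - rat_taylor A1 B1 \<zeta> k"]
      by (simp add: norm_minus_commute)
  qed
qed

section \<open>Algebra of Pade approximants\<close>

definition shift_poly :: "complex \<Rightarrow> complex poly \<Rightarrow> complex poly" where
  "shift_poly \<zeta> p = pcompose p [:\<zeta>, 1:]"

text \<open>The Taylor series of \<open>p\<close> at \<open>\<zeta>\<close>. As a formal series it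
  can be multiplied with an arbitrary coefficient sequence, convergent or not.\<close>

definition local_fps :: "complex \<Rightarrow> complex poly \<Rightarrow> complex fps" where
  "local_fps \<zeta> p = fps_of_poly (shift_poly \<zeta> p)"

lemma degree_shift_poly [simp]: "degree (shift_poly \<zeta> p) = degree p"
  by (simp add: shift_poly_def degree_pcompose)

lemma shift_poly_mult: "shift_poly \<zeta> (p * q) = shift_poly \<zeta> p * shift_poly \<zeta> q"
  by (simp add: shift_poly_def pcompose_mult)

lemma shift_poly_inverse [simp]: "shift_poly (- \<zeta>) (shift_poly \<zeta> p) = p" "shift_poly \<zeta> (shift_poly (- \<zeta>) p) = p"
  by (simp_all add: shift_poly_def pcompose_assoc[symmetric] pcompose_pCons)

lemma shift_poly_eq_0_iff [simp]: "shift_poly \<zeta> p = 0 \<longleftrightarrow> p = 0"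
  by (metis pcompose_0 shift_poly_def shift_poly_inverse(1))

lemma local_fps_mult: "local_fps \<zeta> (p * q) = local_fps \<zeta> p * local_fps \<zeta> q"
  by (simp add: local_fps_def shift_poly_mult fps_of_poly_mult)

lemma local_fps_diff: "local_fps \<zeta> (p - q) = local_fps \<zeta> p - local_fps \<zeta> q"
  by (simp add: local_fps_def shift_poly_def pcompose_diff fps_of_poly_diff)

lemma local_fps_sum: "local_fps \<zeta> (\<Sum>i\<in>I. f i) = (\<Sum>i\<in>I. local_fps \<zeta> (f i))"
  by (simp add: local_fps_def shift_poly_def pcompose_sum fps_of_poly_sum)

lemma local_fps_smult: "local_fps \<zeta> (Polynomial.smult c p) = fps_const c * local_fps \<zeta> p"
  by (simp add: local_fps_def shift_poly_def pcompose_smult fps_of_poly_smult)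

lemma local_fps_power: "local_fps \<zeta> (p ^ n) = local_fps \<zeta> p ^ n"
proof (induction n)
  case 0
  show ?case by (simp add: local_fps_def shift_poly_def pcompose_1)
qed (simp add: local_fps_mult)

lemma local_fps_linear: "local_fps \<zeta> [:- \<zeta>, 1:] = fps_X"
  by (simp add: local_fps_def shift_poly_def pcompose_pCons)

lemma local_fps_nth: "fps_nth (local_fps \<zeta> p) n = coeff (shift_poly \<zeta> p) n"
  by (simp add: local_fps_def)

lemma local_fps_nth_0: "fps_nth (local_fps \<zeta> p) 0 = poly p \<zeta>"
  by (simp add: local_fps_nth shift_poly_def pcompose_coeff_0)

lemma degree_le_of_local_fps:
  assumes "\<And>n. n > N \<Longrightarrow> fps_nth (local_fps \<zeta> p) n = 0"
  shows "degree p \<le> N"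
  using degree_le[of N "shift_poly \<zeta> p"] assms by (simp add: local_fps_nth)

lemma poly_eq_0_of_local_fps:
  assumes "degree p \<le> N" "\<And>n. n \<le> N \<Longrightarrow> fps_nth (local_fps \<zeta> p) n = 0"
  shows "p = 0"
proof -
  have "shift_poly \<zeta> p = 0"
    by (rule poly_eqI) (use assms in \<open>metis coeff_0 coeff_eq_0 degree_shift_poly local_fps_nth not_le order.strict_trans1\<close>)
  then show ?thesis by simp
qed

lemma local_fps_expansion: "(\<lambda>w. poly p (\<zeta> + w)) has_fps_expansion local_fps \<zeta> p"
proof (induction p)
  case (pCons c p)
  have "(\<lambda>w. c + (\<zeta> + w) * poly p (\<zeta> + w)) has_fps_expansion fps_const c + (fps_const \<zeta> + fps_X) * local_fps \<zeta> p"
    by (intro fps_expansion_intros pCons.IH)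
  moreover have "local_fps \<zeta> (pCons c p) = fps_const c + (fps_const \<zeta> + fps_X) * local_fps \<zeta> p"
    by (simp add: local_fps_def shift_poly_def pcompose_pCons fps_of_poly_add fps_of_poly_mult fps_of_poly_const fps_of_poly_pCons)
  ultimately show ?case by simp
qed (simp add: local_fps_def shift_poly_def)

definition quotient_fps :: "complex \<Rightarrow> complex poly \<Rightarrow> complex poly \<Rightarrow> complex fps" where
  "quotient_fps \<zeta> A B = Abs_fps (\<lambda>n. (deriv ^^ n) (\<lambda>z. poly A z / poly B z) \<zeta> / fact n)"

lemma quotient_fps_mult:
  assumes "poly B \<zeta> \<noteq> 0"
  shows "quotient_fps \<zeta> A B * local_fps \<zeta> B = local_fps \<zeta> A"
proof -
  have an: "poly P analytic_on {\<zeta>}" for P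
    by (rule analytic_on_subset[of _ UNIV]) (auto simp: analytic_on_open intro!: holomorphic_intros)
  have "quotient_fps \<zeta> A B = fps_expansion (\<lambda>z. poly A z / poly B z) \<zeta>"
    by (simp add: quotient_fps_def fps_expansion_def)
  moreover have "(\<lambda>z. poly A z / poly B z) analytic_on {\<zeta>}"
    using assms an by (intro analytic_intros) auto
  ultimately have 1: "(\<lambda>w. poly A (\<zeta> + w) / poly B (\<zeta> + w)) has_fps_expansion quotient_fps \<zeta> A B"
    using analytic_at_imp_has_fps_expansion[of "\<lambda>z. poly A z / poly B z" \<zeta>] by simp
  have "(\<lambda>w. poly A (\<zeta> + w) / poly B (\<zeta> + w) * poly B (\<zeta> + w)) has_fps_expansion quotient_fps \<zeta> A B * local_fps \<zeta> B"
    by (intro has_fps_expansion_mult 1 local_fps_expansion)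
  moreover have "\<forall>\<^sub>F w in nhds 0. poly B (\<zeta> + w) \<noteq> 0"
  proof (rule tendsto_imp_eventually_ne)
    have "isCont (\<lambda>w. poly B (\<zeta> + w)) 0" by (intro continuous_intros)
    then show "((\<lambda>w. poly B (\<zeta> + w)) \<longlongrightarrow> poly B \<zeta>) (nhds 0)"
      unfolding isCont_def using tendsto_at_iff_tendsto_nhds[of "\<lambda>w. poly B (\<zeta> + w)" 0] by simp
  qed (rule assms)
  then have "\<forall>\<^sub>F w in nhds 0. poly A (\<zeta> + w) / poly B (\<zeta> + w) * poly B (\<zeta> + w) = poly A (\<zeta> + w)"
    by eventually_elim simp
  ultimately have "(\<lambda>w. poly A (\<zeta> + w)) has_fps_expansion quotient_fps \<zeta> A B * local_fps \<zeta> B"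
    by (simp add: has_fps_expansion_cong)
  then show ?thesis using local_fps_expansion fps_expansion_unique_complex by blast
qed

section \<open>The Pade condition for formal power series\<close>

definition coeff_fps :: "(int \<Rightarrow> complex) \<Rightarrow> complex fps" where
  "coeff_fps a = Abs_fps (\<lambda>n. a (int n))"

lemma fps_mult_agree:
  fixes F G H :: "'a::comm_ring_1 fps"
  assumes "\<And>n. n \<le> N \<Longrightarrow> fps_nth F n = fps_nth G n" "n \<le> N"
  shows "fps_nth (F * H) n = fps_nth (G * H) n"
  unfolding fps_mult_nth using assms by (intro sum.cong) auto

text \<open>As B(\<zeta>) is non-zero, the series of \<open>B\<close> is invertible, and
  multiplication by it preserves agreement up to any given order. The Pade condition thereby becomes
  linear in \<open>A\<close> and \<open>B\<close>.\<close>

lemma is_pade_iff: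
  "is_pade a p q \<zeta> R \<longleftrightarrow>
    (\<exists>A B. R = Fract A B \<and> degree A \<le> p \<and> degree B \<le> q \<and> poly B \<zeta> \<noteq> 0 \<and>
       (\<forall>n\<le>p + q. fps_nth (coeff_fps a * local_fps \<zeta> B) n = fps_nth (local_fps \<zeta> A) n))"
proof -
  have "(\<forall>n\<le>p + q. (deriv ^^ n) (\<lambda>z. poly A z / poly B z) \<zeta> / fact n = a (int n)) \<longleftrightarrow>
     (\<forall>n\<le>p + q. fps_nth (coeff_fps a * local_fps \<zeta> B) n = fps_nth (local_fps \<zeta> A) n)"
    (is "?l \<longleftrightarrow> ?r") if B: "poly B \<zeta> \<noteq> 0" for A B
  proof
    let ?Q = "quotient_fps \<zeta> A B"
    have Q: "?Q * local_fps \<zeta> B = local_fps \<zeta> A" by (rule quotient_fps_mult[OF B])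
    show ?r if ?l
    proof (intro allI impI)
      fix n assume n: "n \<le> p + q"
      have "fps_nth (coeff_fps a * local_fps \<zeta> B) n = fps_nth (?Q * local_fps \<zeta> B) n"
        using that by (intro fps_mult_agree[OF _ n]) (auto simp: coeff_fps_def quotient_fps_def)
      then show "fps_nth (coeff_fps a * local_fps \<zeta> B) n = fps_nth (local_fps \<zeta> A) n" using Q by simp
    qed
    show ?l if ?r
    proof (intro allI impI)
      fix n assume n: "n \<le> p + q"
      have inv: "local_fps \<zeta> B * inverse (local_fps \<zeta> B) = 1"
        using B by (simp add: inverse_mult_eq_1' local_fps_nth_0)
      have "fps_nth (coeff_fps a * local_fps \<zeta> B * inverse (local_fps \<zeta> B)) n
          = fps_nth (?Q * local_fps \<zeta> B * inverse (local_fps \<zeta> B)) n"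
        using that Q by (intro fps_mult_agree[OF _ n]) auto
      then have "fps_nth (coeff_fps a) n = fps_nth ?Q n" by (simp add: mult.assoc inv)
      then show "(deriv ^^ n) (\<lambda>z. poly A z / poly B z) \<zeta> / fact n = a (int n)"
        by (simp add: coeff_fps_def quotient_fps_def)
    qed
  qed
  then show ?thesis unfolding is_pade_def by blast
qed

text \<open>A B' - A' B has degree at most p + q, yet all its Taylor coefficients at
  \<open>\<zeta>\<close> up to order p + q vanish.\<close>

lemma pade_cross_mult:
  assumes "degree A \<le> p" "degree B \<le> q" "degree A' \<le> p" "degree B' \<le> q"
    and "\<And>n. n \<le> p + q \<Longrightarrow> fps_nth (F * local_fps \<zeta> B) n = fps_nth (local_fps \<zeta> A) n"
    and "\<And>n. n \<le> p + q \<Longrightarrow> fps_nth (F * local_fps \<zeta> B') n = fps_nth (local_fps \<zeta> A') n"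
  shows "A * B' = A' * B"
proof -
  have "A * B' - A' * B = 0"
  proof (rule poly_eq_0_of_local_fps)
    show "degree (A * B' - A' * B) \<le> p + q"
      by (intro degree_diff_le order.trans[OF degree_mult_le]) (use assms(1-4) in linarith)+
    fix n assume n: "n \<le> p + q"
    have "fps_nth (local_fps \<zeta> A * local_fps \<zeta> B') n = fps_nth (F * local_fps \<zeta> B * local_fps \<zeta> B') n"
      using assms(5) by (intro fps_mult_agree[OF _ n]) auto
    moreover have "fps_nth (local_fps \<zeta> A' * local_fps \<zeta> B) n = fps_nth (F * local_fps \<zeta> B' * local_fps \<zeta> B) n"
      using assms(6) by (intro fps_mult_agree[OF _ n]) auto
    ultimately show "fps_nth (local_fps \<zeta> (A * B' - A' * B)) n = 0"
      by (simp add: local_fps_diff local_fps_mult mult_ac)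
  qed
  then show ?thesis by simp
qed

lemma is_pade_unique:
  assumes "is_pade a p q \<zeta> R" "is_pade a p q \<zeta> R'"
  shows "R = R'"
proof -
  obtain A B A' B' where 1: "R = Fract A B" "degree A \<le> p" "degree B \<le> q" "poly B \<zeta> \<noteq> 0"
       "\<And>n. n \<le> p + q \<Longrightarrow> fps_nth (coeff_fps a * local_fps \<zeta> B) n = fps_nth (local_fps \<zeta> A) n"
    and 2: "R' = Fract A' B'" "degree A' \<le> p" "degree B' \<le> q" "poly B' \<zeta> \<noteq> 0"
       "\<And>n. n \<le> p + q \<Longrightarrow> fps_nth (coeff_fps a * local_fps \<zeta> B') n = fps_nth (local_fps \<zeta> A') n"
    using assms unfolding is_pade_iff by blast
  have "A * B' = A' * B" by (rule pade_cross_mult[OF 1(2,3) 2(2,3) 1(5) 2(5)])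
  moreover have "B \<noteq> 0" "B' \<noteq> 0" using 1(4) 2(4) by auto
  ultimately show ?thesis unfolding 1(1) 2(1) by (simp add: eq_fract)
qed

section \<open>Cofactor expansion of the Jacobi determinants\<close>

lemma det_first_row_expand:
  fixes b :: "nat \<Rightarrow> nat \<Rightarrow> 'a::comm_ring_1"
  shows "Determinant.det (Matrix.mat (Suc q) (Suc q) (\<lambda>(i, j). if i = 0 then r j else b i j)) =
    (\<Sum>j\<le>q. r j * ((-1) ^ j * Determinant.det (Matrix.mat q q (\<lambda>(i, j'). b (Suc i) (if j' < j then j' else Suc j')))))"
proof -
  let ?M = "Matrix.mat (Suc q) (Suc q) (\<lambda>(i, j). if i = 0 then r j else b i j)"
  have "Determinant.det ?M = (\<Sum>j<Suc q. ?M $$ (0, j) * cofactor ?M 0 j)"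
    by (rule laplace_expansion_row) auto
  also have "\<dots> = (\<Sum>j\<le>q. r j * ((-1) ^ j * Determinant.det (Matrix.mat q q (\<lambda>(i, j'). b (Suc i) (if j' < j then j' else Suc j')))))"
    unfolding lessThan_Suc_atMost
  proof (rule sum.cong)
    fix j assume "j \<in> {..q}"
    moreover have "mat_delete ?M 0 j = Matrix.mat q q (\<lambda>(i, j'). b (Suc i) (if j' < j then j' else Suc j'))"
      unfolding mat_delete_def by (rule eq_matI) auto
    ultimately show "?M $$ (0, j) * cofactor ?M 0 j =
      r j * ((-1) ^ j * Determinant.det (Matrix.mat q q (\<lambda>(i, j'). b (Suc i) (if j' < j then j' else Suc j'))))"
      by (simp add: cofactor_def)
  qed simp
  finally show ?thesis .
qed

lemma det_mat_const_poly:
  "Determinant.det (Matrix.mat n n (\<lambda>(i, j). [:c i j:])) = [:Determinant.det (Matrix.mat n n (\<lambda>(i, j). c i j)) :: complex:]"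
proof -
  interpret comm_ring_hom "\<lambda>c::complex. [:c:]" by unfold_locales (auto simp: one_pCons)
  have "Matrix.mat n n (\<lambda>(i, j). [:c i j:]) = map_mat (\<lambda>c. [:c:]) (Matrix.mat n n (\<lambda>(i, j). c i j))"
    by (rule eq_matI) auto
  then show ?thesis by (simp only: hom_det)
qed

text \<open>The two Jacobi determinants differ only in the first row and so share these first-row
  cofactors; the conditional index omits column \<open>j\<close>.\<close>

definition jacobi_cofactor :: "(int \<Rightarrow> complex) \<Rightarrow> nat \<Rightarrow> nat \<Rightarrow> nat \<Rightarrow> complex" where
  "jacobi_cofactor a p q j = (-1) ^ j * Determinant.det (Matrix.mat q q
     (\<lambda>(i, j'). a (int p - int q + int (Suc i) + int (if j' < j then j' else Suc j'))))"

lemma jacobi_expand: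
  "jacobi_num a p q \<zeta> = (\<Sum>j\<le>q. Polynomial.smult (jacobi_cofactor a p q j)
      ([:- \<zeta>, 1:] ^ (q - j) * partial_sum a \<zeta> (int p - int q + int j)))"
  "jacobi_den a p q \<zeta> = (\<Sum>j\<le>q. Polynomial.smult (jacobi_cofactor a p q j) ([:- \<zeta>, 1:] ^ (q - j)))"
proof -
  have c: "r * ((-1) ^ j * [:d:]) = Polynomial.smult ((-1) ^ j * d) r" for r :: "complex poly" and j d
    by (cases "even j") (auto simp: mult.commute[of r])
  show "jacobi_num a p q \<zeta> = (\<Sum>j\<le>q. Polynomial.smult (jacobi_cofactor a p q j)
      ([:- \<zeta>, 1:] ^ (q - j) * partial_sum a \<zeta> (int p - int q + int j)))"
    unfolding jacobi_num_def Suc_eq_plus1[symmetric] det_first_row_expand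
    by (intro sum.cong) (simp_all only: det_mat_const_poly c jacobi_cofactor_def refl)
  show "jacobi_den a p q \<zeta> = (\<Sum>j\<le>q. Polynomial.smult (jacobi_cofactor a p q j) ([:- \<zeta>, 1:] ^ (q - j)))"
    unfolding jacobi_den_def Suc_eq_plus1[symmetric] det_first_row_expand
    by (intro sum.cong) (simp_all only: det_mat_const_poly c jacobi_cofactor_def refl)
qed

text \<open>The sum expands the determinant in which the first row has been replaced by a copy of
  row \<open>i\<close>; two equal rows make it vanish.\<close>

lemma jacobi_cofactor_orthogonal:
  assumes "1 \<le> i" "i \<le> q"
  shows "(\<Sum>j\<le>q. jacobi_cofactor a p q j * a (int p - int q + int i + int j)) = 0"
proof -
  let ?b = "\<lambda>i j. a (int p - int q + int i + int j)"
  let ?M = "Matrix.mat (Suc q) (Suc q) (\<lambda>(i', j). if i' = 0 then ?b i j else ?b i' j)"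
  have "Determinant.det ?M = 0"
  proof (rule det_identical_rows)
    show "Matrix.row ?M 0 = Matrix.row ?M i" using assms by (intro eq_vecI) auto
  qed (use assms in auto)
  then show ?thesis
    unfolding det_first_row_expand by (simp add: jacobi_cofactor_def mult.commute)
qed

lemma partial_sum_fps_nth:
  "fps_nth (local_fps \<zeta> (partial_sum a \<zeta> k)) n = (if int n \<le> k then a (int n) else 0)"
proof (cases "k < 0")
  case True
  then show ?thesis by (simp add: partial_sum_def local_fps_nth shift_poly_def)
next
  case False
  have "local_fps \<zeta> (partial_sum a \<zeta> k) = (\<Sum>\<nu>\<le>nat k. fps_const (a (int \<nu>)) * fps_X ^ \<nu>)"
    using False by (simp add: partial_sum_def local_fps_sum local_fps_smult local_fps_power local_fps_linear)
  then have "fps_nth (local_fps \<zeta> (partial_sum a \<zeta> k)) n = (\<Sum>\<nu>\<le>nat k. if n = \<nu> then a (int \<nu>) else 0)"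
    by (simp add: fps_sum_nth if_distrib cong: if_cong)
  also have "\<dots> = (if n \<le> nat k then a (int n) else 0)" by simp
  finally show ?thesis using False by (auto simp: le_nat_iff)
qed

section \<open>The Jacobi formulas for a fixed coefficient sequence\<close>

context
  fixes a :: "int \<Rightarrow> complex" and p q :: nat and \<zeta> :: complex
  assumes a_neg: "\<And>k. k < 0 \<Longrightarrow> a k = 0"
begin

text \<open>The partial sum in column \<open>j\<close> stops at p - q + j, and the factor (z -
  \<zeta>)^(q - j) moves this cut-off to \<open>p\<close> in every column. The convention for
  negative indices removes the lower cut-off.\<close>

lemma jacobi_num_nth:
  "fps_nth (local_fps \<zeta> (jacobi_num a p q \<zeta>)) n =
    (if n \<le> p then \<Sum>j\<le>q. jacobi_cofactor a p q j * a (int n - int q + int j) else 0)"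
proof -
  have "fps_nth (local_fps \<zeta> (jacobi_num a p q \<zeta>)) n =
    (\<Sum>j\<le>q. jacobi_cofactor a p q j * (if n < q - j then 0 else
       if int (n - (q - j)) \<le> int p - int q + int j then a (int (n - (q - j))) else 0))"
    by (simp add: jacobi_expand local_fps_sum local_fps_smult local_fps_mult local_fps_power local_fps_linear
        fps_sum_nth fps_X_power_mult_nth partial_sum_fps_nth cong: if_cong)
  also have "\<dots> = (\<Sum>j\<le>q. jacobi_cofactor a p q j * (if n \<le> p then a (int n - int q + int j) else 0))"
  proof (intro sum.cong refl)
    fix j assume j: "j \<in> {..q}"
    show "jacobi_cofactor a p q j * (if n < q - j then 0 else
       if int (n - (q - j)) \<le> int p - int q + int j then a (int (n - (q - j))) else 0) =
      jacobi_cofactor a p q j * (if n \<le> p then a (int n - int q + int j) else 0)"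
    proof (cases "n < q - j")
      case True
      then have "a (int n - int q + int j) = 0" by (intro a_neg) linarith
      then show ?thesis using True by simp
    next
      case False
      then have e: "int (n - (q - j)) = int n - int q + int j" using j by auto
      then have c: "int (n - (q - j)) \<le> int p - int q + int j \<longleftrightarrow> n \<le> p" by linarith
      show ?thesis unfolding c unfolding e by (simp only: False if_False)
    qed
  qed
  finally show ?thesis by simp
qed

lemma coeff_fps_jacobi_den_nth:
  "fps_nth (coeff_fps a * local_fps \<zeta> (jacobi_den a p q \<zeta>)) n =
    (\<Sum>j\<le>q. jacobi_cofactor a p q j * a (int n - int q + int j))"
proof -
  have "coeff_fps a * local_fps \<zeta> (jacobi_den a p q \<zeta>)
      = (\<Sum>j\<le>q. fps_const (jacobi_cofactor a p q j) * (fps_X ^ (q - j) * coeff_fps a))"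
    by (simp add: jacobi_expand local_fps_sum local_fps_smult local_fps_power local_fps_linear
        sum_distrib_left mult_ac)
  then have "fps_nth (coeff_fps a * local_fps \<zeta> (jacobi_den a p q \<zeta>)) n
      = (\<Sum>j\<le>q. jacobi_cofactor a p q j * (if n < q - j then 0 else a (int (n - (q - j)))))"
    by (simp add: fps_sum_nth fps_X_power_mult_nth coeff_fps_def cong: if_cong)
  also have "\<dots> = (\<Sum>j\<le>q. jacobi_cofactor a p q j * a (int n - int q + int j))"
  proof (intro sum.cong refl)
    fix j assume j: "j \<in> {..q}"
    show "jacobi_cofactor a p q j * (if n < q - j then 0 else a (int (n - (q - j)))) =
      jacobi_cofactor a p q j * a (int n - int q + int j)"
    proof (cases "n < q - j")
      case True
      then have "a (int n - int q + int j) = 0" by (intro a_neg) linarith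
      then show ?thesis using True by simp
    next
      case False
      then have e: "int (n - (q - j)) = int n - int q + int j" using j by auto
      show ?thesis unfolding e by (simp only: False if_False)
    qed
  qed
  finally show ?thesis .
qed

text \<open>Up to order \<open>p\<close> both coefficients are given by the same sum. From p + 1 to
  p + q the numerator has none, and the sum vanishes by orthogonality to rows 1 to q.\<close>

lemma jacobi_agree:
  assumes "n \<le> p + q"
  shows "fps_nth (coeff_fps a * local_fps \<zeta> (jacobi_den a p q \<zeta>)) n = fps_nth (local_fps \<zeta> (jacobi_num a p q \<zeta>)) n"
proof (cases "n \<le> p")
  case False
  then have "int n - int q + int j = int p - int q + int (n - p) + int j" for j by simp
  moreover have "(\<Sum>j\<le>q. jacobi_cofactor a p q j * a (int p - int q + int (n - p) + int j)) = 0"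
    using False assms by (intro jacobi_cofactor_orthogonal) auto
  ultimately show ?thesis using False by (simp add: coeff_fps_jacobi_den_nth jacobi_num_nth)
qed (simp add: coeff_fps_jacobi_den_nth jacobi_num_nth)

lemma degree_jacobi_num: "degree (jacobi_num a p q \<zeta>) \<le> p"
  by (rule degree_le_of_local_fps[where \<zeta> = \<zeta>]) (simp add: jacobi_num_nth)

lemma degree_jacobi_den: "degree (jacobi_den a p q \<zeta>) \<le> q"
proof (rule degree_le_of_local_fps[where \<zeta> = \<zeta>])
  fix n assume n: "n > q"
  have "fps_nth (local_fps \<zeta> (jacobi_den a p q \<zeta>)) n = (\<Sum>j\<le>q. jacobi_cofactor a p q j * (if n = q - j then 1 else 0))"
    by (simp add: jacobi_expand local_fps_sum local_fps_smult local_fps_power local_fps_linear fps_sum_nth)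
  also have "\<dots> = 0" using n by (intro sum.neutral) auto
  finally show "fps_nth (local_fps \<zeta> (jacobi_den a p q \<zeta>)) n = 0" .
qed

text \<open>At the centre only the last column of the first row survives, and its cofactor is the
  Hankel determinant up to sign. For q = 0 this is the empty determinant 1, in accordance with
  \<open>in_D\<close>.\<close>

lemma jacobi_den_center: "in_D a p q \<longleftrightarrow> poly (jacobi_den a p q \<zeta>) \<zeta> \<noteq> 0"
proof -
  have "poly (jacobi_den a p q \<zeta>) \<zeta> = (\<Sum>j\<le>q. jacobi_cofactor a p q j * 0 ^ (q - j))"
    by (simp add: jacobi_expand poly_sum)
  also have "\<dots> = jacobi_cofactor a p q q"
    by (subst sum.remove[of _ q]) (auto intro!: sum.neutral simp: power_0_left)
  also have "\<dots> = (-1) ^ q * Determinant.det (Matrix.mat q q (\<lambda>(i, j). a (int p - int q + int i + int j + 1)))"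
    unfolding jacobi_cofactor_def
    by (intro arg_cong2[of _ _ _ _ "(*)"] arg_cong[of _ _ Determinant.det] refl eq_matI) (auto simp: add_ac)
  finally show ?thesis by (auto simp: in_D_def)
qed

lemma pade_eq_jacobi:
  assumes "in_D a p q"
  shows "pade a p q \<zeta> = Fract (jacobi_num a p q \<zeta>) (jacobi_den a p q \<zeta>)"
proof -
  have "is_pade a p q \<zeta> (Fract (jacobi_num a p q \<zeta>) (jacobi_den a p q \<zeta>))"
    unfolding is_pade_iff
    using degree_jacobi_num degree_jacobi_den jacobi_agree assms[unfolded jacobi_den_center] by blast
  then show ?thesis unfolding pade_def using is_pade_unique by blast
qed

text \<open>A singular Hankel matrix would give an approximant of too small a degree: some non-zero
  \<open>E\<close> of degree below \<open>q\<close> with A E divisible by \<open>B\<close>. By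
  coprimality \<open>B\<close> would divide \<open>E\<close>, impossible as \<open>B\<close> has
  degree exactly \<open>q\<close>.\<close>

lemma in_D_rational:
  assumes cop: "coprime A B" and dA: "degree A \<le> p" and dB: "degree B = q" and B: "poly B \<zeta> \<noteq> 0"
    and eq: "coeff_fps a * local_fps \<zeta> B = local_fps \<zeta> A"
  shows "in_D a p q"
proof (rule ccontr)
  assume "\<not> in_D a p q"
  then have q: "q > 0" and det: "Determinant.det (Matrix.mat q q (\<lambda>(i, j). a (int p - int q + int i + int j + 1))) = 0"
    (is "Determinant.det ?M = 0") by (auto simp: in_D_def)
  obtain v where v: "v \<in> carrier_vec q" "v \<noteq> 0\<^sub>v q" "?M *\<^sub>v v = 0\<^sub>v q"
    using det det_0_iff_vec_prod_zero_field[of ?M q] by auto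
  have sum0: "(\<Sum>j<q. a (int p - int q + int i + int j + 1) * Matrix.vec_index v j) = 0" if "i < q" for i
  proof -
    have "Matrix.vec_index (?M *\<^sub>v v) i = (\<Sum>j<q. a (int p - int q + int i + int j + 1) * Matrix.vec_index v j)"
      using that v(1) by (auto simp: scalar_prod_def atLeast0LessThan intro!: sum.cong)
    then show ?thesis using that unfolding v(3) by simp
  qed
  \<comment> \<open>A kernel vector of the Hankel matrix gives \<open>E\<close> of degree less than \<open>q\<close> with \<open>A E = N B\<close>, contradicting coprimality.\<close>
  define E where "E = (\<Sum>j<q. monom (Matrix.vec_index v j) (q - 1 - j))"
  have coeffE: "coeff E (q - 1 - j) = Matrix.vec_index v j" if "j < q" for j
  proof -
    have "coeff E (q - 1 - j) = (\<Sum>k<q. if q - 1 - k = q - 1 - j then Matrix.vec_index v k else 0)"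
      by (simp add: E_def coeff_sum)
    also have "\<dots> = (\<Sum>k<q. if k = j then Matrix.vec_index v k else 0)"
      using that by (intro sum.cong) auto
    finally show ?thesis using that by simp
  qed
  have dE: "degree E \<le> q - 1"
    unfolding E_def by (intro degree_sum_le order.trans[OF degree_monom_le]) auto
  define P where "P = coeff_fps a * fps_of_poly E"
  have P: "fps_nth P k = (\<Sum>j<q. Matrix.vec_index v j * a (int k - int q + 1 + int j))" for k
  proof -
    have "P = (\<Sum>j<q. fps_const (Matrix.vec_index v j) * (fps_X ^ (q - 1 - j) * coeff_fps a))"
      by (simp add: P_def E_def fps_of_poly_sum fps_of_poly_monom sum_distrib_left mult_ac)
    then have "fps_nth P k = (\<Sum>j<q. Matrix.vec_index v j * (if k < q - 1 - j then 0 else a (int (k - (q - 1 - j)))))"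
      by (simp add: fps_sum_nth fps_X_power_mult_nth coeff_fps_def cong: if_cong)
    also have "\<dots> = (\<Sum>j<q. Matrix.vec_index v j * a (int k - int q + 1 + int j))"
    proof (intro sum.cong refl)
      fix j assume j: "j \<in> {..<q}"
      show "Matrix.vec_index v j * (if k < q - 1 - j then 0 else a (int (k - (q - 1 - j)))) = Matrix.vec_index v j * a (int k - int q + 1 + int j)"
      proof (cases "k < q - 1 - j")
        case True
        then have "a (int k - int q + 1 + int j) = 0" by (intro a_neg) linarith
        then show ?thesis using True by simp
      next
        case False
        then have e: "int (k - (q - 1 - j)) = int k - int q + 1 + int j" using j by auto
        show ?thesis unfolding e by (simp only: False if_False)
      qed
    qed
    finally show ?thesis .
  qed
  \<comment> \<open>The kernel equations say exactly that \<open>P\<close> has no terms of orders p,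
    ..., p + q - 1.\<close>
  have P0: "fps_nth P k = 0" if "p \<le> k" "k < p + q" for k
  proof -
    have "fps_nth P k = (\<Sum>j<q. a (int p - int q + int (k - p) + int j + 1) * Matrix.vec_index v j)"
      unfolding P using that by (intro sum.cong) (auto simp: mult.commute algebra_simps)
    then show ?thesis using sum0[of "k - p"] that by auto
  qed
  define N where "N = (\<Sum>k<p. monom (fps_nth P k) k)"
  have coeffN: "coeff N k = (if k < p then fps_nth P k else 0)" for k
    by (simp add: N_def coeff_sum)
  \<comment> \<open>Below order p + q the gap allows \<open>N\<close> to replace \<open>P\<close>,
    and \<open>P\<close> times the series of \<open>B\<close> is that of A E. From order p + q on,
    both products vanish for degree reasons.\<close>
  have R: "shift_poly \<zeta> A * E - N * shift_poly \<zeta> B = 0"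
  proof (rule poly_eqI)
    fix n
    show "coeff (shift_poly \<zeta> A * E - N * shift_poly \<zeta> B) n = coeff 0 n"
    proof (cases "n < p + q")
      case True
      have "fps_of_poly (shift_poly \<zeta> A * E) = P * local_fps \<zeta> B"
        by (simp add: fps_of_poly_mult P_def local_fps_def[symmetric] eq[symmetric] mult_ac)
      then have "coeff (shift_poly \<zeta> A * E) n = fps_nth (P * local_fps \<zeta> B) n" by (metis fps_of_poly_nth)
      also have "\<dots> = fps_nth (fps_of_poly N * local_fps \<zeta> B) n"
        by (rule fps_mult_agree[of n]) (use True P0 in \<open>auto simp: coeffN\<close>)
      also have "\<dots> = coeff (N * shift_poly \<zeta> B) n"
        by (simp add: local_fps_def flip: fps_of_poly_mult)
      finally show ?thesis by simp
    next
      case False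
      have "degree (shift_poly \<zeta> A * E) < p + q"
        using dA dE q by (intro le_less_trans[OF degree_mult_le]) auto
      moreover have "coeff (N * shift_poly \<zeta> B) n = 0"
      proof (cases "N = 0")
        case nz: False
        have "degree N < p"
        proof (rule ccontr)
          assume "\<not> degree N < p"
          then have "coeff N (degree N) = 0" by (simp add: coeffN)
          then show False using nz by simp
        qed
        then have "degree (N * shift_poly \<zeta> B) < p + q"
          using dB by (intro le_less_trans[OF degree_mult_le]) auto
        then show ?thesis using False by (intro coeff_eq_0) auto
      qed simp
      ultimately show ?thesis using False by (simp add: coeff_eq_0)
    qed
  qed
  \<comment> \<open>\<open>E\<close> and \<open>N\<close> are polynomials in z - \<zeta>; shifting
    back gives a divisibility among polynomials in z.\<close>
  define E' where "E' = shift_poly (- \<zeta>) E"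
  have "shift_poly (- \<zeta>) (shift_poly \<zeta> A * E) = shift_poly (- \<zeta>) (N * shift_poly \<zeta> B)" using R by simp
  then have "A * E' = shift_poly (- \<zeta>) N * B" by (simp add: shift_poly_mult E'_def)
  then have "B dvd A * E'" by simp
  then have "B dvd E'" using cop by (simp add: coprime_commute coprime_dvd_mult_right_iff)
  moreover have "degree E' < degree B" using dE dB q by (simp add: E'_def)
  ultimately have "E' = 0" using dvd_imp_degree_le leD by blast
  then have "E = 0" by (simp add: E'_def)
  then have "Matrix.vec_index v j = 0" if "j < q" for j using coeffE[OF that] by simp
  then have "v = 0\<^sub>v q" using v(1) by (intro eq_vecI) auto
  with v(2) show False by simp
qed

text \<open>Both quotients satisfy the Pade condition, so they cross-multiply. Coprimality makes
  \<open>B\<close> divide the Jacobi denominator, which is non-zero of degree at most q = deg B, so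
  the cofactor is a constant.\<close>

lemma jacobi_rational:
  assumes cop: "coprime A B" and dA: "degree A \<le> p" and dB: "degree B = q" and B: "poly B \<zeta> \<noteq> 0"
    and eq: "coeff_fps a * local_fps \<zeta> B = local_fps \<zeta> A"
  obtains c where "c \<noteq> 0" "jacobi_num a p q \<zeta> = Polynomial.smult c A" "jacobi_den a p q \<zeta> = Polynomial.smult c B"
proof -
  have nz: "poly (jacobi_den a p q \<zeta>) \<zeta> \<noteq> 0"
    using in_D_rational[OF assms] jacobi_den_center by simp
  have e: "A * jacobi_den a p q \<zeta> = jacobi_num a p q \<zeta> * B"
    by (rule pade_cross_mult[OF dA _ degree_jacobi_num degree_jacobi_den, where F = "coeff_fps a" and \<zeta> = \<zeta>])
       (use dB eq jacobi_agree in auto)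
  have "B dvd A * jacobi_den a p q \<zeta>" using e by simp
  then have "B dvd jacobi_den a p q \<zeta>" using cop by (simp add: coprime_commute coprime_dvd_mult_right_iff)
  then obtain r where r: "jacobi_den a p q \<zeta> = B * r" by blast
  have B0: "B \<noteq> 0" and r0: "r \<noteq> 0" using B nz r by auto
  have "degree B + degree r \<le> q" using degree_jacobi_den r B0 r0 by (metis degree_mult_eq)
  then have "degree r = 0" using dB by simp
  then obtain c where c: "r = [:c:]" by (metis degree_eq_zeroE)
  have "jacobi_num a p q \<zeta> = A * r" using e r B0 by (simp add: mult_ac)
  then show thesis using that[of c] r r0 by (simp add: c)
qed

end

section \<open>Stability of Pade approximants\<close>

text \<open>Compactness and continuity are bundled in to make the limit bounded; this is what closes
  uniform convergence under products.\<close>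

definition cont_uniform_limit :: "'a::topological_space set \<Rightarrow> (nat \<Rightarrow> 'a \<Rightarrow> complex) \<Rightarrow> ('a \<Rightarrow> complex) \<Rightarrow> bool" where
  "cont_uniform_limit X f g \<longleftrightarrow> compact X \<and> continuous_on X g \<and> uniform_limit X f g sequentially"

lemma cont_uniform_limit_bounded: "cont_uniform_limit X f g \<Longrightarrow> bounded (g ` X)"
  unfolding cont_uniform_limit_def by (intro compact_imp_bounded compact_continuous_image) auto

lemma cont_uniform_limit_const:
  "compact X \<Longrightarrow> continuous_on X g \<Longrightarrow> cont_uniform_limit X (\<lambda>n. g) g"
  by (auto simp: cont_uniform_limit_def uniform_limit_iff)

lemma cont_uniform_limit_add:
  "cont_uniform_limit X f g \<Longrightarrow> cont_uniform_limit X f' g' \<Longrightarrow>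
    cont_uniform_limit X (\<lambda>n x. f n x + f' n x) (\<lambda>x. g x + g' x)"
  unfolding cont_uniform_limit_def by (auto intro: continuous_on_add uniform_limit_add)

lemma cont_uniform_limit_mult:
  assumes "cont_uniform_limit X f g" "cont_uniform_limit X f' g'"
  shows "cont_uniform_limit X (\<lambda>n x. f n x * f' n x) (\<lambda>x. g x * g' x)"
  using assms uniform_lim_mult[OF _ _ assms[THEN cont_uniform_limit_bounded], of f sequentially f']
  unfolding cont_uniform_limit_def by (auto intro: continuous_on_mult)

lemma cont_uniform_limit_sum:
  assumes "compact X" "\<And>i. i \<in> I \<Longrightarrow> cont_uniform_limit X (\<lambda>n. f n i) (g i)"
  shows "cont_uniform_limit X (\<lambda>n x. \<Sum>i\<in>I. f n i x) (\<lambda>x. \<Sum>i\<in>I. g i x)"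
  using assms(2)
  by (induction I rule: infinite_finite_induct)
     (auto intro: cont_uniform_limit_const[OF assms(1)] cont_uniform_limit_add)

lemma cont_uniform_limit_prod:
  assumes "compact X" "\<And>i. i \<in> I \<Longrightarrow> cont_uniform_limit X (\<lambda>n. f n i) (g i)"
  shows "cont_uniform_limit X (\<lambda>n x. \<Prod>i\<in>I. f n i x) (\<lambda>x. \<Prod>i\<in>I. g i x)"
  using assms(2)
  by (induction I rule: infinite_finite_induct)
     (auto intro: cont_uniform_limit_const[OF assms(1)] cont_uniform_limit_mult)

text \<open>By the Leibniz formula the determinant is a finite sum of products of entries.\<close>

lemma cont_uniform_limit_det:
  assumes X: "compact X" and f: "\<And>i j. i < m \<Longrightarrow> j < m \<Longrightarrow> cont_uniform_limit X (\<lambda>n. f n i j) (g i j)"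
  shows "cont_uniform_limit X (\<lambda>n x. Determinant.det (Matrix.mat m m (\<lambda>(i, j). f n i j x)))
    (\<lambda>x. Determinant.det (Matrix.mat m m (\<lambda>(i, j). g i j x)))"
proof -
  have e: "Determinant.det (Matrix.mat m m (\<lambda>(i, j). h i j)) =
     (\<Sum>\<sigma>\<in>{\<sigma>. \<sigma> permutes {0..<m}}. signof \<sigma> * (\<Prod>i=0..<m. h i (\<sigma> i)))" for h :: "nat \<Rightarrow> nat \<Rightarrow> complex"
    by (subst det_def'[of _ m])
       (auto intro!: sum.cong arg_cong[where f = "(*) _"] prod.cong dest: permutes_in_image)
  have "\<sigma> i < m" if "\<sigma> permutes {0..<m}" "i < m" for \<sigma> i
    using permutes_in_image[OF that(1), of i] that(2) by simp
  then show ?thesis unfolding e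
    by (intro cont_uniform_limit_sum X cont_uniform_limit_mult cont_uniform_limit_prod cont_uniform_limit_const continuous_on_const f) auto
qed

lemma poly_partial_sum:
  "poly (partial_sum a \<zeta> k) z = (if k < 0 then 0 else \<Sum>\<nu>\<le>nat k. a (int \<nu>) * (z - \<zeta>) ^ \<nu>)"
  by (simp add: partial_sum_def poly_sum)

text \<open>The Jacobi values are polynomial expressions in z - \<zeta> and the coefficients of
  index at most p + q. Centre and evaluation point are both functions on the parameter space
  \<open>X\<close>, so convergence is uniform in the two jointly.\<close>

lemma cont_uniform_limit_jacobi:
  assumes X: "compact X" and \<zeta>: "continuous_on X \<zeta>" and z: "continuous_on X z"
    and a: "\<And>k. k \<le> int p + int q \<Longrightarrow> cont_uniform_limit X (\<lambda>n x. a n x k) (\<lambda>x. b x k)"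
  shows "cont_uniform_limit X (\<lambda>n x. poly (jacobi_num (a n x) p q (\<zeta> x)) (z x)) (\<lambda>x. poly (jacobi_num (b x) p q (\<zeta> x)) (z x))"
    and "cont_uniform_limit X (\<lambda>n x. poly (jacobi_den (a n x) p q (\<zeta> x)) (z x)) (\<lambda>x. poly (jacobi_den (b x) p q (\<zeta> x)) (z x))"
proof -
  have cof: "cont_uniform_limit X (\<lambda>n x. jacobi_cofactor (a n x) p q j) (\<lambda>x. jacobi_cofactor (b x) p q j)" for j
    unfolding jacobi_cofactor_def
    by (intro cont_uniform_limit_mult cont_uniform_limit_const X continuous_on_const cont_uniform_limit_det a) auto
  have pow: "cont_uniform_limit X (\<lambda>n x. (z x - \<zeta> x) ^ k) (\<lambda>x. (z x - \<zeta> x) ^ k)" for k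
    by (intro cont_uniform_limit_const X continuous_intros \<zeta> z)
  have ps: "cont_uniform_limit X (\<lambda>n x. poly (partial_sum (a n x) (\<zeta> x) k) (z x)) (\<lambda>x. poly (partial_sum (b x) (\<zeta> x) k) (z x))"
    if "k \<le> int p + int q" for k
  proof (cases "k < 0")
    case True
    then show ?thesis by (simp add: poly_partial_sum cont_uniform_limit_const X)
  next
    case False
    then show ?thesis using that unfolding poly_partial_sum
      by (simp, intro cont_uniform_limit_sum X cont_uniform_limit_mult pow a) auto
  qed
  have e: "poly [:- u, 1:] w = w - u" for u w :: complex by simp
  show "cont_uniform_limit X (\<lambda>n x. poly (jacobi_num (a n x) p q (\<zeta> x)) (z x)) (\<lambda>x. poly (jacobi_num (b x) p q (\<zeta> x)) (z x))"
    unfolding jacobi_expand poly_sum poly_smult poly_mult poly_power e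
    by (intro cont_uniform_limit_sum X cont_uniform_limit_mult cof pow ps) auto
  show "cont_uniform_limit X (\<lambda>n x. poly (jacobi_den (a n x) p q (\<zeta> x)) (z x)) (\<lambda>x. poly (jacobi_den (b x) p q (\<zeta> x)) (z x))"
    unfolding jacobi_expand poly_sum poly_smult poly_mult poly_power e
    by (intro cont_uniform_limit_sum X cont_uniform_limit_mult cof pow)
qed

lemma continuous_on_rat_taylor:
  assumes "\<And>z. z \<in> K \<Longrightarrow> poly B z \<noteq> 0"
  shows "continuous_on K (\<lambda>\<zeta>. rat_taylor A B \<zeta> k)"
proof (cases "B = 0")
  case True
  then have "K = {}" using assms by auto
  then show ?thesis by simp
next
  case False
  let ?U = "- {z. poly B z = 0}"
  have "open ?U" using poly_roots_finite[OF False] by (intro open_Compl finite_imp_closed)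
  then have "(deriv ^^ k) (\<lambda>z. poly A z / poly B z) holomorphic_on ?U"
    by (intro holomorphic_higher_deriv holomorphic_intros) auto
  then have "continuous_on ?U ((deriv ^^ k) (\<lambda>z. poly A z / poly B z))" by (rule holomorphic_on_imp_continuous_on)
  then have "continuous_on K ((deriv ^^ k) (\<lambda>z. poly A z / poly B z))"
    by (rule continuous_on_subset) (use assms in auto)
  then show ?thesis unfolding rat_taylor_def by (intro continuous_intros) auto
qed

text \<open>The sequences \<open>a \<zeta>\<close> at different centres need not come from one
  function, so the condition can be tested on coefficients before the limit function exists.\<close>

definition good_pade :: "complex set \<Rightarrow> complex set \<Rightarrow> complex poly \<Rightarrow> complex poly \<Rightarrow> real \<Rightarrow> nat \<Rightarrow> nat \<Rightarrow> (complex \<Rightarrow> int \<Rightarrow> complex) \<Rightarrow> bool" where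
  "good_pade K L A B \<epsilon> p q a \<longleftrightarrow> (\<forall>\<zeta>\<in>K. in_D (a \<zeta>) p q \<and> in_E (a \<zeta>) p q \<zeta> (K \<union> L) \<and>
     (\<forall>z\<in>K. euclid (rat_eval (pade (a \<zeta>) p q \<zeta>) z) (poly A z / poly B z) \<le> ennreal \<epsilon>) \<and>
     (\<forall>z\<in>L. chordal (rat_eval (pade (a \<zeta>) p q \<zeta>) z) (sphere_ratio (poly A z) (poly B z)) \<le> \<epsilon>))"

text \<open>For the exact coefficients of A / B the Jacobi polynomials are c A and c B with c
  \<noteq> 0. These have no common zero and \<open>B\<close> has none on \<open>K\<close>, so
  compactness gives positive lower bounds, which survive uniformly small perturbations.\<close>

lemma good_pade_eventually:
  assumes K: "compact K" and L: "compact L" and cop: "coprime A B"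
    and B: "\<And>z. z \<in> K \<Longrightarrow> poly B z \<noteq> 0" and e: "\<epsilon> > 0" and p: "degree A \<le> p" and q: "q = degree B"
    and neg: "\<And>n \<zeta> k. \<zeta> \<in> K \<Longrightarrow> k < 0 \<Longrightarrow> a n \<zeta> k = 0"
    and lim: "\<And>k. k \<le> p + q \<Longrightarrow> uniform_limit K (\<lambda>n \<zeta>. a n \<zeta> (int k)) (\<lambda>\<zeta>. rat_taylor A B \<zeta> k) sequentially"
  shows "\<forall>\<^sub>F n in sequentially. good_pade K L A B \<epsilon> p q (a n)"
proof -
  define b where "b = (\<lambda>\<zeta> k. if k < 0 then 0 else rat_taylor A B \<zeta> (nat k))"
  \<comment> \<open>Points are pairs of a centre and an evaluation point. On \<open>X\<close> only
    the pair (N, D) is bounded away from 0; on K \<times> K the denominator alone is.\<close>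
  define X where "X = K \<times> (K \<union> L)"
  have X: "compact X" unfolding X_def using K L by (intro compact_Times compact_Un)
  have XK: "compact (K \<times> K)" using K by (intro compact_Times)
  have fst: "fst ` X \<subseteq> K" "fst ` (K \<times> K) \<subseteq> K" by (auto simp: X_def)
  have ulim: "cont_uniform_limit Y (\<lambda>n x. a n (fst x) k) (\<lambda>x. b (fst x) k)"
    if Y: "compact Y" "fst ` Y \<subseteq> K" and k: "k \<le> int p + int q" for Y :: "(complex \<times> complex) set" and k
  proof (cases "k < 0")
    case True
    then have "uniform_limit Y (\<lambda>n x. a n (fst x) k) (\<lambda>x. b (fst x) k) sequentially"
      using Y(2) neg by (auto simp: uniform_limit_iff b_def image_subset_iff)
    then show ?thesis using Y True by (simp add: cont_uniform_limit_def b_def)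
  next
    case False
    have "uniform_limit K (\<lambda>n \<zeta>. a n \<zeta> k) (\<lambda>\<zeta>. rat_taylor A B \<zeta> (nat k)) sequentially"
      using lim[of "nat k"] False k by auto
    then have "uniform_limit Y (\<lambda>n x. a n (fst x) k) (\<lambda>x. b (fst x) k) sequentially"
      unfolding uniform_limit_iff
    proof (intro allI impI)
      fix r :: real assume "r > 0" and "\<forall>e>0. \<forall>\<^sub>F n in sequentially. \<forall>\<zeta>\<in>K. dist (a n \<zeta> k) (rat_taylor A B \<zeta> (nat k)) < e"
      then have "\<forall>\<^sub>F n in sequentially. \<forall>\<zeta>\<in>K. dist (a n \<zeta> k) (rat_taylor A B \<zeta> (nat k)) < r" by blast
      then show "\<forall>\<^sub>F n in sequentially. \<forall>x\<in>Y. dist (a n (fst x) k) (b (fst x) k) < r"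
        by eventually_elim (use Y(2) False in \<open>auto simp: b_def\<close>)
    qed
    moreover have "continuous_on Y (\<lambda>x. rat_taylor A B (fst x) (nat k))"
      using continuous_on_compose2[OF continuous_on_rat_taylor[OF B] continuous_on_fst[OF continuous_on_id] Y(2)] by simp
    ultimately show ?thesis using Y False by (simp add: cont_uniform_limit_def b_def)
  qed
  define N D where "N = (\<lambda>n x. poly (jacobi_num (a n (fst x)) p q (fst x)) (snd x))"
    and "D = (\<lambda>n x. poly (jacobi_den (a n (fst x)) p q (fst x)) (snd x))"
  define N0 D0 where "N0 = (\<lambda>x. poly (jacobi_num (b (fst x)) p q (fst x)) (snd x))"
    and "D0 = (\<lambda>x. poly (jacobi_den (b (fst x)) p q (fst x)) (snd x))"
  have limX: "cont_uniform_limit X N N0" "cont_uniform_limit X D D0"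
    unfolding N_def D_def N0_def D0_def
    by (rule cont_uniform_limit_jacobi; use X ulim[OF X fst(1)] in \<open>auto intro!: continuous_intros\<close>)+
  have limK: "cont_uniform_limit (K \<times> K) N N0" "cont_uniform_limit (K \<times> K) D D0"
    unfolding N_def D_def N0_def D0_def
    by (rule cont_uniform_limit_jacobi; use XK ulim[OF XK fst(2)] in \<open>auto intro!: continuous_intros\<close>)+
  have rat: "\<exists>c. c \<noteq> 0 \<and> jacobi_num (b \<zeta>) p q \<zeta> = Polynomial.smult c A \<and> jacobi_den (b \<zeta>) p q \<zeta> = Polynomial.smult c B"
    if z: "\<zeta> \<in> K" for \<zeta>
  proof -
    have "coeff_fps (b \<zeta>) = quotient_fps \<zeta> A B"
      by (simp add: coeff_fps_def quotient_fps_def b_def rat_taylor_def)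
    then have "coeff_fps (b \<zeta>) * local_fps \<zeta> B = local_fps \<zeta> A"
      using quotient_fps_mult[OF B[OF z]] by simp
    then show ?thesis
      using jacobi_rational[of "b \<zeta>" A B p q \<zeta>] cop p q B[OF z] by (metis b_def)
  qed
  \<comment> \<open>The constant depends on the centre, but it cancels in quotients and in
    homogeneous coordinates; the lower bounds below use only the continuity of \<open>N0\<close> and
    \<open>D0\<close>.\<close>
  have N0D0: "\<exists>c. c \<noteq> 0 \<and> N0 (\<zeta>, z) = c * poly A z \<and> D0 (\<zeta>, z) = c * poly B z" if "\<zeta> \<in> K" for \<zeta> z
    using rat[OF that] by (auto simp: N0_def D0_def)
  have nzX: "N0 x \<noteq> 0 \<or> D0 x \<noteq> 0" if "x \<in> X" for x
    using N0D0[of "fst x" "snd x"] that coprime_poly_0[OF cop] by (auto simp: X_def)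
  have nzK: "D0 x \<noteq> 0" if "x \<in> K \<times> K" for x
    using N0D0[of "fst x" "snd x"] that B by auto
  obtain \<delta> where \<delta>: "\<delta> > 0" "\<And>x. x \<in> X \<Longrightarrow> \<delta> \<le> sqrt ((cmod (N0 x))\<^sup>2 + (cmod (D0 x))\<^sup>2)"
    by (rule compact_pair_norm_ge[OF X, of N0 D0]) (use limX nzX in \<open>auto simp: cont_uniform_limit_def\<close>)
  \<comment> \<open>Pairing with 0 turns the bound for pairs into a bound for |D0| alone.\<close>
  obtain \<delta>' where \<delta>': "\<delta>' > 0" "\<And>x. x \<in> K \<times> K \<Longrightarrow> \<delta>' \<le> sqrt ((cmod (D0 x))\<^sup>2 + (cmod (0::complex))\<^sup>2)"
    by (rule compact_pair_norm_ge[OF XK, of D0 "\<lambda>_. 0"]) (use limK nzK in \<open>auto simp: cont_uniform_limit_def\<close>)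
  have D0K: "\<delta>' \<le> cmod (D0 x)" if "x \<in> K \<times> K" for x using \<delta>'(2)[OF that] by simp
  \<comment> \<open>The first bound keeps the perturbed pair non-zero, the second makes the chordal
    error at most \<open>\<epsilon>\<close>.\<close>
  define \<tau> where "\<tau> = min (\<delta> / 4) (\<epsilon> * \<delta> / 4)"
  have \<tau>: "\<tau> > 0" "4 * \<tau> \<le> \<delta>" "4 * \<tau> \<le> \<epsilon> * \<delta>" using \<delta> e by (auto simp: \<tau>_def)
  have quot: "uniform_limit (K \<times> K) (\<lambda>n x. N n x / D n x) (\<lambda>x. N0 x / D0 x) sequentially"
    by (rule uniform_lim_divide[where b = \<delta>'])
       (use limK D0K \<delta>'(1) cont_uniform_limit_bounded[OF limK(1)] in \<open>auto simp: cont_uniform_limit_def\<close>)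
  have "\<forall>\<^sub>F n in sequentially. (\<forall>x\<in>X. dist (N n x) (N0 x) < \<tau>) \<and> (\<forall>x\<in>X. dist (D n x) (D0 x) < \<tau>)
     \<and> (\<forall>x\<in>K\<times>K. dist (D n x) (D0 x) < \<delta>') \<and> (\<forall>x\<in>K\<times>K. dist (N n x / D n x) (N0 x / D0 x) < \<epsilon>)"
    using limX limK quot \<tau> \<delta>' e unfolding cont_uniform_limit_def uniform_limit_iff eventually_conj_iff by blast
  then show ?thesis
  proof eventually_elim
    case (elim n)
    have DK: "D n x \<noteq> 0" if "x \<in> K \<times> K" for x
      using elim D0K[OF that] that by (fastforce simp: dist_norm)
    have nz: "N n x \<noteq> 0 \<or> D n x \<noteq> 0" if x: "x \<in> X" for x
    proof (rule ccontr)
      assume "\<not> ?thesis"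
      then have "cmod (N0 x) < \<tau>" "cmod (D0 x) < \<tau>" using elim x by (auto simp: dist_norm)
      moreover have "sqrt ((cmod (N0 x))\<^sup>2 + (cmod (D0 x))\<^sup>2) \<le> cmod (N0 x) + cmod (D0 x)"
        by (rule sqrt_sum_squares_le_sum) auto
      ultimately show False using \<delta>(2)[OF x] \<tau> by linarith
    qed
    show ?case unfolding good_pade_def
    proof (intro ballI conjI)
      fix \<zeta> assume z: "\<zeta> \<in> K"
      have neg': "\<And>k. k < 0 \<Longrightarrow> a n \<zeta> k = 0" using neg[OF z] by auto
      \<comment> \<open>The Hankel determinant is read off from the denominator evaluated at its own
        centre, a point of K \<times> K.\<close>
      show inD: "in_D (a n \<zeta>) p q"
        using DK[of "(\<zeta>, \<zeta>)"] z jacobi_den_center[of "a n \<zeta>" p q \<zeta>] neg' by (simp add: D_def)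
      show "in_E (a n \<zeta>) p q \<zeta> (K \<union> L)"
        using nz z unfolding in_E_def X_def N_def D_def by fastforce
      have den0: "jacobi_den (a n \<zeta>) p q \<zeta> \<noteq> 0"
        using DK[of "(\<zeta>, \<zeta>)"] z by (auto simp: D_def)
      have pe: "pade (a n \<zeta>) p q \<zeta> = Fract (jacobi_num (a n \<zeta>) p q \<zeta>) (jacobi_den (a n \<zeta>) p q \<zeta>)"
        by (rule pade_eq_jacobi[OF neg' inD])
      have ev: "rat_eval (pade (a n \<zeta>) p q \<zeta>) w = sphere_ratio (N n (\<zeta>, w)) (D n (\<zeta>, w))" if "w \<in> K \<union> L" for w
        using nz[of "(\<zeta>, w)"] z that den0
        by (simp add: pe rat_eval_Fract N_def D_def X_def)
      show "euclid (rat_eval (pade (a n \<zeta>) p q \<zeta>) w) (poly A w / poly B w) \<le> ennreal \<epsilon>" if w: "w \<in> K" for w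
      proof -
        have "N0 (\<zeta>, w) / D0 (\<zeta>, w) = poly A w / poly B w" using N0D0[OF z, of w] by auto
        moreover have "dist (N n (\<zeta>, w) / D n (\<zeta>, w)) (N0 (\<zeta>, w) / D0 (\<zeta>, w)) < \<epsilon>"
          using elim z w by blast
        moreover have "D n (\<zeta>, w) \<noteq> 0" using DK z w by blast
        ultimately show ?thesis using w by (simp add: ev sphere_ratio_def dist_norm ennreal_leI)
      qed
      show "chordal (rat_eval (pade (a n \<zeta>) p q \<zeta>) w) (sphere_ratio (poly A w) (poly B w)) \<le> \<epsilon>" if w: "w \<in> L" for w
      proof -
        have x: "(\<zeta>, w) \<in> X" using z w by (simp add: X_def)
        have "sphere_ratio (N0 (\<zeta>, w)) (D0 (\<zeta>, w)) = sphere_ratio (poly A w) (poly B w)"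
          using N0D0[OF z, of w] sphere_ratio_scale by metis
        then have "chordal (rat_eval (pade (a n \<zeta>) p q \<zeta>) w) (sphere_ratio (poly A w) (poly B w))
          = chordal (sphere_ratio (N n (\<zeta>, w)) (D n (\<zeta>, w))) (sphere_ratio (N0 (\<zeta>, w)) (D0 (\<zeta>, w)))"
          using w by (simp add: ev)
        also have "\<dots> \<le> (cmod (N n (\<zeta>, w) - N0 (\<zeta>, w)) + cmod (D n (\<zeta>, w) - D0 (\<zeta>, w))) /
           sqrt ((cmod (N0 (\<zeta>, w)))\<^sup>2 + (cmod (D0 (\<zeta>, w)))\<^sup>2)"
          by (rule chordal_sphere_ratio_le[OF nz[OF x] nzX[OF x]])
        also have "\<dots> \<le> (\<tau> + \<tau>) / \<delta>"
          using elim x \<delta>(1) \<delta>(2)[OF x] \<tau>(1) by (intro frac_le add_mono) (auto simp: dist_norm intro: less_imp_le)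
        also have "\<dots> \<le> \<epsilon>"
        proof -
          have "\<tau> + \<tau> \<le> \<epsilon> * \<delta>" using \<tau> by linarith
          then show ?thesis using \<delta>(1) by (simp add: pos_divide_le_eq)
        qed
        finally show ?thesis .
      qed
    qed
  qed
qed

text \<open>Otherwise each tolerance 1 / (n + 1) has a counterexample, and these converge uniformly
  to the coefficients of A / B, against eventual goodness. So one tolerance serves all coefficient
  families at once.\<close>

lemma good_pade_stable:
  assumes K: "compact K" and L: "compact L" and cop: "coprime A B"
    and B: "\<And>z. z \<in> K \<Longrightarrow> poly B z \<noteq> 0" and e: "\<epsilon> > 0" and p: "degree A \<le> p" and q: "q = degree B"
  shows "\<exists>\<eta>>0. \<forall>a. (\<forall>\<zeta>\<in>K. \<forall>k<0. a \<zeta> k = 0) \<longrightarrow>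
      (\<forall>\<zeta>\<in>K. \<forall>k\<le>p + q. cmod (a \<zeta> (int k) - rat_taylor A B \<zeta> k) \<le> \<eta>) \<longrightarrow> good_pade K L A B \<epsilon> p q a"
proof (rule ccontr)
  assume no: "\<not> ?thesis"
  define P where "P = (\<lambda>\<eta> a. (\<forall>\<zeta>\<in>K. \<forall>k<0. a \<zeta> k = 0) \<and>
      (\<forall>\<zeta>\<in>K. \<forall>k\<le>p + q. cmod (a \<zeta> (int k) - rat_taylor A B \<zeta> k) \<le> \<eta>) \<and> \<not> good_pade K L A B \<epsilon> p q a)"
  have "\<exists>a. P \<eta> a" if "\<eta> > 0" for \<eta>
    using no that unfolding P_def by blast
  then have "\<forall>n. \<exists>a. P (1 / real (Suc n)) a" by simp
  then obtain a where a: "\<And>n. P (1 / real (Suc n)) (a n)" by metis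
  have "\<forall>\<^sub>F n in sequentially. good_pade K L A B \<epsilon> p q (a n)"
  proof (rule good_pade_eventually[OF K L cop B e p q])
    show "a n \<zeta> k = 0" if "\<zeta> \<in> K" "k < 0" for n \<zeta> k using a[of n] that unfolding P_def by blast
    fix k assume k: "k \<le> p + q"
    show "uniform_limit K (\<lambda>n \<zeta>. a n \<zeta> (int k)) (\<lambda>\<zeta>. rat_taylor A B \<zeta> k) sequentially"
      unfolding uniform_limit_iff
    proof (intro allI impI)
      fix r :: real assume "r > 0"
      then have "\<forall>\<^sub>F n in sequentially. 1 / real (Suc n) < r"
        using LIMSEQ_inverse_real_of_nat by (intro order_tendstoD(2)[of _ 0]) (auto simp: inverse_eq_divide)
      then show "\<forall>\<^sub>F n in sequentially. \<forall>\<zeta>\<in>K. dist (a n \<zeta> (int k)) (rat_taylor A B \<zeta> k) < r"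
      proof eventually_elim
        case (elim n)
        then show ?case using a[of n] k unfolding P_def dist_norm by (blast intro: le_less_trans)
      qed
    qed
  qed
  then obtain n where "good_pade K L A B \<epsilon> p q (a n)" by (auto simp: eventually_sequentially)
  then show False using a[of n] unfolding P_def by blast
qed

section \<open>Exhaustions, dense targets and the stage sequence\<close>

text \<open>For closed \<open>C\<close> and \<open>M\<close> these are compact sets that absorb
  every compact subset of C - M.\<close>

definition exhaustion :: "complex set \<Rightarrow> complex set \<Rightarrow> nat \<Rightarrow> complex set" where
  "exhaustion C M n = {z \<in> C. cmod z \<le> real n \<and> (\<forall>m\<in>M. 1 / real (Suc n) \<le> dist z m)}"

lemma compact_exhaustion:
  assumes "closed C"
  shows "compact (exhaustion C M n)"
proof -
  have "exhaustion C M n = cball 0 (real n) \<inter> (C \<inter> (\<Inter>m\<in>M. {z. 1 / real (Suc n) \<le> dist z m}))"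
    by (auto simp: exhaustion_def)
  moreover have "closed {z::complex. 1 / real (Suc n) \<le> dist z m}" for m
    by (intro closed_Collect_le continuous_intros)
  ultimately show ?thesis
    using assms by (simp only:) (intro compact_Int_closed compact_cball closed_Int closed_INT ballI)
qed

lemma exhaustion_mono:
  assumes "m \<le> n"
  shows "exhaustion C M m \<subseteq> exhaustion C M n"
proof -
  have "1 / real (Suc n) \<le> 1 / real (Suc m)" using assms by (simp add: frac_le)
  then show ?thesis using assms by (force simp: exhaustion_def)
qed

lemma exhaustion_absorbs:
  assumes J: "compact J" "J \<subseteq> C" and M: "closed M" "J \<inter> M = {}"
  obtains N where "\<And>n. n \<ge> N \<Longrightarrow> J \<subseteq> exhaustion C M n"
proof -
  obtain d where d: "d > 0" "\<And>x y. x \<in> J \<Longrightarrow> y \<in> M \<Longrightarrow> d \<le> dist x y"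
    using separate_compact_closed[OF J(1) M] by blast
  obtain b where b: "\<And>x. x \<in> J \<Longrightarrow> cmod x \<le> b" using compact_imp_bounded[OF J(1)] by (auto simp: bounded_iff)
  obtain N :: nat where N: "max b (1 / d) < real N" using reals_Archimedean2 by blast
  show thesis
  proof (rule that[of N], rule subsetI)
    fix n x assume n: "n \<ge> N" and x: "x \<in> J"
    have "real N \<le> real n" using n by simp
    then have bn: "b \<le> real n" and dn: "1 / d < real (Suc n)" using N by auto
    have "1 / real (Suc n) \<le> d" using dn d(1) by (simp add: field_simps)
    then show "x \<in> exhaustion C M n"
      using x J(2) b[OF x] bn d(2)[OF x] by (force simp: exhaustion_def)
  qed
qed

lemma exhaustion_neighbourhood:
  assumes "closed M" "z \<notin> M"
  obtains r N where "r > 0" "ball z r \<inter> C \<subseteq> exhaustion C M N"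
proof -
  have "open (- M)" "z \<in> - M" using assms by auto
  then obtain e where e: "e > 0" "cball z e \<subseteq> - M" using open_contains_cball by blast
  obtain N where N: "\<And>n. n \<ge> N \<Longrightarrow> cball z e \<subseteq> exhaustion UNIV M n"
    by (rule exhaustion_absorbs[OF compact_cball[of z e] subset_UNIV assms(1)]) (use e(2) in auto)
  have "ball z e \<inter> C \<subseteq> exhaustion C M N" using N[of N] by (force simp: exhaustion_def subset_iff)
  then show thesis using that e(1) by blast
qed

text \<open>A point is missing for one of three reasons. Outside \<open>C\<close> it can stay put;
  if it is too large it moves radially outwards; if it is too close to some \<open>m\<close> in
  \<open>M\<close> it moves straight to \<open>m\<close>, which belongs to no set of the
  exhaustion.\<close>

lemma exhaustion_push:
  assumes "a \<notin> exhaustion C M n"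
  shows "\<exists>b. b \<notin> exhaustion C M (Suc n) \<and> closed_segment a b \<inter> exhaustion C M n = {}"
proof -
  consider "a \<notin> C" | "cmod a > real n" | m where "m \<in> M" "dist a m < 1 / real (Suc n)"
    using assms by (force simp: exhaustion_def)
  then show ?thesis
  proof cases
    case 1
    then show ?thesis by (intro exI[of _ a]) (auto simp: exhaustion_def)
  next
    case 2
    \<comment> \<open>The end point (1 + c) a has modulus |a| + n + 2, beyond the bound n + 1 of the
      next set.\<close>
    define c where "c = (real n + 2) / cmod a"
    have a: "cmod a > 0" using 2 by linarith
    have c: "c \<ge> 0" by (simp add: c_def)
    have "cmod ((1 + c) *\<^sub>R a) = cmod a + (real n + 2)"
      using c a by (simp add: c_def distrib_right)
    then have "\<not> cmod ((1 + c) *\<^sub>R a) \<le> real (Suc n)" using a by linarith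
    then have "(1 + c) *\<^sub>R a \<notin> exhaustion C M (Suc n)" unfolding exhaustion_def by blast
    moreover have "x \<notin> exhaustion C M n" if x: "x \<in> closed_segment a ((1 + c) *\<^sub>R a)" for x
    proof -
      obtain u where u: "0 \<le> u" "x = (1 - u) *\<^sub>R a + u *\<^sub>R ((1 + c) *\<^sub>R a)"
        using x by (auto simp: in_segment)
      have "x = (1 + u * c) *\<^sub>R a" unfolding u(2) by (simp add: algebra_simps)
      then have "cmod x = (1 + u * c) * cmod a" using u c by simp
      also have "\<dots> \<ge> 1 * cmod a" using u c by (intro mult_right_mono) auto
      finally show ?thesis using 2 by (simp add: exhaustion_def)
    qed
    ultimately show ?thesis by blast
  next
    case 3
    have "m \<notin> exhaustion C M (Suc n)" using 3(1) by (force simp: exhaustion_def)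
    moreover have "x \<notin> exhaustion C M n" if x: "x \<in> closed_segment a m" for x
    proof -
      have "dist x m \<le> dist a m" using segment_bound(2)[OF x] by (simp add: dist_norm norm_minus_commute)
      then show ?thesis using 3 by (force simp: exhaustion_def)
    qed
    ultimately show ?thesis by blast
  qed
qed

section \<open>A countable chordally dense family of rational functions\<close>

definition rational_coeffs :: "complex poly set" where
  "rational_coeffs = {p. \<forall>i. Re (coeff p i) \<in> \<rat> \<and> Im (coeff p i) \<in> \<rat>}"

lemma countable_rational_coeffs: "countable rational_coeffs"
proof -
  let ?D = "(\<lambda>(x, y). Complex x y) ` (\<rat> \<times> \<rat>)"
  have "countable (Poly ` lists ?D)"
    by (intro countable_image countable_lists countable_SIGMA countable_rat)
  moreover have "rational_coeffs \<subseteq> Poly ` lists ?D"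
  proof
    fix p assume "p \<in> rational_coeffs"
    then have "coeff p i \<in> ?D" for i
      by (intro image_eqI[of _ _ "(Re (coeff p i), Im (coeff p i))"]) (auto simp: rational_coeffs_def)
    then have "coeffs p \<in> lists ?D" by (auto simp: coeffs_def)
    then show "p \<in> Poly ` lists ?D" by (metis Poly_coeffs imageI)
  qed
  ultimately show ?thesis by (rule countable_subset[rotated])
qed

lemma rational_coeffs_dense:
  assumes L: "compact L" and \<tau>: "\<tau> > 0"
  obtains p' where "p' \<in> rational_coeffs" "\<And>z. z \<in> L \<Longrightarrow> cmod (poly p' z - poly p z) \<le> \<tau>"
proof -
  obtain b where b: "b > 0" "\<And>x. x \<in> L \<Longrightarrow> cmod x \<le> b" using compact_imp_bounded[OF L] bounded_pos by metis
  \<comment> \<open>As |z| \<le> b on \<open>L\<close>, moving every coefficient by at most \<tau> /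
    s moves the values by at most \<open>\<tau>\<close>.\<close>
  define s where "s = (\<Sum>i\<le>degree p. b ^ i)"
  have s: "s > 0" unfolding s_def using b by (intro sum_pos) auto
  have "\<exists>c. Re c \<in> \<rat> \<and> Im c \<in> \<rat> \<and> cmod (c - w) \<le> \<tau> / s" for w
  proof -
    have t: "\<tau> / (2 * s) > 0" using s \<tau> by simp
    obtain x where x: "x \<in> \<rat>" "Re w < x" "x < Re w + \<tau> / (2 * s)" using Rats_dense_in_real[of "Re w" "Re w + \<tau> / (2 * s)"] t by auto
    obtain y where y: "y \<in> \<rat>" "Im w < y" "y < Im w + \<tau> / (2 * s)" using Rats_dense_in_real[of "Im w" "Im w + \<tau> / (2 * s)"] t by auto
    have "cmod (Complex x y - w) \<le> \<bar>Re (Complex x y - w)\<bar> + \<bar>Im (Complex x y - w)\<bar>" by (rule cmod_le)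
    also have "\<dots> \<le> \<tau> / (2 * s) + \<tau> / (2 * s)" using x y by (intro add_mono) auto
    also have "\<dots> = \<tau> / s" by simp
    finally show ?thesis using x y by (intro exI[of _ "Complex x y"]) auto
  qed
  then obtain c where c: "\<And>w. Re (c w) \<in> \<rat> \<and> Im (c w) \<in> \<rat> \<and> cmod (c w - w) \<le> \<tau> / s" by metis
  define p' where "p' = (\<Sum>i\<le>degree p. monom (c (coeff p i)) i)"
  have "coeff p' i = (if i \<le> degree p then c (coeff p i) else 0)" for i by (simp add: p'_def coeff_sum)
  then have "p' \<in> rational_coeffs" using c by (simp add: rational_coeffs_def)
  moreover have "cmod (poly p' z - poly p z) \<le> \<tau>" if z: "z \<in> L" for z
  proof -
    have "poly p' z - poly p z = (\<Sum>i\<le>degree p. (c (coeff p i) - coeff p i) * z ^ i)"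
      by (simp add: p'_def poly_sum poly_monom poly_altdef[of p] sum_subtractf[symmetric] algebra_simps)
    also have "cmod \<dots> \<le> (\<Sum>i\<le>degree p. \<tau> / s * b ^ i)"
    proof (intro order_trans[OF norm_sum] sum_mono)
      fix i
      have "cmod z ^ i \<le> b ^ i" using b(2)[OF z] by (intro power_mono) auto
      then show "cmod ((c (coeff p i) - coeff p i) * z ^ i) \<le> \<tau> / s * b ^ i"
        unfolding norm_mult norm_power using c s \<tau> by (intro mult_mono) auto
    qed
    also have "\<dots> = \<tau> / s * s" by (simp only: s_def sum_distrib_left)
    also have "\<dots> = \<tau>" using s by simp
    finally show ?thesis .
  qed
  ultimately show thesis using that by blast
qed

text \<open>Perturbing the coefficients of a coprime pair to Gaussian rationals moves the values
  little in the chordal metric. Each member of the countable family must recur, so that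
  approximation is possible beyond any index.\<close>

lemma chordally_dense_sequence:
  obtains h :: "nat \<Rightarrow> complex poly fract" where
    "\<And>g L \<epsilon> N. compact L \<Longrightarrow> \<epsilon> > 0 \<Longrightarrow> \<exists>n\<ge>N. \<forall>z\<in>L. chordal (rat_eval (h n) z) (rat_eval g z) \<le> \<epsilon>"
proof -
  define H where "H = (\<lambda>(P, Q). Fract P Q) ` (rational_coeffs \<times> rational_coeffs)"
  have H: "countable H" unfolding H_def by (intro countable_image countable_SIGMA countable_rational_coeffs)
  \<comment> \<open>Pair coding lets every member occur infinitely often: the code of (i, N) is at
    least \<open>N\<close>.\<close>
  define h where "h = (\<lambda>n. from_nat_into H (fst (prod_decode n)))"
  show thesis
  proof (rule that[of h])
    fix g :: "complex poly fract" and L :: "complex set" and \<epsilon> :: real and N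
    assume L: "compact L" and e: "\<epsilon> > 0"
    obtain P Q where PQ: "Q \<noteq> 0" "\<And>z. poly P z \<noteq> 0 \<or> poly Q z \<noteq> 0" "\<And>z. rat_eval g z = sphere_ratio (poly P z) (poly Q z)"
      using rat_eval_coprime_pair[of g] by metis
    \<comment> \<open>Closeness at one extra point where \<open>Q\<close> does not vanish forces Q'
      to be non-zero, even if \<open>L\<close> is empty or \<open>Q\<close> vanishes on all of
      it.\<close>
    have "\<exists>z0. poly Q z0 \<noteq> 0" using PQ(1) poly_all_0_iff_0 by blast
    then obtain z0 where z0: "poly Q z0 \<noteq> 0" by blast
    have L': "compact (insert z0 L)" using L by simp
    obtain \<delta> where \<delta>: "\<delta> > 0" "\<And>z. z \<in> L \<Longrightarrow> \<delta> \<le> sqrt ((cmod (poly P z))\<^sup>2 + (cmod (poly Q z))\<^sup>2)"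
      by (rule compact_pair_norm_ge[OF L, of "poly P" "poly Q"]) (use PQ in \<open>auto intro!: continuous_intros\<close>)
    define \<tau> where "\<tau> = Min {\<delta> / 4, \<epsilon> * \<delta> / 2, cmod (poly Q z0) / 2}"
    have \<tau>: "\<tau> > 0" "4 * \<tau> \<le> \<delta>" "2 * \<tau> \<le> \<epsilon> * \<delta>" "2 * \<tau> \<le> cmod (poly Q z0)"
    proof -
      show "\<tau> > 0" using \<delta>(1) e z0 by (simp add: \<tau>_def)
      have "\<tau> \<le> \<delta> / 4" "\<tau> \<le> \<epsilon> * \<delta> / 2" "\<tau> \<le> cmod (poly Q z0) / 2" by (simp_all add: \<tau>_def)
      then show "4 * \<tau> \<le> \<delta>" "2 * \<tau> \<le> \<epsilon> * \<delta>" "2 * \<tau> \<le> cmod (poly Q z0)" by linarith+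
    qed
    obtain P' where P': "P' \<in> rational_coeffs" "\<And>z. z \<in> insert z0 L \<Longrightarrow> cmod (poly P' z - poly P z) \<le> \<tau>"
      using rational_coeffs_dense[OF L' \<tau>(1)] by metis
    obtain Q' where Q': "Q' \<in> rational_coeffs" "\<And>z. z \<in> insert z0 L \<Longrightarrow> cmod (poly Q' z - poly Q z) \<le> \<tau>"
      using rational_coeffs_dense[OF L' \<tau>(1)] by metis
    have "poly Q' z0 \<noteq> 0" using Q'(2)[of z0] \<tau>(1,4) by auto
    then have Q'0: "Q' \<noteq> 0" by auto
    have nz: "poly P' z \<noteq> 0 \<or> poly Q' z \<noteq> 0" if z: "z \<in> L" for z
    proof (rule ccontr)
      assume "\<not> ?thesis"
      then have "cmod (poly P z) \<le> \<tau>" "cmod (poly Q z) \<le> \<tau>" using P'(2)[of z] Q'(2)[of z] z by auto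
      moreover have "sqrt ((cmod (poly P z))\<^sup>2 + (cmod (poly Q z))\<^sup>2) \<le> cmod (poly P z) + cmod (poly Q z)"
        by (rule sqrt_sum_squares_le_sum) auto
      ultimately show False using \<delta>(2)[OF z] \<tau> by linarith
    qed
    have close: "chordal (rat_eval (Fract P' Q') z) (rat_eval g z) \<le> \<epsilon>" if z: "z \<in> L" for z
    proof -
      have "chordal (rat_eval (Fract P' Q') z) (rat_eval g z)
        \<le> (cmod (poly P' z - poly P z) + cmod (poly Q' z - poly Q z)) / sqrt ((cmod (poly P z))\<^sup>2 + (cmod (poly Q z))\<^sup>2)"
        unfolding rat_eval_Fract[OF nz[OF z] Q'0] PQ(3) by (rule chordal_sphere_ratio_le[OF nz[OF z] PQ(2)])
      also have "\<dots> \<le> (\<tau> + \<tau>) / \<delta>"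
        using P'(2)[of z] Q'(2)[of z] z \<delta>(1) \<delta>(2)[OF z] \<tau>(1) by (intro frac_le add_mono) auto
      also have "\<dots> \<le> \<epsilon>" using \<tau>(3) \<delta>(1) by (simp add: pos_divide_le_eq)
      finally show ?thesis .
    qed
    have "Fract P' Q' \<in> H" using P' Q' by (auto simp: H_def)
    then obtain i where i: "from_nat_into H i = Fract P' Q'" using from_nat_into_surj[OF H] by metis
    have "h (prod_encode (i, N)) = Fract P' Q'" by (simp add: h_def i)
    then show "\<exists>n\<ge>N. \<forall>z\<in>L. chordal (rat_eval (h n) z) (rat_eval g z) \<le> \<epsilon>"
      using close by (intro exI[of _ "prod_encode (i, N)"]) (simp add: le_prod_encode_2)
  qed
qed

section \<open>Stages of the construction\<close>

definition good_stage ::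
  "complex set \<Rightarrow> complex set \<Rightarrow> complex poly fract \<Rightarrow> real \<Rightarrow> complex poly \<Rightarrow> complex poly \<Rightarrow> real \<Rightarrow> nat \<Rightarrow> bool" where
  "good_stage K L h \<epsilon> A B \<eta> l \<longleftrightarrow> coprime A B \<and> B \<noteq> 0 \<and> (\<forall>z\<in>K. poly B z \<noteq> 0) \<and>
     (\<forall>z\<in>L. chordal (sphere_ratio (poly A z) (poly B z)) (rat_eval h z) \<le> \<epsilon>) \<and> 0 < \<eta> \<and> \<eta> \<le> \<epsilon> \<and>
     (\<forall>a. (\<forall>\<zeta>\<in>K. \<forall>k<0. a \<zeta> k = 0) \<longrightarrow> (\<forall>\<zeta>\<in>K. \<forall>k\<le>l. cmod (a \<zeta> (int k) - rat_taylor A B \<zeta> k) \<le> \<eta>) \<longrightarrow>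
       good_pade K L A B \<epsilon> (degree A) (degree B) a)"

text \<open>\<open>\<eta>\<close> and \<open>l\<close> record what later stages must preserve.
  Lowering the tolerance and raising the order only restricts the competitors, so both can be
  adjusted to \<open>\<eta>0\<close> and \<open>l0\<close>.\<close>

lemma good_stage_exists:
  assumes K: "compact K" and L: "compact L" and cop: "coprime A B" and B: "B \<noteq> 0" "\<And>z. z \<in> K \<Longrightarrow> poly B z \<noteq> 0"
    and h: "\<And>z. z \<in> L \<Longrightarrow> chordal (sphere_ratio (poly A z) (poly B z)) (rat_eval h z) \<le> \<epsilon>" and e: "\<epsilon> > 0" and e0: "\<eta>0 > 0"
  obtains \<eta> l where "good_stage K L h \<epsilon> A B \<eta> l" "\<eta> \<le> \<eta>0" "l0 \<le> l"
proof -
  obtain \<eta> where \<eta>: "\<eta> > 0" "\<And>a. (\<forall>\<zeta>\<in>K. \<forall>k<0. a \<zeta> k = 0) \<Longrightarrow>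
      (\<forall>\<zeta>\<in>K. \<forall>k\<le>degree A + degree B. cmod (a \<zeta> (int k) - rat_taylor A B \<zeta> k) \<le> \<eta>) \<Longrightarrow>
      good_pade K L A B \<epsilon> (degree A) (degree B) a"
    using good_pade_stable[OF K L cop B(2) e, of "degree A" "degree B"] by auto
  define \<eta>' where "\<eta>' = Min {\<eta>, \<epsilon>, \<eta>0}"
  have \<eta>': "\<eta>' > 0" "\<eta>' \<le> \<eta>" "\<eta>' \<le> \<epsilon>" "\<eta>' \<le> \<eta>0" using \<eta>(1) e e0 by (auto simp: \<eta>'_def)
  have "good_stage K L h \<epsilon> A B \<eta>' (l0 + degree A + degree B)"
    unfolding good_stage_def
  proof (intro conjI allI impI ballI)
    fix a assume a: "\<forall>\<zeta>\<in>K. \<forall>k<0. a \<zeta> k = 0"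
      "\<forall>\<zeta>\<in>K. \<forall>k\<le>l0 + degree A + degree B. cmod (a \<zeta> (int k) - rat_taylor A B \<zeta> k) \<le> \<eta>'"
    have "cmod (a \<zeta> (int k) - rat_taylor A B \<zeta> k) \<le> \<eta>" if "\<zeta> \<in> K" "k \<le> degree A + degree B" for \<zeta> k
    proof -
      have "cmod (a \<zeta> (int k) - rat_taylor A B \<zeta> k) \<le> \<eta>'" using a(2) that by simp
      then show ?thesis using \<eta>'(2) by linarith
    qed
    then show "good_pade K L A B \<epsilon> (degree A) (degree B) a" using \<eta>(2) a(1) by blast
  qed (use cop B h \<eta>' in auto)
  then show thesis by (rule that) (use \<eta>' in auto)
qed

text \<open>Dependent choice. A step changes the coefficients by at most half the current tolerance,
  and tolerances halve, so the total later change stays within the tolerance of every earlier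
  stage.\<close>

lemma stage_sequence:
  fixes K L :: "nat \<Rightarrow> complex set"
  assumes K: "\<And>n. compact (K n)" "\<And>n. K n \<subseteq> K (Suc n)" and L: "\<And>n. compact (L n)" "\<And>n. K n \<inter> L n = {}"
    and push: "\<And>n a. a \<notin> K n \<Longrightarrow> \<exists>b. b \<notin> K (Suc n) \<and> closed_segment a b \<inter> K n = {}"
  obtains A B \<eta> l where "\<And>n. good_stage (K n) (L n) (h n) (1 / real (Suc n)) (A n) (B n) (\<eta> n) (l n)"
    "\<And>n. n \<le> l n" "\<And>n. l n \<le> l (Suc n)" "\<And>n. \<eta> (Suc n) \<le> \<eta> n / 2"
    "\<And>n \<zeta> k. \<zeta> \<in> K n \<Longrightarrow> k \<le> l n \<Longrightarrow>
       cmod (rat_taylor (A (Suc n)) (B (Suc n)) \<zeta> k - rat_taylor (A n) (B n) \<zeta> k) \<le> \<eta> n / 2"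
proof -
  define P where "P = (\<lambda>n (A, B, \<eta>, l). good_stage (K n) (L n) (h n) (1 / real (Suc n)) A B \<eta> l \<and> n \<le> l)"
  define Q where "Q = (\<lambda>n (A, B, \<eta> :: real, l) (A', B', \<eta>', l'). l \<le> (l' :: nat) \<and> \<eta>' \<le> \<eta> / 2 \<and>
    (\<forall>\<zeta>\<in>K n. \<forall>k\<le>l. cmod (rat_taylor A' B' \<zeta> k - rat_taylor A B \<zeta> k) \<le> \<eta> / 2))"
  have "\<exists>x. P 0 x"
  proof -
    \<comment> \<open>The first stage has nothing to preserve: the approximation step is run with
      the empty set as previous compact set, and \<open>b\<close> is a target for all poles.\<close>
    obtain b where b: "b \<notin> K 0"
      using K(1)[of 0] compact_imp_bounded not_bounded_UNIV by (metis UNIV_eq_I)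
    obtain A B where AB: "coprime A B" "B \<noteq> 0" "\<And>z. z \<in> K 0 \<Longrightarrow> poly B z \<noteq> 0"
      "\<And>z. z \<in> L 0 \<Longrightarrow> chordal (sphere_ratio (poly A z) (poly B z)) (rat_eval (h 0) z) \<le> 1 / real (Suc 0)"
      by (rule rational_step[of "{}" "K 0" "L 0" 1 "1 / real (Suc 0)" _ _ "h 0"])
         (use K(1) L b in \<open>auto intro: exI[of _ b]\<close>)
    obtain \<eta> l where "good_stage (K 0) (L 0) (h 0) (1 / real (Suc 0)) A B \<eta> l"
      by (rule good_stage_exists[OF K(1)[of 0] L(1)[of 0] AB(1,2,3) AB(4), of 1 0]) auto
    then show ?thesis by (auto simp: P_def)
  qed
  moreover have "\<exists>y. P (Suc n) y \<and> Q n x y" if x: "P n x" for x n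
  proof -
    obtain A B \<eta> l where xe: "x = (A, B, \<eta>, l)" by (cases x)
    have g: "good_stage (K n) (L n) (h n) (1 / real (Suc n)) A B \<eta> l" "n \<le> l" using x by (auto simp: P_def xe)
    then have B: "B \<noteq> 0" "\<And>z. z \<in> K n \<Longrightarrow> poly B z \<noteq> 0" and \<eta>: "\<eta> > 0" by (auto simp: good_stage_def)
    \<comment> \<open>One number serves both the preservation of stage \<open>n\<close> and the
      chordal error allowed at stage n + 1.\<close>
    define \<epsilon> where "\<epsilon> = min (\<eta> / 2) (1 / real (Suc (Suc n)))"
    have \<epsilon>: "\<epsilon> > 0" "\<epsilon> \<le> \<eta> / 2" "\<epsilon> \<le> 1 / real (Suc (Suc n))" using \<eta> by (auto simp: \<epsilon>_def)
    obtain A' B' where AB: "coprime A' B'" "B' \<noteq> 0" "\<And>z. z \<in> K (Suc n) \<Longrightarrow> poly B' z \<noteq> 0"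
      "\<And>\<zeta> k. \<zeta> \<in> K n \<Longrightarrow> k \<le> l \<Longrightarrow> cmod (rat_taylor A' B' \<zeta> k - rat_taylor A B \<zeta> k) \<le> \<epsilon>"
      "\<And>z. z \<in> L (Suc n) \<Longrightarrow> chordal (sphere_ratio (poly A' z) (poly B' z)) (rat_eval (h (Suc n)) z) \<le> \<epsilon>"
      using rational_step[OF K(1)[of n] K(1)[of "Suc n"] K(2)[of n] L(1)[of "Suc n"] L(2)[of "Suc n"] push B \<epsilon>(1), where h = "h (Suc n)" and l = l]
      by metis
    have c: "chordal (sphere_ratio (poly A' z) (poly B' z)) (rat_eval (h (Suc n)) z) \<le> 1 / real (Suc (Suc n))" if "z \<in> L (Suc n)" for z
      using AB(5)[OF that] \<epsilon>(3) by linarith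
    have pos: "0 < 1 / real (Suc (Suc n))" "0 < \<eta> / 2" using \<eta> by auto
    obtain \<eta>' l' where st: "good_stage (K (Suc n)) (L (Suc n)) (h (Suc n)) (1 / real (Suc (Suc n))) A' B' \<eta>' l'" "\<eta>' \<le> \<eta> / 2" "l + Suc n \<le> l'"
      using good_stage_exists[OF K(1)[of "Suc n"] L(1)[of "Suc n"] AB(1,2,3) c pos, of "l + Suc n"] by metis
    have "P (Suc n) (A', B', \<eta>', l')" using st by (auto simp: P_def)
    moreover have "Q n x (A', B', \<eta>', l')" using st AB(4) \<epsilon>(2) by (force simp: Q_def xe)
    ultimately show ?thesis by blast
  qed
  ultimately obtain F where F: "\<And>n. P n (F n)" "\<And>n. Q n (F n) (F (Suc n))"
    using dependent_nat_choice[of P Q] by metis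
  show thesis
    by (rule that[of "\<lambda>n. fst (F n)" "\<lambda>n. fst (snd (F n))" "\<lambda>n. fst (snd (snd (F n)))" "\<lambda>n. snd (snd (snd (F n)))"])
       (use F in \<open>auto simp: P_def Q_def case_prod_unfold\<close>)
qed

section \<open>The limit function\<close>

lemma euclid_triangle: "euclid x c \<le> euclid x b + ennreal (cmod (b - c))"
proof (cases x)
  case (Fin a)
  have "cmod (a - c) \<le> cmod (a - b) + cmod (b - c)" using norm_triangle_ineq[of "a - b" "b - c"] by simp
  then show ?thesis using Fin by (simp flip: ennreal_plus add: ennreal_leI)
qed simp

lemma ennreal_tendsto_0:
  fixes F :: "nat \<Rightarrow> ennreal"
  assumes "\<And>k. k \<ge> N \<Longrightarrow> F k \<le> ennreal (c / real (Suc k))"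
  shows "F \<longlonglongrightarrow> 0"
proof (rule tendsto_sandwich[of "\<lambda>_. 0" F sequentially "\<lambda>k. ennreal (c / real (Suc k))"])
  have "(\<lambda>k. c * inverse (real (Suc k))) \<longlonglongrightarrow> c * 0"
    by (intro tendsto_intros LIMSEQ_inverse_real_of_nat)
  then have "(\<lambda>k. c / real (Suc k)) \<longlonglongrightarrow> 0" by (simp add: divide_inverse)
  then show "(\<lambda>k. ennreal (c / real (Suc k))) \<longlonglongrightarrow> 0" using tendsto_ennrealI by fastforce
  show "\<forall>\<^sub>F k in sequentially. F k \<le> ennreal (c / real (Suc k))"
    using assms by (auto simp: eventually_sequentially)
qed auto

text \<open>A Urysohn function for the disjoint closures of \<open>S\<close> and \<open>T\<close> is
  cut at the level 1/2; the level set itself belongs to both pieces.\<close>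

lemma separating_frontier_cover:
  fixes S T :: "complex set"
  assumes "closure S \<inter> closure T = {}"
  obtains M M' where "closed M" "closed M'" "M \<union> M' = frontier \<Omega>" "S \<inter> M = {}" "T \<inter> M' = {}"
proof -
  obtain u :: "complex \<Rightarrow> real" where u: "continuous_on UNIV u" "\<And>x. x \<in> closure S \<Longrightarrow> u x = 0" "\<And>x. x \<in> closure T \<Longrightarrow> u x = 1"
    using Urysohn[OF closed_closure closed_closure assms] by metis
  show thesis
  proof (rule that[of "frontier \<Omega> \<inter> {z. 1/2 \<le> u z}" "frontier \<Omega> \<inter> {z. u z \<le> 1/2}"])
    show "closed (frontier \<Omega> \<inter> {z. 1/2 \<le> u z})" "closed (frontier \<Omega> \<inter> {z. u z \<le> 1/2})"
      by (intro closed_Int frontier_closed closed_Collect_le continuous_on_const u(1))+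
    show "S \<inter> (frontier \<Omega> \<inter> {z. 1/2 \<le> u z}) = {}" "T \<inter> (frontier \<Omega> \<inter> {z. u z \<le> 1/2}) = {}"
      using u(2,3) closure_subset by force+
  qed auto
qed

text \<open>Separates the convergence of the stages on the side of \<open>\<Omega>\<close> from the
  chordal approximation.\<close>

locale stage_limit =
  fixes \<Omega> M :: "complex set" and A B :: "nat \<Rightarrow> complex poly" and \<eta> :: "nat \<Rightarrow> real" and l :: "nat \<Rightarrow> nat"
  assumes open_\<Omega>: "open \<Omega>" and closed_M: "closed M" and M_sub: "M \<subseteq> frontier \<Omega>"
    and B_nz: "\<And>n z. z \<in> exhaustion (closure \<Omega>) M n \<Longrightarrow> poly (B n) z \<noteq> 0"
    and \<eta>_le: "\<And>n. \<eta> n \<le> 1 / real (Suc n)" and \<eta>_pos: "\<And>n. 0 < \<eta> n"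
    and l_ge: "\<And>n. n \<le> l n" and l_mono: "\<And>n. l n \<le> l (Suc n)" and \<eta>_half: "\<And>n. \<eta> (Suc n) \<le> \<eta> n / 2"
    and step: "\<And>n \<zeta> k. \<zeta> \<in> exhaustion (closure \<Omega>) M n \<Longrightarrow> k \<le> l n \<Longrightarrow>
       cmod (rat_taylor (A (Suc n)) (B (Suc n)) \<zeta> k - rat_taylor (A n) (B n) \<zeta> k) \<le> \<eta> n / 2"
begin

abbreviation "K \<equiv> exhaustion (closure \<Omega>) M"
abbreviation "r n \<equiv> rat_taylor (A n) (B n)"
definition "limit_taylor \<zeta> k = lim (\<lambda>n. r n \<zeta> k)"
definition "limit_fun \<zeta> = limit_taylor \<zeta> 0"

lemma K_mono: "m \<le> n \<Longrightarrow> K m \<subseteq> K n" by (rule exhaustion_mono)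

lemma l_mono': "m \<le> n \<Longrightarrow> l m \<le> l n" by (rule lift_Suc_mono_le[of l]) (use l_mono in auto)

text \<open>The steps sum to \<eta> n (1/2 + 1/4 + ...). The decay of the tolerances is proved in
  the same induction because it bounds each new step.\<close>

lemma stage_diff:
  assumes "\<zeta> \<in> K n" "k \<le> l n"
  shows "cmod (r (n + j) \<zeta> k - r n \<zeta> k) \<le> \<eta> n * (1 - (1/2) ^ j) \<and> \<eta> (n + j) \<le> \<eta> n * (1/2) ^ j"
proof (induction j)
  case (Suc j)
  have "\<zeta> \<in> K (n + j)" "k \<le> l (n + j)" using assms K_mono[of n "n + j"] l_mono'[of n "n + j"] by auto
  then have "cmod (r (Suc (n + j)) \<zeta> k - r (n + j) \<zeta> k) \<le> \<eta> (n + j) / 2" by (rule step)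
  then have "cmod (r (n + Suc j) \<zeta> k - r n \<zeta> k) \<le> \<eta> (n + j) / 2 + \<eta> n * (1 - (1/2) ^ j)"
    using Suc.IH norm_triangle_ineq[of "r (Suc (n + j)) \<zeta> k - r (n + j) \<zeta> k" "r (n + j) \<zeta> k - r n \<zeta> k"] by simp
  moreover have "\<eta> (n + Suc j) \<le> \<eta> (n + j) / 2" using \<eta>_half[of "n + j"] by simp
  ultimately show ?case using Suc.IH by (simp add: algebra_simps)
qed simp

lemma stage_diff_le:
  assumes "\<zeta> \<in> K n" "k \<le> l n" "n \<le> m"
  shows "cmod (r m \<zeta> k - r n \<zeta> k) \<le> \<eta> n"
proof -
  have "\<eta> n * (1 - (1/2) ^ (m - n)) \<le> \<eta> n * 1" using \<eta>_pos[of n] by (intro mult_left_mono) auto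
  then show ?thesis using stage_diff[OF assms(1,2), of "m - n"] assms(3) by simp
qed

lemma convergent_taylor:
  assumes "\<zeta> \<in> K n0"
  shows "(\<lambda>n. r n \<zeta> k) \<longlonglongrightarrow> limit_taylor \<zeta> k"
proof -
  have "Cauchy (\<lambda>n. r n \<zeta> k)"
  proof (rule metric_CauchyI)
    fix e :: real assume e: "e > 0"
    obtain N0 :: nat where N0: "2 / e < real N0" using reals_Archimedean2 by blast
    \<comment> \<open>From this index on the point lies in \<open>K N\<close>, the order
      \<open>k\<close> is controlled since \<open>k \<le> N \<le> l N\<close>, and the tolerance is
      below e / 2.\<close>
    define N where "N = max n0 (max k N0)"
    have "2 / e < real (Suc N)" using N0 by (simp add: N_def)
    then have "2 * (1 / real (Suc N)) < e" using e by (simp add: field_simps)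
    then have eN: "2 * \<eta> N < e" using \<eta>_le[of N] by linarith
    have z: "\<zeta> \<in> K N" "k \<le> l N" using assms K_mono[of n0 N] l_ge[of N] by (auto simp: N_def)
    have "dist (r m \<zeta> k) (r n \<zeta> k) < e" if "m \<ge> N" "n \<ge> N" for m n
    proof -
      have "dist (r m \<zeta> k) (r n \<zeta> k) \<le> cmod (r m \<zeta> k - r N \<zeta> k) + cmod (r n \<zeta> k - r N \<zeta> k)"
        by (metis dist_norm dist_triangle2)
      then show ?thesis using stage_diff_le[OF z that(1)] stage_diff_le[OF z that(2)] eN by linarith
    qed
    then show "\<exists>M. \<forall>m\<ge>M. \<forall>n\<ge>M. dist (r m \<zeta> k) (r n \<zeta> k) < e" by blast
  qed
  then show ?thesis unfolding limit_taylor_def by (simp add: Cauchy_convergent_iff convergent_LIMSEQ_iff)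
qed

lemma limit_taylor_close:
  assumes "\<zeta> \<in> K n" "k \<le> l n"
  shows "cmod (limit_taylor \<zeta> k - r n \<zeta> k) \<le> \<eta> n"
proof (rule Lim_bounded)
  show "(\<lambda>m. cmod (r m \<zeta> k - r n \<zeta> k)) \<longlonglongrightarrow> cmod (limit_taylor \<zeta> k - r n \<zeta> k)"
    by (intro tendsto_intros convergent_taylor[OF assms(1)])
  show "\<forall>m\<ge>n. cmod (r m \<zeta> k - r n \<zeta> k) \<le> \<eta> n" using stage_diff_le[OF assms] by blast
qed

lemma uniform_limit_taylor: "uniform_limit (K N) (\<lambda>n \<zeta>. r n \<zeta> k) (\<lambda>\<zeta>. limit_taylor \<zeta> k) sequentially"
  unfolding uniform_limit_iff
proof (intro allI impI)
  fix e :: real assume e: "e > 0"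
  have "\<forall>\<^sub>F n in sequentially. 1 / real (Suc n) < e"
    using LIMSEQ_inverse_real_of_nat e by (intro order_tendstoD(2)[of _ 0]) (auto simp: inverse_eq_divide)
  moreover have "\<forall>\<^sub>F n in sequentially. n \<ge> max N k" by (rule eventually_ge_at_top)
  ultimately show "\<forall>\<^sub>F n in sequentially. \<forall>\<zeta>\<in>K N. dist (r n \<zeta> k) (limit_taylor \<zeta> k) < e"
  proof eventually_elim
    case (elim n)
    show ?case
    proof
      fix \<zeta> assume "\<zeta> \<in> K N"
      then have "cmod (limit_taylor \<zeta> k - r n \<zeta> k) \<le> \<eta> n"
        using elim K_mono[of N n] l_ge[of n] by (intro limit_taylor_close) auto
      then show "dist (r n \<zeta> k) (limit_taylor \<zeta> k) < e"
        using elim \<eta>_le[of n] by (simp add: dist_norm norm_minus_commute)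
    qed
  qed
qed

text \<open>Convergence is uniform on each \<open>K N\<close>, and every point of closure \<Omega> -
  M has a relative neighbourhood inside some \<open>K N\<close>.\<close>

lemma continuous_limit_taylor: "continuous_on (closure \<Omega> - M) (\<lambda>\<zeta>. limit_taylor \<zeta> k)"
  unfolding continuous_on_def
proof
  fix z assume z: "z \<in> closure \<Omega> - M"
  obtain e N where e: "e > 0" "ball z e \<inter> closure \<Omega> \<subseteq> K N"
    using exhaustion_neighbourhood[OF closed_M, of z] z by auto
  have "continuous_on (K N) (\<lambda>\<zeta>. limit_taylor \<zeta> k)"
  proof (rule uniform_limit_theorem[OF _ uniform_limit_taylor])
    \<comment> \<open>Earlier stages may have poles on \<open>K N\<close>; those from
      \<open>N\<close> on do not.\<close>
    have "continuous_on (K N) (\<lambda>\<zeta>. r n \<zeta> k)" if "n \<ge> N" for n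
      using B_nz[of _ n] K_mono[OF that] by (intro continuous_on_rat_taylor) blast
    then show "\<forall>\<^sub>F n in sequentially. continuous_on (K N) (\<lambda>\<zeta>. r n \<zeta> k)"
      by (auto simp: eventually_sequentially)
  qed simp
  moreover have "z \<in> K N" using e z by auto
  ultimately have "((\<lambda>\<zeta>. limit_taylor \<zeta> k) \<longlongrightarrow> limit_taylor z k) (at z within K N)"
    by (simp add: continuous_on_def)
  then have "((\<lambda>\<zeta>. limit_taylor \<zeta> k) \<longlongrightarrow> limit_taylor z k) (at z within (closure \<Omega> - M) \<inter> ball z e)"
    by (rule tendsto_within_subset) (use e in auto)
  then show "((\<lambda>\<zeta>. limit_taylor \<zeta> k) \<longlongrightarrow> limit_taylor z k) (at z within closure \<Omega> - M)"
    by (subst at_within_nhd[of z "ball z e" _ "(closure \<Omega> - M) \<inter> ball z e"]) (use e(1) in auto)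
qed

text \<open>Weierstrass' theorem on a small disc: the stages converge uniformly and so do all their
  derivatives locally, which identifies the derivatives of the limit with the limits of the
  coefficients.\<close>

lemma limit_fun_local:
  assumes z: "z \<in> \<Omega>"
  obtains e where "e > 0" "limit_fun holomorphic_on ball z e"
    "\<And>k w. w \<in> ball z e \<Longrightarrow> (deriv ^^ k) limit_fun w = fact k * limit_taylor w k"
proof -
  have zM: "z \<notin> M" using z M_sub open_\<Omega> by (auto simp: frontier_def interior_open)
  obtain e1 N where e1: "e1 > 0" "ball z e1 \<inter> closure \<Omega> \<subseteq> K N"
    using exhaustion_neighbourhood[OF closed_M zM] by blast
  obtain e2 where e2: "e2 > 0" "ball z e2 \<subseteq> \<Omega>" using open_\<Omega> z openE by blast
  define e where "e = min e1 e2"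
  have e: "e > 0" "ball z e \<subseteq> K N"
    using e1 e2 closure_subset[of \<Omega>] by (auto simp: e_def subset_iff)
  \<comment> \<open>The shift by \<open>N\<close> makes every member of the sequence pole-free on
    the disc.\<close>
  define g where "g = (\<lambda>n z. poly (A (n + N)) z / poly (B (n + N)) z)"
  have "poly (B (n + N)) w \<noteq> 0" if "w \<in> ball z e" for n w
    using that e(2) K_mono[of N "n + N"] by (intro B_nz) auto
  then have hol: "g n holomorphic_on ball z e" for n
    unfolding g_def by (intro holomorphic_intros) auto
  have ul: "uniform_limit (ball z e) g limit_fun sequentially"
    unfolding uniform_limit_iff
  proof (intro allI impI)
    fix d :: real assume "d > 0"
    then have "\<forall>\<^sub>F n in sequentially. \<forall>\<zeta>\<in>K N. dist (r n \<zeta> 0) (limit_taylor \<zeta> 0) < d"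
      using uniform_limit_taylor[where N = N and k = 0] by (simp add: uniform_limit_iff)
    then have "\<forall>\<^sub>F n in sequentially. \<forall>\<zeta>\<in>K N. dist (r (n + N) \<zeta> 0) (limit_taylor \<zeta> 0) < d"
      by (rule sequentially_offset)
    then show "\<forall>\<^sub>F n in sequentially. \<forall>\<zeta>\<in>ball z e. dist (g n \<zeta>) (limit_fun \<zeta>) < d"
      by eventually_elim (use e(2) in \<open>auto simp: g_def rat_taylor_def limit_fun_def\<close>)
  qed
  have holl: "limit_fun holomorphic_on ball z e"
  proof (rule holomorphic_uniform_sequence[OF open_ball hol])
    fix x assume "x \<in> ball z e"
    then obtain d where "d > 0" "cball x d \<subseteq> ball z e" by (meson open_ball open_contains_cball)
    then show "\<exists>d>0. cball x d \<subseteq> ball z e \<and> uniform_limit (cball x d) g limit_fun sequentially"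
      using uniform_limit_on_subset[OF ul] by blast
  qed
  have "(deriv ^^ k) limit_fun w = fact k * limit_taylor w k" if w: "w \<in> ball z e" for k w
  proof (rule LIMSEQ_unique)
    show "(\<lambda>n. (deriv ^^ k) (g n) w) \<longlonglongrightarrow> (deriv ^^ k) limit_fun w"
      by (rule higher_deriv_complex_uniform_limit[OF ul]) (use hol w in auto)
    have "(\<lambda>n. r n w k) \<longlonglongrightarrow> limit_taylor w k" using convergent_taylor w e(2) by blast
    then have "(\<lambda>n. fact k * r (n + N) w k) \<longlonglongrightarrow> fact k * limit_taylor w k"
      by (intro tendsto_intros LIMSEQ_ignore_initial_segment)
    then show "(\<lambda>n. (deriv ^^ k) (g n) w) \<longlonglongrightarrow> fact k * limit_taylor w k"
      by (simp add: g_def rat_taylor_def)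
  qed
  then show thesis using that e(1) holl by blast
qed

lemma limit_fun_deriv: "z \<in> \<Omega> \<Longrightarrow> (deriv ^^ k) limit_fun z = fact k * limit_taylor z k"
  using limit_fun_local[of z] by (metis centre_in_ball)

lemma limit_fun_holomorphic: "limit_fun holomorphic_on \<Omega>"
proof -
  have "limit_fun field_differentiable at z" if "z \<in> \<Omega>" for z
    using limit_fun_local[OF that] by (metis centre_in_ball holomorphic_on_imp_differentiable_at open_ball)
  then show ?thesis by (simp add: holomorphic_on_def field_differentiable_at_within)
qed

lemma \<Omega>_sub: "\<Omega> \<subseteq> closure \<Omega> - M"
  using closure_subset M_sub open_\<Omega> by (auto simp: frontier_def interior_open)

text \<open>At boundary points off \<open>M\<close> the limit from within \<Omega> is the value of
  the continuous function k! \<open>limit_taylor\<close>, which agrees with the derivative on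
  \<Omega>.\<close>

lemma deriv_ext_limit_fun:
  assumes z: "z \<in> closure \<Omega> - M"
  shows "deriv_ext \<Omega> limit_fun k z = fact k * limit_taylor z k"
proof (cases "z \<in> \<Omega>")
  case False
  have "((\<lambda>\<zeta>. fact k * limit_taylor \<zeta> k) \<longlongrightarrow> fact k * limit_taylor z k) (at z within closure \<Omega> - M)"
    using continuous_limit_taylor z by (intro tendsto_intros) (auto simp: continuous_on_def)
  then have "((\<lambda>\<zeta>. fact k * limit_taylor \<zeta> k) \<longlongrightarrow> fact k * limit_taylor z k) (at z within \<Omega>)"
    using \<Omega>_sub by (rule tendsto_within_subset)
  then have "((deriv ^^ k) limit_fun \<longlongrightarrow> fact k * limit_taylor z k) (at z within \<Omega>)"
    by (rule Lim_transform_within[of _ _ _ _ 1]) (auto simp: limit_fun_deriv)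
  \<comment> \<open>A point of the closure outside \<Omega> is a limit point of \<Omega>, so the
    limit in \<open>deriv_ext\<close> is unique.\<close>
  moreover have "at z within \<Omega> \<noteq> bot"
    using z False by (simp add: trivial_limit_within closure_def)
  ultimately show ?thesis using False by (simp add: deriv_ext_def tendsto_Lim)
qed (simp add: deriv_ext_def limit_fun_deriv)

lemma taylor_coeff_limit_fun:
  assumes "z \<in> closure \<Omega> - M"
  shows "taylor_coeff \<Omega> limit_fun z (int k) = limit_taylor z k"
  using deriv_ext_limit_fun[OF assms] by (simp add: taylor_coeff_def)

lemma limit_fun_extends: "S \<subseteq> closure \<Omega> - M \<Longrightarrow> extends_continuously \<Omega> S ((deriv ^^ k) limit_fun)"
  unfolding extends_continuously_def using \<Omega>_sub
  by (intro exI[of _ "\<lambda>\<zeta>. fact k * limit_taylor \<zeta> k"] conjI continuous_on_mult_left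
      continuous_on_subset[OF continuous_limit_taylor]) (auto simp: limit_fun_deriv)

end

section \<open>Assembling the universal function\<close>

theorem proposition5p1:
  fixes \<Omega> S T :: "complex set"
  assumes "open \<Omega>"
    and "S \<subseteq> frontier \<Omega>" and "T \<subseteq> frontier \<Omega>"
    and "closure S \<inter> closure T = {}"
  shows "V S T \<Omega> \<noteq> {}"
proof -
  obtain M M' where M: "closed M" "closed M'" "M \<union> M' = frontier \<Omega>" "S \<inter> M = {}" "T \<inter> M' = {}"
    using separating_frontier_cover[OF assms(4)] by metis
  \<comment> \<open>\<open>K\<close> exhausts closure \<Omega> - M, which contains \<Omega> \<union>
    S; \<open>L\<close> exhausts the complement of \<Omega> without M', which contains
    \<open>T\<close> and the complement of closure \<Omega>.\<close>
  define K where "K = exhaustion (closure \<Omega>) M"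
  define L where "L = exhaustion (- \<Omega>) M'"
  have cK: "compact (K n)" for n by (simp add: K_def compact_exhaustion)
  have cL: "compact (L n)" for n using assms(1) by (simp add: L_def compact_exhaustion closed_Compl)
  \<comment> \<open>A common point would lie on the frontier, hence in \<open>M\<close> or M', but
    \<open>K n\<close> avoids the one and \<open>L n\<close> the other.\<close>
  have KL: "K n \<inter> L n = {}" for n
  proof -
    have "z \<notin> L n" if "z \<in> K n" for z
    proof
      assume "z \<in> L n"
      then have "z \<in> frontier \<Omega>" using that assms(1)
        by (auto simp: K_def L_def exhaustion_def frontier_def interior_open)
      then have "z \<in> M \<or> z \<in> M'" using M(3) by blast
      then show False using that \<open>z \<in> L n\<close> by (force simp: K_def L_def exhaustion_def)
    qed
    then show ?thesis by blast
  qed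
  obtain h :: "nat \<Rightarrow> complex poly fract" where h:
    "\<And>g L \<epsilon> N. compact L \<Longrightarrow> \<epsilon> > 0 \<Longrightarrow> \<exists>n\<ge>N. \<forall>z\<in>L. chordal (rat_eval (h n) z) (rat_eval g z) \<le> \<epsilon>"
    using chordally_dense_sequence by metis
  obtain A B \<eta> l where stage: "\<And>n. good_stage (K n) (L n) (h n) (1 / real (Suc n)) (A n) (B n) (\<eta> n) (l n)"
    and seq: "\<And>n. n \<le> l n" "\<And>n. l n \<le> l (Suc n)" "\<And>n. \<eta> (Suc n) \<le> \<eta> n / 2"
    "\<And>n \<zeta> k. \<zeta> \<in> K n \<Longrightarrow> k \<le> l n \<Longrightarrow>
       cmod (rat_taylor (A (Suc n)) (B (Suc n)) \<zeta> k - rat_taylor (A n) (B n) \<zeta> k) \<le> \<eta> n / 2"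
    by (rule stage_sequence[of K L h])
       (use cK cL KL exhaustion_mono[of _ "Suc _"] exhaustion_push in \<open>auto simp: K_def\<close>)
  interpret stage_limit \<Omega> M A B \<eta> l
    using assms(1) M seq stage by unfold_locales (auto simp: good_stage_def K_def)
  have \<Omega>S: "\<Omega> \<union> S \<subseteq> closure \<Omega> - M"
    using \<Omega>_sub assms(2) M(4) by (auto simp: frontier_def)
  have KW: "K n \<subseteq> closure \<Omega> - M" for n by (force simp: K_def exhaustion_def)
  \<comment> \<open>The coefficients of the limit stay within \<open>\<eta> n\<close> of stage
    \<open>n\<close> up to order \<open>l n\<close>, so the stability recorded in every stage
    applies to the limit.\<close>
  have good: "good_pade (K n) (L n) (A n) (B n) (1 / real (Suc n)) (degree (A n)) (degree (B n)) (taylor_coeff \<Omega> limit_fun)" for n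
  proof -
    have "cmod (taylor_coeff \<Omega> limit_fun \<zeta> (int k) - rat_taylor (A n) (B n) \<zeta> k) \<le> \<eta> n"
      if "\<zeta> \<in> K n" "k \<le> l n" for \<zeta> k
    proof -
      have "taylor_coeff \<Omega> limit_fun \<zeta> (int k) = limit_taylor \<zeta> k"
        using KW that(1) by (intro taylor_coeff_limit_fun) blast
      then show ?thesis using limit_taylor_close[of \<zeta> n k] that by (simp add: K_def)
    qed
    then show ?thesis
      using stage[of n] unfolding good_stage_def by (auto simp: taylor_coeff_def)
  qed
  have "limit_fun \<in> V S T \<Omega>"
    unfolding V_def
  proof (intro CollectI conjI allI impI)
    show "limit_fun holomorphic_on \<Omega>" by (rule limit_fun_holomorphic)
    show "extends_continuously \<Omega> S ((deriv ^^ k) limit_fun)" for k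
      using \<Omega>S by (intro limit_fun_extends) auto
    fix g J2 assume J2: "compact J2 \<and> J2 \<subseteq> (UNIV - closure \<Omega>) \<union> T"
    have "J2 \<subseteq> - \<Omega>"
      using J2 assms(1,3) closure_subset[of \<Omega>] by (auto simp: frontier_def interior_open)
    moreover have "J2 \<inter> M' = {}" using J2 M(3,5) by (auto simp: frontier_def)
    ultimately obtain N2 where N2: "\<And>n. n \<ge> N2 \<Longrightarrow> J2 \<subseteq> L n"
      using exhaustion_absorbs[of J2 "- \<Omega>" M'] J2 M(2) unfolding L_def by metis
    \<comment> \<open>Stages whose target is within 1 / (k + 1) of \<open>g\<close> on
      \<open>J2\<close> occur arbitrarily late.\<close>
    have "\<exists>n\<ge>max N2 k. \<forall>z\<in>J2. chordal (rat_eval (h n) z) (rat_eval g z) \<le> 1 / real (Suc k)" for k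
      using J2 by (intro h) auto
    then obtain \<nu> where \<nu>: "\<And>k. \<nu> k \<ge> max N2 k"
      "\<And>k z. z \<in> J2 \<Longrightarrow> chordal (rat_eval (h (\<nu> k)) z) (rat_eval g z) \<le> 1 / real (Suc k)" by metis
    \<comment> \<open>These degrees depend on \<open>g\<close> and \<open>J2\<close> but not on
      \<open>J1\<close>, which only decides from which index on the estimates hold.\<close>
    define p q where "p = (\<lambda>k. degree (A (\<nu> k)))" and "q = (\<lambda>k. degree (B (\<nu> k)))"
    let ?P = "\<lambda>k \<zeta>. pade (taylor_coeff \<Omega> limit_fun \<zeta>) (p k) (q k) \<zeta>"
    have small: "1 / real (Suc (\<nu> k)) \<le> 1 / real (Suc k)" for k using \<nu>(1)[of k] by (simp add: frac_le)
    show "\<exists>p q :: nat \<Rightarrow> nat. \<forall>J1. compact J1 \<and> J1 \<subseteq> \<Omega> \<union> S \<longrightarrow>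
         (\<exists>n0. \<forall>n\<ge>n0. \<forall>\<zeta>\<in>J1.
            in_D (taylor_coeff \<Omega> limit_fun \<zeta>) (p n) (q n) \<and>
            in_E (taylor_coeff \<Omega> limit_fun \<zeta>) (p n) (q n) \<zeta> (J1 \<union> J2)) \<and>
         ((\<lambda>n. SUP \<zeta>\<in>J1. SUP z\<in>J1.
             euclid (rat_eval (pade (taylor_coeff \<Omega> limit_fun \<zeta>) (p n) (q n) \<zeta>) z) (deriv_ext \<Omega> limit_fun 0 z))
           \<longlonglongrightarrow> 0) \<and>
         ((\<lambda>n. SUP \<zeta>\<in>J1. SUP z\<in>J2.
             ennreal (chordal (rat_eval (pade (taylor_coeff \<Omega> limit_fun \<zeta>) (p n) (q n) \<zeta>) z) (rat_eval g z)))
           \<longlonglongrightarrow> 0)"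
    proof (rule exI[of _ p], rule exI[of _ q], intro allI impI)
      fix J1 assume J1: "compact J1 \<and> J1 \<subseteq> \<Omega> \<union> S"
      then have "J1 \<subseteq> closure \<Omega>" "J1 \<inter> M = {}" using \<Omega>S by auto
      then obtain N1 where N1: "\<And>n. n \<ge> N1 \<Longrightarrow> J1 \<subseteq> K n"
        using exhaustion_absorbs[of J1 "closure \<Omega>" M] J1 M(1) unfolding K_def by metis
      have sub: "J1 \<subseteq> K (\<nu> k)" "J2 \<subseteq> L (\<nu> k)" if "k \<ge> N1" for k
        using N1[of "\<nu> k"] N2[of "\<nu> k"] \<nu>(1)[of k] that by auto
      \<comment> \<open>The Euclidean bound adds two errors, from the Pade approximant to the stage
        and from the stage to the limit. The chordal bound adds three: approximant to stage, stage
        to its target, target to \<open>g\<close>.\<close>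
      have D: "in_D (taylor_coeff \<Omega> limit_fun \<zeta>) (p k) (q k)"
        and E: "in_E (taylor_coeff \<Omega> limit_fun \<zeta>) (p k) (q k) \<zeta> (J1 \<union> J2)"
        and eu: "\<And>z. z \<in> J1 \<Longrightarrow> euclid (rat_eval (?P k \<zeta>) z) (deriv_ext \<Omega> limit_fun 0 z) \<le> ennreal (2 / real (Suc k))"
        and ch: "\<And>z. z \<in> J2 \<Longrightarrow> chordal (rat_eval (?P k \<zeta>) z) (rat_eval g z) \<le> 3 / real (Suc k)"
        if k: "k \<ge> N1" and \<zeta>: "\<zeta> \<in> J1" for k \<zeta>
      proof -
        let ?n = "\<nu> k"
        have gp: "in_D (taylor_coeff \<Omega> limit_fun \<zeta>) (p k) (q k)"
          "in_E (taylor_coeff \<Omega> limit_fun \<zeta>) (p k) (q k) \<zeta> (K ?n \<union> L ?n)"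
          "\<And>z. z \<in> K ?n \<Longrightarrow> euclid (rat_eval (?P k \<zeta>) z) (poly (A ?n) z / poly (B ?n) z) \<le> ennreal (1 / real (Suc ?n))"
          "\<And>z. z \<in> L ?n \<Longrightarrow> chordal (rat_eval (?P k \<zeta>) z) (sphere_ratio (poly (A ?n) z) (poly (B ?n) z)) \<le> 1 / real (Suc ?n)"
          using good[of ?n] sub(1)[OF k] \<zeta> unfolding good_pade_def p_def q_def by blast+
        show "in_D (taylor_coeff \<Omega> limit_fun \<zeta>) (p k) (q k)" by (rule gp(1))
        show "in_E (taylor_coeff \<Omega> limit_fun \<zeta>) (p k) (q k) \<zeta> (J1 \<union> J2)"
          using gp(2) sub[OF k] unfolding in_E_def by blast
        show "euclid (rat_eval (?P k \<zeta>) z) (deriv_ext \<Omega> limit_fun 0 z) \<le> ennreal (2 / real (Suc k))" if z: "z \<in> J1" for z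
        proof -
          have zK: "z \<in> K ?n" using z sub(1)[OF k] by blast
          have "deriv_ext \<Omega> limit_fun 0 z = limit_taylor z 0"
            using deriv_ext_limit_fun[of z 0] zK KW by auto
          moreover have "poly (A ?n) z / poly (B ?n) z = rat_taylor (A ?n) (B ?n) z 0" by (simp add: rat_taylor_def)
          moreover have "cmod (limit_taylor z 0 - rat_taylor (A ?n) (B ?n) z 0) \<le> 1 / real (Suc k)"
            using limit_taylor_close[of z ?n 0] zK \<eta>_le[of ?n] small[of k] unfolding K_def by linarith
          ultimately have 1: "ennreal (cmod (poly (A ?n) z / poly (B ?n) z - deriv_ext \<Omega> limit_fun 0 z)) \<le> ennreal (1 / real (Suc k))"
            by (intro ennreal_leI) (simp add: norm_minus_commute)
          have 2: "euclid (rat_eval (?P k \<zeta>) z) (poly (A ?n) z / poly (B ?n) z) \<le> ennreal (1 / real (Suc k))"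
            using gp(3)[OF zK] ennreal_leI[OF small[of k]] by (rule order_trans)
          have "euclid (rat_eval (?P k \<zeta>) z) (deriv_ext \<Omega> limit_fun 0 z) \<le> ennreal (1 / real (Suc k)) + ennreal (1 / real (Suc k))"
            by (rule order_trans[OF euclid_triangle add_mono[OF 2 1]])
          also have "\<dots> = ennreal (2 / real (Suc k))" by (simp flip: ennreal_plus)
          finally show ?thesis .
        qed
        show "chordal (rat_eval (?P k \<zeta>) z) (rat_eval g z) \<le> 3 / real (Suc k)" if z: "z \<in> J2" for z
        proof -
          have zL: "z \<in> L ?n" using z sub(2)[OF k] by blast
          have "chordal (sphere_ratio (poly (A ?n) z) (poly (B ?n) z)) (rat_eval (h ?n) z) \<le> 1 / real (Suc ?n)"
            using stage[of ?n] zL unfolding good_stage_def by blast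
          then have "chordal (rat_eval (?P k \<zeta>) z) (rat_eval g z) \<le> 1 / real (Suc ?n) + (1 / real (Suc ?n) + 1 / real (Suc k))"
            using gp(4)[OF zL] \<nu>(2)[OF z, of k]
              chordal_triangle[where x = "rat_eval (?P k \<zeta>) z" and y = "sphere_ratio (poly (A ?n) z) (poly (B ?n) z)" and z = "rat_eval g z"]
              chordal_triangle[where x = "sphere_ratio (poly (A ?n) z) (poly (B ?n) z)" and y = "rat_eval (h ?n) z" and z = "rat_eval g z"]
            by linarith
          also have "\<dots> \<le> 1 / real (Suc k) + (1 / real (Suc k) + 1 / real (Suc k))" using small[of k] by linarith
          also have "\<dots> = 3 / real (Suc k)" by (simp add: field_simps)
          finally show ?thesis .
        qed
      qed
      show "(\<exists>n0. \<forall>n\<ge>n0. \<forall>\<zeta>\<in>J1. in_D (taylor_coeff \<Omega> limit_fun \<zeta>) (p n) (q n) \<and>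
            in_E (taylor_coeff \<Omega> limit_fun \<zeta>) (p n) (q n) \<zeta> (J1 \<union> J2)) \<and>
         ((\<lambda>n. SUP \<zeta>\<in>J1. SUP z\<in>J1. euclid (rat_eval (?P n \<zeta>) z) (deriv_ext \<Omega> limit_fun 0 z)) \<longlonglongrightarrow> 0) \<and>
         ((\<lambda>n. SUP \<zeta>\<in>J1. SUP z\<in>J2. ennreal (chordal (rat_eval (?P n \<zeta>) z) (rat_eval g z))) \<longlonglongrightarrow> 0)"
      proof (intro conjI)
        show "\<exists>n0. \<forall>n\<ge>n0. \<forall>\<zeta>\<in>J1. in_D (taylor_coeff \<Omega> limit_fun \<zeta>) (p n) (q n) \<and>
            in_E (taylor_coeff \<Omega> limit_fun \<zeta>) (p n) (q n) \<zeta> (J1 \<union> J2)"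
          using D E by blast
        show "(\<lambda>n. SUP \<zeta>\<in>J1. SUP z\<in>J1. euclid (rat_eval (?P n \<zeta>) z) (deriv_ext \<Omega> limit_fun 0 z)) \<longlonglongrightarrow> 0"
          by (rule ennreal_tendsto_0[of N1 _ 2]) (intro SUP_least eu)
        show "(\<lambda>n. SUP \<zeta>\<in>J1. SUP z\<in>J2. ennreal (chordal (rat_eval (?P n \<zeta>) z) (rat_eval g z))) \<longlonglongrightarrow> 0"
          by (rule ennreal_tendsto_0[of N1 _ 3]) (intro SUP_least ennreal_leI ch)
      qed
    qed
  qed
  then show ?thesis by blast
qed

end
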